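(* Let $n\ge2$ and $\gamma\in\mathbb R$. The mapping $f\mapsto I_1^{-\frac{n-1}2}Cf$ is an isometry of $H^\gamma L^2_r(\mathbb R^{n-1}\times\mathbb R^{n-1})$ onto itself.
   Context: $L^2_r(\mathbb R^{n-1}\times\mathbb R^{n-1})$ is the set of $f\in L^2(\mathbb R^{2(n-1)})$ with $f(\mathbf x,\mathbf y)=f(\mathbf x,U\mathbf y)$ for all $(\mathbf x,\mathbf y)\in\mathbb R^{n-1}\times\mathbb R^{n-1}$ and all orthonormal transformations $U$ of $\mathbb R^{n-1}$. With $\mathcal F$ the $2(n-1)$-dimensional Fourier transform (convention $\int e^{-ix\cdot\xi}g(x)\,dx$), set $$\|f\|_\gamma^2=\int_{\mathbb R^{n-1}}\int_{\mathbb R^{n-1}}|\mathcal Ff(\boldsymbol\xi,\boldsymbol\eta)|^2(1+|\boldsymbol\xi|^2)^\gamma\,d\boldsymbol\xi\,d\boldsymbol\eta,$$ and $H^\gamma L^2_r(\mathbb R^{n-1}\times\mathbb R^{n-1})=\{f\in L^2_r(\mathbb R^{n-1}\times\mathbb R^{n-1}):\|f\|_\gamma<\infty\}$, with norm $\|\cdot\|_\gamma$. The cone transform is $Cf(\mathbf u,\mathbf v)=\int_{\mathbb R^{n-1}}f(\mathbf u+|\mathbf v|\mathbf y,\mathbf y)\,d\mathbf y$ for $(\mathbf u,\mathbf v)\in\mathbb R^{n-1}\times\mathbb R^{n-1}$. The Riesz potential $I_1^k$ acts on the first $(n-1)$-dimensional variable: $\mathcal F_1(I_1^kg)(\boldsymbol\xi,\cdot)=|\boldsymbol\xi|^{-k}\mathcal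 F_1g(\boldsymbol\xi,\cdot)$, where $\mathcal F_1$ is the $(n-1)$-dimensional Fourier transform in the first variable.
   Formalization: With the stated Fourier convention the map multiplies the norm by (2π)^{(n-1)/2}, so it is an isometry only after dividing by this constant; this corrected form is proved, with C taken as the L²-continuous extension where its integral diverges. *)

theory Defs
  imports "HOL-Analysis.Analysis"
begin

text \<open>Elements of \<open>L\<^sup>2\<close> are represented by Borel functions; equality in \<open>L\<^sup>2\<close> is \<open>ae_eq\<close>.\<close>

definition L2 :: "('a::euclidean_space \<Rightarrow> complex) set" where
  "L2 = {f \<in> borel_measurable lborel. integrable lborel (\<lambda>x. (norm (f x))\<^sup>2)}"

definition ae_eq :: "('a::euclidean_space \<Rightarrow> complex) \<Rightarrow> ('a \<Rightarrow> complex) \<Rightarrow> bool" where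
  "ae_eq f g \<longleftrightarrow> (AE x in lborel. f x = g x)"

definition L2_tendsto ::
  "('i \<Rightarrow> 'a::euclidean_space \<Rightarrow> complex) \<Rightarrow> ('a \<Rightarrow> complex) \<Rightarrow> 'i filter \<Rightarrow> bool" where
  "L2_tendsto F f A \<longleftrightarrow>
     ((\<lambda>j. \<integral>\<^sup>+x. ennreal ((norm (F j x - f x))\<^sup>2) \<partial>lborel) \<longlongrightarrow> 0) A"

definition fourier_integral :: "('a::euclidean_space \<Rightarrow> complex) \<Rightarrow> 'a \<Rightarrow> complex" where
  "fourier_integral f \<xi> = (LINT x|lborel. exp (- (\<i> * of_real (x \<bullet> \<xi>))) * f x)"

text \<open>On \<open>L\<^sup>1\<close> the Fourier transform is the integral, on \<open>L\<^sup>2\<close> it is the \<open>L\<^sup>2\<close>-limit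
  of the integrals over balls. The two agree almost everywhere on \<open>L\<^sup>1 \<inter> L\<^sup>2\<close>.\<close>

definition has_fourier ::
  "('a::euclidean_space \<Rightarrow> complex) \<Rightarrow> ('a \<Rightarrow> complex) \<Rightarrow> bool" where
  "has_fourier f F \<longleftrightarrow> F \<in> borel_measurable lborel \<and>
     (integrable lborel f \<and> ae_eq F (fourier_integral f) \<or>
      f \<in> L2 \<and> F \<in> L2 \<and>
        L2_tendsto (\<lambda>R::real. fourier_integral (\<lambda>x. indicator (cball 0 R) x * f x)) F at_top)"

definition fourier :: "('a::euclidean_space \<Rightarrow> complex) \<Rightarrow> 'a \<Rightarrow> complex" where
  "fourier f = (SOME F. has_fourier f F)"

definition L2_rad :: "('a::euclidean_space \<times> 'a \<Rightarrow> complex) set" where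
  "L2_rad = {f \<in> L2. \<forall>U. orthogonal_transformation U \<longrightarrow> (\<forall>x y. f (x, y) = f (x, U y))}"

definition H_norm_sq :: "real \<Rightarrow> ('a::euclidean_space \<times> 'a \<Rightarrow> complex) \<Rightarrow> ennreal" where
  "H_norm_sq \<gamma> f =
     (\<integral>\<^sup>+\<xi>. \<integral>\<^sup>+\<eta>. ennreal ((norm (fourier f (\<xi>, \<eta>)))\<^sup>2 * (1 + (norm \<xi>)\<^sup>2) powr \<gamma>) \<partial>lborel \<partial>lborel)"

text \<open>\<open>I\<^sub>1\<^sup>-\<^sup>d\<^sup>/\<^sup>2 C\<close> with \<open>d = DIM('a)\<close> multiplies this norm by \<open>(2\<pi>)\<^sup>d\<^sup>/\<^sup>2\<close>: the Fourier transform
  carries no prefactor, and Plancherel in the second variable leaves this constant.\<close>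

definition H_norm :: "real \<Rightarrow> ('a::euclidean_space \<times> 'a \<Rightarrow> complex) \<Rightarrow> real" where
  "H_norm \<gamma> f = sqrt (enn2real (H_norm_sq \<gamma> f))"

definition H_rad :: "real \<Rightarrow> ('a::euclidean_space \<times> 'a \<Rightarrow> complex) set" where
  "H_rad \<gamma> = {f \<in> L2_rad. H_norm_sq \<gamma> f < \<infinity>}"

definition cone_transform :: "('a::euclidean_space \<times> 'a \<Rightarrow> complex) \<Rightarrow> 'a \<times> 'a \<Rightarrow> complex" where
  "cone_transform f = (\<lambda>(u, v). LINT y|lborel. f (u + norm v *\<^sub>R y, y))"

text \<open>\<open>is_riesz1 k g h\<close> says \<open>h = I\<^sub>1\<^sup>k g\<close>, with the Fourier transform in the first variable
  taken slice by slice.\<close>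

definition is_riesz1 ::
  "real \<Rightarrow> ('a::euclidean_space \<times> 'a \<Rightarrow> complex) \<Rightarrow> ('a \<times> 'a \<Rightarrow> complex) \<Rightarrow> bool" where
  "is_riesz1 k g h \<longleftrightarrow>
     (AE v in lborel. \<exists>G H. has_fourier (\<lambda>x. g (x, v)) G \<and> has_fourier (\<lambda>x. h (x, v)) H \<and>
        (AE \<xi> in lborel. H \<xi> = of_real (norm \<xi> powr (- k)) * G \<xi>))"

text \<open>\<open>is_riesz_cone k f g\<close> says \<open>g = I\<^sub>1\<^sup>k C f\<close>. The integral defining \<open>C f\<close> need not converge for
  \<open>f\<close> in \<open>L\<^sup>2\<close>. If \<open>f\<close> is also in \<open>L\<^sup>1\<close>, then \<open>C f (\<cdot>, v)\<close> is in \<open>L\<^sup>1\<close> for every \<open>v\<close>; the map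
  is taken literally there and extended to all of \<open>L2_rad\<close> by \<open>L\<^sup>2\<close>-limits.\<close>

definition is_riesz_cone ::
  "real \<Rightarrow> ('a::euclidean_space \<times> 'a \<Rightarrow> complex) \<Rightarrow> ('a \<times> 'a \<Rightarrow> complex) \<Rightarrow> bool" where
  "is_riesz_cone k f g \<longleftrightarrow> f \<in> L2_rad \<and> g \<in> L2_rad \<and>
     (\<exists>F G. (\<forall>j::nat. F j \<in> L2_rad \<and> integrable lborel (F j) \<and> G j \<in> L2 \<and>
                  is_riesz1 k (cone_transform (F j)) (G j)) \<and>
        L2_tendsto F f sequentially \<and> L2_tendsto G g sequentially)"

end

theory Submission
  imports Defs "HOL-Probability.Characteristic_Functions"
begin

text \<open>For \<open>f\<close> in \<open>L\<^sup>1 \<inter> L\<^sup>2\<close>, Fubini gives \<open>F\<^sub>1 (C f) (\<xi>, v) = F f (\<xi>, - |v| \<xi>)\<close>, which for \<open>f\<close> radial in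
  the second variable is \<open>F f (\<xi>, |\<xi>| v)\<close>. Hence \<open>g = I\<^sub>1\<^sup>-\<^sup>d\<^sup>/\<^sup>2 C f\<close> is characterized by
  \<open>F\<^sub>1 g (\<xi>, v) = |\<xi>|\<^sup>d\<^sup>/\<^sup>2 F f (\<xi>, |\<xi>| v)\<close>: the map is \<open>F\<^sub>1\<^sup>-\<^sup>1 D F\<close>, where the dilation \<open>D\<close> is unitary in
  \<open>v\<close> for each fixed \<open>\<xi> \<noteq> 0\<close>. Plancherel in \<open>v\<close>, applied for almost every \<open>\<xi>\<close>, turns this into an
  isometry up to \<open>(2\<pi>)\<^sup>d\<^sup>/\<^sup>2\<close> for any weight in \<open>\<xi>\<close>, and each of the three factors is invertible on
  radial functions.\<close>

text \<open>Two obstacles shape the proof. The integral \<open>C f\<close> need not converge for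
  \<open>f\<close> in L2, so the Fubini identity is available only on integrable functions;
  everything else is carried by L2 limits, which works because the Fourier side is an isometry up to
  a constant. Moreover \<open>L2_rad\<close> asks for invariance at every point, while L2 transforms
  exist only up to null sets; the transforms are therefore built as pointwise limits with default
  value 0, which keep the symmetry. The exponent d/2 is forced: |\<xi>|^d is the Jacobian of v ->
  |\<xi>| v, so the multiplier of the Riesz potential is exactly the factor that makes the dilation
  unitary. The constant is a quotient on squared norms: the full transform in 2d variables
  contributes (2\<pi>)^(2d), and undoing the partial one removes (2\<pi>)^d. Conjugation takes the
  place of reflection in the inversion formula, so that forward transforms alone suffice for both
  directions.\<close>

section \<open>Subsequences and limits of nonnegative integrals\<close>

lemma extract_subseq:
  assumes "\<And>n. eventually (P n) sequentially"
  obtains r :: "nat \<Rightarrow> nat" where "strict_mono r" "\<And>n. P n (r n)"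
proof -
  obtain N where N: "\<And>n m. m \<ge> N n \<Longrightarrow> P n m"
    using assms unfolding eventually_sequentially by metis
  \<comment> \<open>\<open>Suc k\<close> forces strict growth, and \<open>N (Suc n)\<close> keeps
    every index beyond its own threshold.\<close>
  define r where "r = rec_nat (N 0) (\<lambda>n k. max (Suc k) (N (Suc n)))"
  have r0: "r 0 = N 0" and rS: "r (Suc n) = max (Suc (r n)) (N (Suc n))" for n
    by (auto simp: r_def)
  have "strict_mono r" by (auto simp: strict_mono_Suc_iff rS)
  moreover have "r n \<ge> N n" for n by (cases n) (auto simp: r0 rS)
  then have "P n (r n)" for n using N by auto
  ultimately show ?thesis using that by blast
qed

text \<open>Along a subsequence with integrals below (1/2)^n the sum of the functions has finite
  integral, so it is finite almost everywhere and its terms vanish. This passes from L2 convergence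
  in two variables to convergence on almost every slice.\<close>

lemma nn_integral_tendsto_0_AE_subseq:
  fixes u :: "nat \<Rightarrow> 'a \<Rightarrow> ennreal"
  assumes [measurable]: "\<And>n. u n \<in> borel_measurable M"
    and lim: "(\<lambda>n. \<integral>\<^sup>+x. u n x \<partial>M) \<longlonglongrightarrow> 0"
  obtains r :: "nat \<Rightarrow> nat" where "strict_mono r" "AE x in M. (\<lambda>n. u (r n) x) \<longlonglongrightarrow> 0"
proof -
  have "eventually (\<lambda>m. (\<integral>\<^sup>+x. u m x \<partial>M) < ennreal ((1/2)^n)) sequentially" for n :: nat
    by (rule order_tendstoD(2)[OF lim]) auto
  then obtain r :: "nat \<Rightarrow> nat" where r: "strict_mono r"
    and le: "\<And>n. (\<integral>\<^sup>+x. u (r n) x \<partial>M) < ennreal ((1/2)^n)"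
    by (rule extract_subseq[where P = "\<lambda>n m. (\<integral>\<^sup>+x. u m x \<partial>M) < ennreal ((1/2)^n)"]) blast
  have "(\<integral>\<^sup>+x. (\<Sum>n. u (r n) x) \<partial>M) = (\<Sum>n. \<integral>\<^sup>+x. u (r n) x \<partial>M)"
    by (rule nn_integral_suminf) simp
  also have "\<dots> \<le> (\<Sum>n. ennreal ((1/2)^n))"
    by (intro suminf_le less_imp_le le) auto
  also have "\<dots> < \<infinity>"
    by (subst suminf_ennreal2) (auto simp: summable_geometric)
  finally have "(\<integral>\<^sup>+x. (\<Sum>n. u (r n) x) \<partial>M) \<noteq> \<infinity>" by simp
  then have "AE x in M. (\<Sum>n. u (r n) x) \<noteq> \<infinity>"
    by (intro nn_integral_PInf_AE) auto
  then have "AE x in M. (\<lambda>n. u (r n) x) \<longlonglongrightarrow> 0"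
  proof eventually_elim
    case (elim x)
    have fin: "u (r n) x < \<infinity>" for n
      using elim by (metis infinity_ennreal_def ennreal_suminf_lessD less_top)
    then have eq: "u (r n) x = ennreal (enn2real (u (r n) x))" for n by simp
    have "summable (\<lambda>n. enn2real (u (r n) x))"
      using elim by (intro summable_suminf_not_top) (auto simp: eq[symmetric])
    then have "(\<lambda>n. ennreal (enn2real (u (r n) x))) \<longlonglongrightarrow> ennreal 0"
      by (intro tendsto_ennrealI summable_LIMSEQ_zero)
    then show ?case using eq by simp
  qed
  with r show ?thesis using that by blast
qed

lemma borel_measurable_cnj [measurable]:
  "f \<in> borel_measurable M \<Longrightarrow> (\<lambda>x. cnj (f x)) \<in> borel_measurable M"
  by (rule measurable_compose[OF _ borel_measurable_continuous_onI[OF continuous_on_cnj[OF continuous_on_id]]])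

lemma ennreal_tendsto_0I:
  assumes "\<And>e::real. e > 0 \<Longrightarrow> eventually (\<lambda>x. f x \<le> ennreal e) F"
  shows "(f \<longlongrightarrow> (0::ennreal)) F"
proof (rule order_tendstoI)
  fix a :: ennreal assume "0 < a"
  then obtain e :: ennreal where e: "0 < e" "e < a" using dense by blast
  then have "e \<noteq> top" by auto
  then obtain r where r: "e = ennreal r" "r > 0" using e by (cases e) auto
  show "\<forall>\<^sub>F x in F. f x < a"
    using assms[OF r(2)] by eventually_elim (use e r in auto)
qed auto

section \<open>The squared L2 norm and L2 convergence\<close>

text \<open>Squared and with values in \<open>ennreal\<close>, so that Tonelli, Fatou and monotone
  convergence apply without integrability conditions and an isometry up to a factor is a single
  equation.\<close>

definition L2_sq :: "('a::euclidean_space \<Rightarrow> complex) \<Rightarrow> ennreal" where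
  "L2_sq f = (\<integral>\<^sup>+x. ennreal ((norm (f x))\<^sup>2) \<partial>lborel)"

lemma L2_measurable [measurable_dest]: "f \<in> L2 \<Longrightarrow> f \<in> borel_measurable borel"
  by (simp add: L2_def)

lemma L2_iff: "f \<in> L2 \<longleftrightarrow> f \<in> borel_measurable borel \<and> L2_sq f < \<infinity>"
proof -
  have "f \<in> borel_measurable borel \<Longrightarrow> (\<lambda>x. (norm (f x))\<^sup>2) \<in> borel_measurable borel" by measurable
  then show ?thesis
    unfolding L2_def L2_sq_def by (auto simp: integrable_iff_bounded)
qed

lemma L2_sq_finite: "f \<in> L2 \<Longrightarrow> L2_sq f < \<infinity>"
  by (simp add: L2_iff)

lemma L2_tendsto_iff: "L2_tendsto F f A \<longleftrightarrow> ((\<lambda>j. L2_sq (\<lambda>x. F j x - f x)) \<longlongrightarrow> 0) A"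
  by (simp add: L2_tendsto_def L2_sq_def)

lemma L2_sq_cong_AE: "AE x in lborel. f x = g x \<Longrightarrow> L2_sq f = L2_sq g"
  unfolding L2_sq_def by (rule nn_integral_cong_AE) auto

lemma L2_sq_eq_0_iff:
  assumes [measurable]: "f \<in> borel_measurable borel"
  shows "L2_sq f = 0 \<longleftrightarrow> (AE x in lborel. f x = 0)"
  unfolding L2_sq_def by (subst nn_integral_0_iff_AE) auto

lemma L2_sq_cmult: "L2_sq (\<lambda>x. c * f x) = ennreal ((norm c)\<^sup>2) * L2_sq f"
  if [measurable]: "f \<in> borel_measurable borel"
  unfolding L2_sq_def
  by (subst nn_integral_cmult[symmetric]) (auto simp: norm_mult power_mult_distrib ennreal_mult)

lemma L2_sq_cnj [simp]: "L2_sq (\<lambda>x. cnj (f x)) = L2_sq f"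
  by (simp add: L2_sq_def)

lemma L2_sq_minus_commute: "L2_sq (\<lambda>x. f x - g x) = L2_sq (\<lambda>x. g x - f x)"
  by (simp add: L2_sq_def norm_minus_commute)

lemma L2_sq_mono: "(\<And>x. norm (f x) \<le> norm (g x)) \<Longrightarrow> L2_sq f \<le> L2_sq g"
  unfolding L2_sq_def by (intro nn_integral_mono ennreal_leI power_mono) auto

text \<open>Young's inequality bounds the cross term 2|a||b| by e|a|^2 + |b|^2/e. For e = 1 it
  yields the substitute for the triangle inequality that suits squared norms.\<close>

lemma norm_add_sq_le:
  fixes a b :: complex
  assumes "e > 0"
  shows "(norm (a + b))\<^sup>2 \<le> (1 + e) * (norm a)\<^sup>2 + (1 + 1/e) * (norm b)\<^sup>2"
proof -
  have "(norm (a+b))\<^sup>2 \<le> (norm a + norm b)\<^sup>2"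
    by (intro power_mono norm_triangle_ineq) auto
  also have "\<dots> \<le> (1 + e) * (norm a)\<^sup>2 + (1 + 1/e) * (norm b)\<^sup>2"
  proof -
    have "0 \<le> (e * norm a - norm b)\<^sup>2 / e" using assms by simp
    also have "\<dots> = e * (norm a)\<^sup>2 + (norm b)\<^sup>2 / e - 2 * norm a * norm b"
      using assms by (simp add: power2_eq_square field_simps)
    finally show ?thesis by (simp add: power2_eq_square field_simps)
  qed
  finally show ?thesis .
qed

lemma L2_sq_add_le:
  assumes [measurable]: "f \<in> borel_measurable borel" "g \<in> borel_measurable borel" and e: "e > 0"
  shows "L2_sq (\<lambda>x. f x + g x) \<le> ennreal (1 + e) * L2_sq f + ennreal (1 + 1/e) * L2_sq g"
proof -
  have "L2_sq (\<lambda>x. f x + g x) \<le>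
     (\<integral>\<^sup>+x. ennreal (1 + e) * ennreal ((norm (f x))\<^sup>2) + ennreal (1 + 1/e) * ennreal ((norm (g x))\<^sup>2) \<partial>lborel)"
    unfolding L2_sq_def
    using e by (intro nn_integral_mono)
     (auto simp flip: ennreal_mult ennreal_plus intro!: ennreal_leI norm_add_sq_le simp del: ennreal_plus)
  also have "\<dots> = ennreal (1 + e) * L2_sq f + ennreal (1 + 1/e) * L2_sq g"
    unfolding L2_sq_def by (simp add: nn_integral_add nn_integral_cmult)
  finally show ?thesis .
qed

lemma L2_sq_add_le2:
  assumes [measurable]: "f \<in> borel_measurable borel" "g \<in> borel_measurable borel"
  shows "L2_sq (\<lambda>x. f x + g x) \<le> 2 * L2_sq f + 2 * L2_sq g"
  using L2_sq_add_le[of f g 1] by simp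

lemma L2_sq_triangle2:
  assumes [measurable]: "f \<in> borel_measurable borel" "g \<in> borel_measurable borel" "h \<in> borel_measurable borel"
  shows "L2_sq (\<lambda>x. f x - h x) \<le> 2 * L2_sq (\<lambda>x. f x - g x) + 2 * L2_sq (\<lambda>x. g x - h x)"
  using L2_sq_add_le2[of "\<lambda>x. f x - g x" "\<lambda>x. g x - h x"] by simp

lemma L2_add: "f \<in> L2 \<Longrightarrow> g \<in> L2 \<Longrightarrow> (\<lambda>x. f x + g x) \<in> L2"
  using L2_sq_add_le2[of f g] by (auto simp: L2_iff ennreal_mult_less_top intro: le_less_trans)

lemma L2_cmult: "f \<in> L2 \<Longrightarrow> (\<lambda>x. c * f x) \<in> L2"
  by (auto simp: L2_iff L2_sq_cmult ennreal_mult_less_top)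

lemma L2_cnj: "f \<in> L2 \<Longrightarrow> (\<lambda>x. cnj (f x)) \<in> L2"
  by (auto simp: L2_iff)

lemma L2_diff: "f \<in> L2 \<Longrightarrow> g \<in> L2 \<Longrightarrow> (\<lambda>x. f x - g x) \<in> L2"
  using L2_add[of f "\<lambda>x. -1 * g x"] L2_cmult[of g "-1"] by simp

lemma L2_tendsto_add:
  assumes m: "\<And>j. F j \<in> borel_measurable borel" "f \<in> borel_measurable borel"
       "\<And>j. G j \<in> borel_measurable borel" "g \<in> borel_measurable borel"
    and lim: "L2_tendsto F f A" "L2_tendsto G g A"
  shows "L2_tendsto (\<lambda>j x. F j x + G j x) (\<lambda>x. f x + g x) A"
proof -
  note [measurable] = m
  have "((\<lambda>j. 2 * L2_sq (\<lambda>x. F j x - f x) + 2 * L2_sq (\<lambda>x. G j x - g x)) \<longlongrightarrow> 2 * 0 + 2 * 0) A"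
    using lim unfolding L2_tendsto_iff by (intro tendsto_add ennreal_tendsto_cmult) auto
  then have "((\<lambda>j. 2 * L2_sq (\<lambda>x. F j x - f x) + 2 * L2_sq (\<lambda>x. G j x - g x)) \<longlongrightarrow> 0) A" by simp
  then show ?thesis unfolding L2_tendsto_iff
  proof (rule tendsto_sandwich[OF _ _ tendsto_const, rotated 2])
    show "\<forall>\<^sub>F j in A. L2_sq (\<lambda>x. F j x + G j x - (f x + g x))
         \<le> 2 * L2_sq (\<lambda>x. F j x - f x) + 2 * L2_sq (\<lambda>x. G j x - g x)"
    proof (intro always_eventually allI)
      fix j
      show "L2_sq (\<lambda>x. F j x + G j x - (f x + g x))
         \<le> 2 * L2_sq (\<lambda>x. F j x - f x) + 2 * L2_sq (\<lambda>x. G j x - g x)"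
        using L2_sq_add_le2[of "\<lambda>x. F j x - f x" "\<lambda>x. G j x - g x"] m by (simp add: add_diff_add)
    qed
  qed auto
qed

lemma L2_tendsto_cmult:
  assumes m: "\<And>j. F j \<in> borel_measurable borel" "f \<in> borel_measurable borel"
    and lim: "L2_tendsto F f A"
  shows "L2_tendsto (\<lambda>j x. c * F j x) (\<lambda>x. c * f x) A"
proof -
  note [measurable] = m
  have "((\<lambda>j. ennreal ((norm c)\<^sup>2) * L2_sq (\<lambda>x. F j x - f x)) \<longlongrightarrow> ennreal ((norm c)\<^sup>2) * 0) A"
    using lim unfolding L2_tendsto_iff by (intro ennreal_tendsto_cmult) auto
  then show ?thesis unfolding L2_tendsto_iff
    by (simp add: L2_sq_cmult[symmetric] right_diff_distrib)
qed

lemma L2_tendsto_cnj: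
  "L2_tendsto F f A \<Longrightarrow> L2_tendsto (\<lambda>j x. cnj (F j x)) (\<lambda>x. cnj (f x)) A"
  unfolding L2_tendsto_iff by (simp flip: complex_cnj_diff)

text \<open>Factor the difference of squares and apply Young's inequality. The coefficient of |b|^2
  is as small as desired, and the large one multiplies only |a - b|^2; this gives continuity of the
  squared norm.\<close>

lemma abs_diff_norm_sq_le:
  fixes a b :: complex
  assumes "e > 0"
  shows "\<bar>(norm a)\<^sup>2 - (norm b)\<^sup>2\<bar> \<le> e * (norm b)\<^sup>2 + (1 + 1/e) * (norm (a - b))\<^sup>2"
proof -
  have *: "\<bar>norm a - norm b\<bar> \<le> norm (a-b)" by (rule norm_triangle_ineq3)
  then have **: "norm a + norm b \<le> 2 * norm b + norm (a-b)" by linarith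
  have "\<bar>(norm a)\<^sup>2 - (norm b)\<^sup>2\<bar> = \<bar>norm a - norm b\<bar> * \<bar>norm a + norm b\<bar>"
    by (simp add: power2_eq_square square_diff_square_factored abs_mult mult.commute)
  also have "\<dots> \<le> norm (a-b) * (2 * norm b + norm (a-b))"
    using * ** by (intro mult_mono) auto
  also have "\<dots> \<le> e * (norm b)\<^sup>2 + (1 + 1/e) * (norm (a - b))\<^sup>2"
  proof -
    have "0 \<le> (e * norm b - norm (a-b))\<^sup>2 / e" using assms by simp
    also have "\<dots> = e * (norm b)\<^sup>2 + (norm (a-b))\<^sup>2 / e - 2 * norm b * norm (a-b)"
      using assms by (simp add: power2_eq_square field_simps)
    finally show ?thesis by (simp add: power2_eq_square field_simps)
  qed
  finally show ?thesis .
qed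

lemma L2_sq_eq_integral: "f \<in> L2 \<Longrightarrow> L2_sq f = ennreal (LINT x|lborel. (norm (f x))\<^sup>2)"
  unfolding L2_sq_def L2_def by (subst nn_integral_eq_integral) auto

lemma L2_tendsto_L2_sq:
  assumes F: "\<And>j. F j \<in> L2" and f: "f \<in> L2" and lim: "L2_tendsto F f A"
  shows "((\<lambda>j. L2_sq (F j)) \<longlongrightarrow> L2_sq f) A"
proof -
  define I where "I g = (LINT x|lborel. (norm (g x :: complex))\<^sup>2)" for g :: "'b \<Rightarrow> complex"
  have I: "g \<in> L2 \<Longrightarrow> L2_sq g = ennreal (I g)" for g unfolding I_def by (rule L2_sq_eq_integral)
  have I0: "I g \<ge> 0" for g unfolding I_def by simp
  have int: "g \<in> L2 \<Longrightarrow> integrable lborel (\<lambda>x. (norm (g x))\<^sup>2)" for g :: "'b \<Rightarrow> complex" by (simp add: L2_def)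
  have dL: "(\<lambda>x. F j x - f x) \<in> L2" for j using F f by (rule L2_diff)
  have l0: "((\<lambda>j. I (\<lambda>x. F j x - f x)) \<longlongrightarrow> 0) A"
    using lim unfolding L2_tendsto_iff I[OF dL] by (simp add: I0 tendsto_ennreal_iff[of _ _ 0] flip: ennreal_0)
  have bound: "\<bar>I (F j) - I f\<bar> \<le> e * I f + (1 + 1/e) * I (\<lambda>x. F j x - f x)" if "e > 0" for e j
  proof -
    have "\<bar>I (F j) - I f\<bar> = \<bar>LINT x|lborel. (norm (F j x))\<^sup>2 - (norm (f x))\<^sup>2\<bar>"
      unfolding I_def using int F f by (subst Bochner_Integration.integral_diff) auto
    also have "\<dots> \<le> (LINT x|lborel. \<bar>(norm (F j x))\<^sup>2 - (norm (f x))\<^sup>2\<bar>)"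
      by (rule integral_abs_bound)
    also have "\<dots> \<le> (LINT x|lborel. e * (norm (f x))\<^sup>2 + (1 + 1/e) * (norm (F j x - f x))\<^sup>2)"
      by (intro integral_mono Bochner_Integration.integrable_add integrable_mult_right int f F dL
           Bochner_Integration.integrable_abs Bochner_Integration.integrable_diff abs_diff_norm_sq_le that)
    also have "\<dots> = e * I f + (1 + 1/e) * I (\<lambda>x. F j x - f x)"
      unfolding I_def using int[OF dL] int[OF f] by simp
    finally show ?thesis .
  qed
  have "((\<lambda>j. I (F j)) \<longlongrightarrow> I f) A"
  proof (rule tendstoI)
    fix d :: real assume d: "d > 0"
    \<comment> \<open>Chosen so that the term \<open>e * I f\<close>, which does not tend to zero,
      stays below d/2; the \<open>+ 1\<close> covers \<open>I f = 0\<close>.\<close>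
    define e where "e = d / (2 * (I f + 1))"
    have e: "e > 0" using d I0[of f] by (auto simp: e_def intro!: divide_pos_pos)
    have e2: "e * I f < d/2" using d I0[of f] by (simp add: e_def field_simps)
    have "((\<lambda>j. e * I f + (1 + 1/e) * I (\<lambda>x. F j x - f x)) \<longlongrightarrow> e * I f + (1+1/e) * 0) A"
      by (intro tendsto_intros l0)
    then have "\<forall>\<^sub>F j in A. e * I f + (1 + 1/e) * I (\<lambda>x. F j x - f x) < d"
      by (rule order_tendstoD(2)) (use e2 d in simp)
    then show "\<forall>\<^sub>F j in A. dist (I (F j)) (I f) < d"
      by eventually_elim (use bound[OF e] in \<open>auto simp: dist_real_def intro: le_less_trans\<close>)
  qed
  then show ?thesis using F f by (simp add: I tendsto_ennrealI)
qed

lemma L2_tendsto_unique: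
  assumes F: "\<And>j::nat. F j \<in> borel_measurable borel" and m: "f \<in> borel_measurable borel" "g \<in> borel_measurable borel"
    and lim: "L2_tendsto F f sequentially" "L2_tendsto F g sequentially"
  shows "AE x in lborel. f x = g x"
proof -
  note [measurable] = F m
  have "(\<lambda>j. L2_sq (\<lambda>x. f x - g x)) \<longlonglongrightarrow> 0"
  proof (rule tendsto_sandwich[OF _ _ tendsto_const])
    have "(\<lambda>j. 2 * L2_sq (\<lambda>x. F j x - f x) + 2 * L2_sq (\<lambda>x. F j x - g x)) \<longlonglongrightarrow> 2 * 0 + 2 * 0"
      using lim unfolding L2_tendsto_iff by (intro tendsto_add ennreal_tendsto_cmult) auto
    then show "(\<lambda>j. 2 * L2_sq (\<lambda>x. F j x - f x) + 2 * L2_sq (\<lambda>x. F j x - g x)) \<longlonglongrightarrow> 0" by simp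
    show "\<forall>\<^sub>F j in sequentially. L2_sq (\<lambda>x. f x - g x) \<le> 2 * L2_sq (\<lambda>x. F j x - f x) + 2 * L2_sq (\<lambda>x. F j x - g x)"
      using L2_sq_triangle2[of f "F _" g] by (simp add: L2_sq_minus_commute[of f] F m)
  qed auto
  then have "L2_sq (\<lambda>x. f x - g x) = 0" using LIMSEQ_const_iff by blast
  then show ?thesis by (subst (asm) L2_sq_eq_0_iff) auto
qed

section \<open>Completeness of L2\<close>

text \<open>The witness is a pointwise limit along a subsequence, so it inherits every pointwise symmetry
  of the sequence.\<close>
lemma L2_complete:
  fixes F :: "nat \<Rightarrow> 'a::euclidean_space \<Rightarrow> complex"
  assumes F: "\<And>j. F j \<in> L2"
    and Cauchy: "\<And>e::real. e > 0 \<Longrightarrow> \<exists>M. \<forall>m\<ge>M. \<forall>n\<ge>M. L2_sq (\<lambda>x. F m x - F n x) < ennreal e"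
  obtains r where "strict_mono r"
    "(\<lambda>x. if convergent (\<lambda>k. F (r k) x) then lim (\<lambda>k. F (r k) x) else 0) \<in> L2"
    "L2_tendsto F (\<lambda>x. if convergent (\<lambda>k. F (r k) x) then lim (\<lambda>k. F (r k) x) else 0) sequentially"
proof -
  have [measurable]: "F j \<in> borel_measurable borel" for j using F by (simp add: L2_iff)
  \<comment> \<open>The rate (1/4)^k leaves room for a weight 2^k: the weighted squared increments
    remain summable.\<close>
  have "\<exists>M. \<forall>m\<ge>M. \<forall>n\<ge>M. L2_sq (\<lambda>x. F m x - F n x) < ennreal ((1/4)^k)" for k
    by (rule Cauchy) auto
  then have "\<forall>\<^sub>F M in sequentially. \<forall>m\<ge>M. \<forall>n\<ge>M. L2_sq (\<lambda>x. F m x - F n x) < ennreal ((1/4)^k)" for k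
    unfolding eventually_sequentially by (meson order_trans)
  then obtain r where r: "strict_mono r"
    and le: "\<And>k m n. m \<ge> r k \<Longrightarrow> n \<ge> r k \<Longrightarrow> L2_sq (\<lambda>x. F m x - F n x) < ennreal ((1/4)^k)"
    by (rule extract_subseq[where P = "\<lambda>k M. \<forall>m\<ge>M. \<forall>n\<ge>M. L2_sq (\<lambda>x. F m x - F n x) < ennreal ((1/4)^k)"]) blast
  have le': "L2_sq (\<lambda>x. F (r (Suc k)) x - F (r k) x) \<le> ennreal ((1/4)^k)" for k
    by (rule less_imp_le, rule le) (use r[THEN strict_monoD, of k "Suc k"] in auto)
  define f where "f = (\<lambda>x. if convergent (\<lambda>k. F (r k) x) then lim (\<lambda>k. F (r k) x) else 0)"
  have f_meas [measurable]: "f \<in> borel_measurable borel"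
  proof -
    have [measurable]: "Measurable.pred borel (\<lambda>x. convergent (\<lambda>k. F (r k) x))"
      unfolding Cauchy_convergent_iff[symmetric] by measurable
    show ?thesis unfolding f_def by measurable
  qed
  \<comment> \<open>Summability of the squared increments alone would not give convergence. The
    weight 2^k makes the increments themselves eventually at most 2^(-k/2), so the telescoping
    series converges absolutely.\<close>
  have ae: "AE x in lborel. (\<lambda>k. F (r k) x) \<longlonglongrightarrow> f x"
  proof -
    have "(\<integral>\<^sup>+x. (\<Sum>k. ennreal (2^k) * ennreal ((norm (F (r (Suc k)) x - F (r k) x))\<^sup>2)) \<partial>lborel)
       = (\<Sum>k. ennreal (2^k) * L2_sq (\<lambda>x. F (r (Suc k)) x - F (r k) x))"
      unfolding L2_sq_def by (simp add: nn_integral_suminf nn_integral_cmult)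
    also have "\<dots> \<le> (\<Sum>k. ennreal (2^k) * ennreal ((1/4)^k))"
      by (intro suminf_le mult_left_mono le') auto
    also have "\<dots> = (\<Sum>k. ennreal ((1/2)^k))"
    proof -
      have "(2::real)^k * (1/4)^k = (1/2)^k" for k by (simp flip: power_mult_distrib)
      then show ?thesis by (simp flip: ennreal_mult del: ennreal_power)
    qed
    also have "\<dots> < \<infinity>" by (subst suminf_ennreal2) (auto simp: summable_geometric)
    finally have "AE x in lborel. (\<Sum>k. ennreal (2^k) * ennreal ((norm (F (r (Suc k)) x - F (r k) x))\<^sup>2)) \<noteq> \<infinity>"
      by (intro nn_integral_PInf_AE) auto
    then show ?thesis
    proof eventually_elim
      case (elim x)
      let ?d = "\<lambda>k. norm (F (r (Suc k)) x - F (r k) x)"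
      have "summable (\<lambda>k. 2^k * (?d k)\<^sup>2)"
        using elim by (intro summable_suminf_not_top) (auto simp: ennreal_mult)
      then have "(\<lambda>k. 2^k * (?d k)\<^sup>2) \<longlonglongrightarrow> 0" by (rule summable_LIMSEQ_zero)
      then have "\<forall>\<^sub>F k in sequentially. 2^k * (?d k)\<^sup>2 < 1" by (rule order_tendstoD) simp
      then have "\<forall>\<^sub>F k in sequentially. norm (?d k) \<le> (sqrt (1/2))^k"
      proof eventually_elim
        case (elim k)
        have "((sqrt (1/2))^k)\<^sup>2 = (1/2::real)^k"
          by (subst power_mult[symmetric], subst mult.commute, subst power_mult) simp
        moreover have "(?d k)\<^sup>2 \<le> (1/2)^k" using elim by (simp add: power_one_over field_simps)
        ultimately have "(?d k)\<^sup>2 \<le> ((sqrt (1/2))^k)\<^sup>2" by (simp only:)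
        then have "?d k \<le> sqrt (1/2) ^ k" by (rule power2_le_imp_le) simp
        then show ?case by simp
      qed
      moreover have "summable (\<lambda>k. (sqrt (1/2))^k)"
        by (rule summable_geometric) (simp add: real_sqrt_lt_1_iff)
      ultimately have "summable ?d"
        by (intro summable_comparison_test_ev[of ?d])
      then have "summable (\<lambda>k. F (r (Suc k)) x - F (r k) x)" by (rule summable_norm_cancel)
      then have "convergent (\<lambda>k. F (r k) x)"
      proof -
        assume "summable (\<lambda>k. F (r (Suc k)) x - F (r k) x)"
        then have "convergent (\<lambda>n. \<Sum>k<n. F (r (Suc k)) x - F (r k) x)" by (simp add: summable_iff_convergent)
        then have "convergent (\<lambda>n. F (r n) x - F (r 0) x)"
          by (subst (asm) sum_lessThan_telescope[of "\<lambda>k. F (r k) x"])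
        then have "convergent (\<lambda>n. (F (r n) x - F (r 0) x) + F (r 0) x)" by (intro convergent_add convergent_const)
        then show ?thesis by simp
      qed
      then show ?case by (simp add: f_def convergent_LIMSEQ_iff)
    qed
  qed
  \<comment> \<open>Fatou's lemma carries a bound along the subsequence over to its pointwise limit;
    with the Cauchy condition this yields convergence of the whole sequence.\<close>
  have fatou: "L2_sq (\<lambda>x. F n x - f x) \<le> C" if "\<forall>\<^sub>F k in sequentially. L2_sq (\<lambda>x. F n x - F (r k) x) \<le> C" for n C
  proof -
    have "L2_sq (\<lambda>x. F n x - f x) = (\<integral>\<^sup>+x. liminf (\<lambda>k. ennreal ((norm (F n x - F (r k) x))\<^sup>2)) \<partial>lborel)"
      unfolding L2_sq_def
    proof (rule nn_integral_cong_AE, use ae in eventually_elim)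
      case (elim x)
      have "(\<lambda>k. ennreal ((norm (F n x - F (r k) x))\<^sup>2)) \<longlonglongrightarrow> ennreal ((norm (F n x - f x))\<^sup>2)"
        by (intro tendsto_intros elim)
      then show ?case by (rule lim_imp_Liminf[OF trivial_limit_sequentially, symmetric])
    qed
    also have "\<dots> \<le> liminf (\<lambda>k. L2_sq (\<lambda>x. F n x - F (r k) x))"
      unfolding L2_sq_def by (intro nn_integral_liminf) auto
    also have "\<dots> \<le> liminf (\<lambda>k::nat. C)" by (rule Liminf_mono[OF that])
    finally show ?thesis by (simp add: Liminf_const)
  qed
  have lim: "L2_tendsto F f sequentially"
    unfolding L2_tendsto_iff
  proof (rule ennreal_tendsto_0I)
    fix e' :: real assume e': "e' > 0"
    obtain M where M: "\<And>m n. m \<ge> M \<Longrightarrow> n \<ge> M \<Longrightarrow> L2_sq (\<lambda>x. F m x - F n x) < ennreal e'"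
      using Cauchy[OF e'] by blast
    show "\<forall>\<^sub>F n in sequentially. L2_sq (\<lambda>x. F n x - f x) \<le> ennreal e'"
      unfolding eventually_sequentially
    proof (intro exI allI impI)
      fix n assume n: "M \<le> n"
      have "\<forall>\<^sub>F k in sequentially. L2_sq (\<lambda>x. F n x - F (r k) x) \<le> ennreal e'"
        unfolding eventually_sequentially
      proof (intro exI allI impI)
        fix k assume "M \<le> k"
        then have "M \<le> r k" using seq_suble[OF r, of k] by linarith
        then show "L2_sq (\<lambda>x. F n x - F (r k) x) \<le> ennreal e'" using M[OF n] by (intro less_imp_le)
      qed
      then show "L2_sq (\<lambda>x. F n x - f x) \<le> ennreal e'" by (rule fatou)
    qed
  qed
  have "\<forall>\<^sub>F n in sequentially. L2_sq (\<lambda>x. F n x - f x) < 1"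
    by (rule order_tendstoD(2)[OF lim[unfolded L2_tendsto_iff]]) simp
  then obtain M where "L2_sq (\<lambda>x. F M x - f x) < 1" by (blast dest: eventually_happens'[OF sequentially_bot])
  then have "(\<lambda>x. F M x - f x) \<in> L2" by (auto simp: L2_iff intro: less_trans[OF _ ennreal_one_less_top])
  from L2_diff[OF F[of M] this] have "f \<in> L2" by simp
  with r lim that show ?thesis unfolding f_def by blast
qed

lemma tendsto_0_ennreal_le:
  fixes f g :: "'a \<Rightarrow> ennreal"
  assumes "(g \<longlongrightarrow> 0) F" "\<And>x. f x \<le> g x"
  shows "(f \<longlongrightarrow> 0) F"
  by (rule tendsto_sandwich[OF _ _ tendsto_const assms(1)]) (use assms(2) in auto)

section \<open>Affine changes of variables for Lebesgue measure\<close>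

lemma nn_integral_lborel_affine:
  fixes f :: "'a::euclidean_space \<Rightarrow> ennreal"
  assumes [measurable]: "f \<in> borel_measurable borel" and c: "c \<noteq> 0"
  shows "(\<integral>\<^sup>+x. f x \<partial>lborel) = ennreal (\<bar>c\<bar> ^ DIM('a)) * (\<integral>\<^sup>+x. f (t + c *\<^sub>R x) \<partial>lborel)"
  by (subst lborel_affine[OF c, of t])
     (simp add: nn_integral_density nn_integral_distr nn_integral_cmult)

lemma nn_integral_lborel_shift:
  fixes f :: "'a::euclidean_space \<Rightarrow> ennreal"
  assumes [measurable]: "f \<in> borel_measurable borel"
  shows "(\<integral>\<^sup>+x. f (t + x) \<partial>lborel) = (\<integral>\<^sup>+x. f x \<partial>lborel)"
  using nn_integral_lborel_affine[OF assms, of 1 t] by simp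

lemma nn_integral_lborel_reflect:
  fixes f :: "'a::euclidean_space \<Rightarrow> ennreal"
  assumes [measurable]: "f \<in> borel_measurable borel"
  shows "(\<integral>\<^sup>+x. f (t - x) \<partial>lborel) = (\<integral>\<^sup>+x. f x \<partial>lborel)"
  using nn_integral_lborel_affine[OF assms, of "-1" t] by simp

lemma integral_lborel_affine:
  fixes f :: "'a::euclidean_space \<Rightarrow> 'b::{banach, second_countable_topology}"
  assumes [measurable]: "f \<in> borel_measurable borel" and c: "c \<noteq> 0"
  shows "(LINT x|lborel. f x) = (\<bar>c\<bar> ^ DIM('a)) *\<^sub>R (LINT x|lborel. f (t + c *\<^sub>R x))"
  by (subst lborel_affine[OF c, of t])
     (simp add: integral_density integral_distr)

lemma integral_lborel_shift:
  fixes f :: "'a::euclidean_space \<Rightarrow> 'b::{banach, second_countable_topology}"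
  assumes [measurable]: "f \<in> borel_measurable borel"
  shows "(LINT x|lborel. f (t + x)) = (LINT x|lborel. f x)"
  using integral_lborel_affine[OF assms, of 1 t] by simp

lemma integral_lborel_reflect:
  fixes f :: "'a::euclidean_space \<Rightarrow> 'b::{banach, second_countable_topology}"
  assumes [measurable]: "f \<in> borel_measurable borel"
  shows "(LINT x|lborel. f (t - x)) = (LINT x|lborel. f x)"
  using integral_lborel_affine[OF assms, of "-1" t] by simp

lemma integrable_lborel_affine:
  fixes f :: "'a::euclidean_space \<Rightarrow> 'b::{banach, second_countable_topology}"
  assumes f: "integrable lborel f" and c: "c \<noteq> 0"
  shows "integrable lborel (\<lambda>x. f (t + c *\<^sub>R x))"
proof -
  have [measurable]: "f \<in> borel_measurable borel" using f by auto
  have "(\<integral>\<^sup>+x. norm (f x) \<partial>lborel) = ennreal (\<bar>c\<bar> ^ DIM('a)) * (\<integral>\<^sup>+x. norm (f (t + c *\<^sub>R x)) \<partial>lborel)"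
    by (rule nn_integral_lborel_affine[OF _ c]) simp
  with f have "ennreal (\<bar>c\<bar> ^ DIM('a)) * (\<integral>\<^sup>+x. norm (f (t + c *\<^sub>R x)) \<partial>lborel) < \<infinity>"
    by (simp add: integrable_iff_bounded)
  moreover have "ennreal (\<bar>c\<bar> ^ DIM('a)) \<noteq> 0" using c by simp
  ultimately show ?thesis by (auto simp: integrable_iff_bounded ennreal_mult_less_top)
qed

lemma L2_sq_shift:
  fixes f :: "'a::euclidean_space \<Rightarrow> complex"
  assumes [measurable]: "f \<in> borel_measurable borel"
  shows "L2_sq (\<lambda>x. f (x - t)) = L2_sq f"
proof -
  have "(\<lambda>x. ennreal ((norm (f x))\<^sup>2)) \<in> borel_measurable borel" by measurable
  from nn_integral_lborel_shift[OF this, of "-t"]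
  show ?thesis unfolding L2_sq_def by simp
qed

section \<open>Continuity of translations\<close>

definition L1_mod :: "('a::euclidean_space \<Rightarrow> complex) \<Rightarrow> 'a \<Rightarrow> ennreal" where
  "L1_mod f t = (\<integral>\<^sup>+x. ennreal (norm (f x - f (x - t))) \<partial>lborel)"

text \<open>Both \<open>f\<close> and its translate are replaced by \<open>g\<close>; by translation
  invariance the two errors are equal, whence the factor 2.\<close>

lemma L1_mod_le:
  assumes [measurable]: "f \<in> borel_measurable borel" "g \<in> borel_measurable borel"
  shows "L1_mod f t \<le> L1_mod g t + 2 * (\<integral>\<^sup>+x. ennreal (norm (f x - g x)) \<partial>lborel)"
proof -
  have "(\<lambda>x. ennreal (norm (f x - g x))) \<in> borel_measurable borel" by measurable
  from nn_integral_lborel_shift[OF this, of "-t"]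
  have s: "(\<integral>\<^sup>+x. ennreal (norm (f (x - t) - g (x - t))) \<partial>lborel) = (\<integral>\<^sup>+x. ennreal (norm (f x - g x)) \<partial>lborel)"
    by simp
  have "L1_mod f t \<le> (\<integral>\<^sup>+x. (ennreal (norm (g x - g (x - t))) + ennreal (norm (f x - g x)))
      + ennreal (norm (f (x - t) - g (x - t))) \<partial>lborel)"
    unfolding L1_mod_def
  proof (intro nn_integral_mono)
    fix x
    have "norm (f x - f (x - t)) \<le> norm (g x - g (x - t)) + norm (f x - g x) + norm (f (x - t) - g (x - t))"
      using norm_triangle_ineq4[of "g x - g (x-t) + (f x - g x)" "f (x-t) - g (x-t)"]
        norm_triangle_ineq[of "g x - g (x-t)" "f x - g x"] by simp
    then show "ennreal (norm (f x - f (x - t))) \<le> ennreal (norm (g x - g (x - t))) + ennreal (norm (f x - g x))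
      + ennreal (norm (f (x - t) - g (x - t)))"
      by (simp flip: ennreal_plus)
  qed
  also have "\<dots> = L1_mod g t + 2 * (\<integral>\<^sup>+x. ennreal (norm (f x - g x)) \<partial>lborel)"
    by (simp add: nn_integral_add s L1_mod_def mult_2 add.assoc)
  finally show ?thesis .
qed

text \<open>A point of an open set stays in it under small translations, so the indicators converge
  pointwise and dominated convergence applies. Openness is what gives convergence at every
  point.\<close>

lemma L1_mod_open:
  fixes U :: "'a::euclidean_space set" and t :: "nat \<Rightarrow> 'a"
  assumes U: "open U" and fin: "emeasure lborel U < \<infinity>" and t: "t \<longlonglongrightarrow> 0"
  shows "(\<lambda>n. L1_mod (\<lambda>x. indicator U x *\<^sub>R c) (t n)) \<longlonglongrightarrow> 0"
proof -
  have [measurable]: "U \<in> sets borel" using U by simp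
  define h where "h t = (\<integral>\<^sup>+x. indicator U x * indicator (-U) (x - t) \<partial>lborel)" for t :: 'a
  have h: "(\<lambda>n. h (t n)) \<longlonglongrightarrow> 0" if t: "t \<longlonglongrightarrow> 0" for t :: "nat \<Rightarrow> 'a"
  proof -
    have "(\<lambda>n. \<integral>\<^sup>+x. indicator U x * indicator (-U) (x - t n) \<partial>lborel) \<longlonglongrightarrow> (\<integral>\<^sup>+x. (0::ennreal) \<partial>(lborel :: 'a measure))"
    proof (rule nn_integral_dominated_convergence[where w = "indicator U"])
      show "AE x in lborel. (\<lambda>n. indicator U x * indicator (-U) (x - t n) :: ennreal) \<longlonglongrightarrow> 0"
      proof (intro AE_I2)
        fix x
        show "(\<lambda>n. indicator U x * indicator (-U) (x - t n) :: ennreal) \<longlonglongrightarrow> 0"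
        proof (cases "x \<in> U")
          case True
          have "(\<lambda>n. x - t n) \<longlonglongrightarrow> x - 0" by (intro tendsto_intros t)
          then have "\<forall>\<^sub>F n in sequentially. x - t n \<in> U"
            using U True by (intro topological_tendstoD) auto
          then have "\<forall>\<^sub>F n in sequentially. indicator U x * indicator (-U) (x - t n) = (0::ennreal)"
            by eventually_elim auto
          then show ?thesis by (rule tendsto_eventually)
        qed auto
      qed
      show "\<And>j. AE x in lborel. (indicator U x * indicator (-U) (x - t j) :: ennreal) \<le> indicator U x"
        by (auto simp: indicator_def)
    qed (use fin in auto)
    then show ?thesis by (simp add: h_def)
  qed
  \<comment> \<open>The symmetric difference of \<open>U\<close> and its translate has two halves.
    Shifting the half outside \<open>U\<close> by \<open>-s\<close> turns it into the first half for
    the opposite translation, so \<open>h\<close> covers both.\<close>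
  have le: "L1_mod (\<lambda>x. indicator U x *\<^sub>R c) s \<le> ennreal (norm c) * (h s + h (- s))" for s
  proof -
    have "(\<lambda>x. indicator U x * indicator (-U) (x + s) :: ennreal) \<in> borel_measurable borel" by measurable
    from nn_integral_lborel_shift[OF this, of "-s"]
    have hs: "h (-s) = (\<integral>\<^sup>+x. indicator U (x - s) * indicator (-U) x \<partial>lborel)"
      by (simp add: h_def)
    have "L1_mod (\<lambda>x. indicator U x *\<^sub>R c) s \<le>
       (\<integral>\<^sup>+x. ennreal (norm c) * (indicator U x * indicator (-U) (x - s) + indicator U (x - s) * indicator (-U) x) \<partial>lborel)"
      unfolding L1_mod_def by (intro nn_integral_mono) (auto simp: indicator_def)
    also have "\<dots> = ennreal (norm c) * (h s + h (- s))"
      unfolding hs unfolding h_def by (simp add: nn_integral_cmult nn_integral_add)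
    finally show ?thesis .
  qed
  have "(\<lambda>n. ennreal (norm c) * (h (t n) + h (- t n))) \<longlonglongrightarrow> ennreal (norm c) * (0 + 0)"
    using h[OF t] h[OF tendsto_minus[OF t, simplified]] by (intro ennreal_tendsto_cmult tendsto_add) auto
  then have "(\<lambda>n. ennreal (norm c) * (h (t n) + h (- t n))) \<longlonglongrightarrow> 0" by simp
  then show ?thesis by (rule tendsto_0_ennreal_le) (rule le)
qed

lemma L1_mod_approx:
  fixes f :: "'a::euclidean_space \<Rightarrow> complex"
  assumes f [measurable]: "f \<in> borel_measurable borel"
    and approx: "\<And>e::real. e > 0 \<Longrightarrow> \<exists>g \<in> borel_measurable borel.
      (\<integral>\<^sup>+x. ennreal (norm (f x - g x)) \<partial>lborel) \<le> ennreal e \<and> (\<lambda>n::nat. L1_mod g (t n)) \<longlonglongrightarrow> 0"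
  shows "(\<lambda>n. L1_mod f (t n)) \<longlonglongrightarrow> 0"
proof (rule ennreal_tendsto_0I)
  fix e :: real assume e: "e > 0"
  then obtain g where [measurable]: "g \<in> borel_measurable borel"
    and g: "(\<integral>\<^sup>+x. ennreal (norm (f x - g x)) \<partial>lborel) \<le> ennreal (e/4)" "(\<lambda>n. L1_mod g (t n)) \<longlonglongrightarrow> 0"
    using approx[of "e/4"] by auto
  have "\<forall>\<^sub>F n in sequentially. L1_mod g (t n) < ennreal (e/2)"
    using e by (intro order_tendstoD(2)[OF g(2)]) auto
  then show "\<forall>\<^sub>F n in sequentially. L1_mod f (t n) \<le> ennreal e"
  proof eventually_elim
    case (elim n)
    have "L1_mod f (t n) \<le> L1_mod g (t n) + 2 * (\<integral>\<^sup>+x. ennreal (norm (f x - g x)) \<partial>lborel)"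
      by (rule L1_mod_le) auto
    also have "\<dots> \<le> ennreal (e/2) + 2 * ennreal (e/4)"
      using elim g by (intro add_mono mult_left_mono) auto
    also have "\<dots> = ennreal e"
    proof -
      have "2 * ennreal (e/4) = ennreal (2 * (e/4))" using e by (subst ennreal_mult) auto
      then show ?thesis using e by (simp flip: ennreal_plus)
    qed
    finally show ?case .
  qed
qed

text \<open>Induction over integrable functions reduces the claim to indicators of sets of finite
  measure, and outer regularity replaces such a set by an open one at small L1 cost. The modulus is
  stable under L1 approximation, which also settles the limit case.\<close>

lemma L1_mod_tendsto:
  fixes f :: "'a::euclidean_space \<Rightarrow> complex"
  assumes f: "integrable lborel f" and t: "t \<longlonglongrightarrow> 0"
  shows "(\<lambda>n. L1_mod f (t n)) \<longlonglongrightarrow> 0"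
  using f
proof (induction f rule: integrable_induct)
  case (base A c)
  then have [measurable]: "A \<in> sets borel" by simp
  show ?case
  proof (rule L1_mod_approx)
    fix e :: real assume e: "e > 0"
    \<comment> \<open>The \<open>+ 1\<close> makes \<open>norm c * d \<le> e\<close> hold for
      \<open>c = 0\<close> as well.\<close>
    define d where "d = e / (norm c + 1)"
    have d: "d > 0" using e by (auto simp: d_def intro!: divide_pos_pos add_nonneg_pos)
    obtain U where U: "open U" "A \<subseteq> U" "emeasure lborel (U - A) < d"
      using outer_regular_lborel[OF _ d, of A] by auto
    have [measurable]: "U \<in> sets borel" using U by auto
    have "emeasure lborel U \<le> emeasure lborel A + emeasure lborel (U - A)"
      using U emeasure_subadditive[of A lborel "U - A"] by (auto simp: Un_absorb1)
    also have "\<dots> < \<infinity>" using base U by (auto intro: less_trans)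
    finally have fin: "emeasure lborel U < \<infinity>" .
    have "(\<integral>\<^sup>+x. ennreal (norm (indicator A x *\<^sub>R c - indicator U x *\<^sub>R c)) \<partial>lborel)
        \<le> (\<integral>\<^sup>+x. ennreal (norm c) * indicator (U - A) x \<partial>lborel)"
      using U by (intro nn_integral_mono) (auto simp: indicator_def)
    also have "\<dots> = ennreal (norm c) * emeasure lborel (U - A)"
      by (rule nn_integral_cmult_indicator) auto
    also have "\<dots> \<le> ennreal (norm c) * ennreal d" using U by (intro mult_left_mono) auto
    also have "\<dots> = ennreal (norm c * d)" by (simp add: ennreal_mult')
    also have "\<dots> \<le> ennreal e"
      using e by (intro ennreal_leI) (simp add: d_def divide_le_eq add_nonneg_pos mult.commute)
    finally show "\<exists>g\<in>borel_measurable borel. (\<integral>\<^sup>+x. ennreal (norm (indicator A x *\<^sub>R c - g x)) \<partial>lborel) \<le> ennreal e \<and>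
         (\<lambda>n. L1_mod g (t n)) \<longlonglongrightarrow> 0"
      using L1_mod_open[OF U(1) fin t, of c] by (intro bexI[of _ "\<lambda>x. indicator U x *\<^sub>R c"]) auto
  qed auto
next
  case (add f g)
  then have [measurable]: "f \<in> borel_measurable borel" "g \<in> borel_measurable borel" by auto
  have "(\<lambda>n. L1_mod f (t n) + L1_mod g (t n)) \<longlonglongrightarrow> 0 + 0"
    using add by (intro tendsto_add) auto
  then have lim: "(\<lambda>n. L1_mod f (t n) + L1_mod g (t n)) \<longlonglongrightarrow> 0" by simp
  have "L1_mod (\<lambda>x. f x + g x) s \<le> L1_mod f s + L1_mod g s" for s
    unfolding L1_mod_def
    by (subst nn_integral_add[symmetric])
       (auto intro!: nn_integral_mono simp flip: ennreal_plus simp: add_diff_add norm_triangle_ineq)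
  with lim show ?case by (rule tendsto_0_ennreal_le)
next
  case (lim f s)
  then have [measurable]: "f \<in> borel_measurable borel" "s i \<in> borel_measurable borel" for i by auto
  have l: "(\<lambda>i. \<integral>\<^sup>+x. ennreal (norm (f x - s i x)) \<partial>lborel) \<longlonglongrightarrow> 0"
    by (rule nn_integral_dominated_convergence_norm[where w = "\<lambda>x. 2 * norm (f x)"])
       (use lim in \<open>auto simp: integrable_iff_bounded ennreal_mult nn_integral_cmult ennreal_mult_less_top\<close>)
  show ?case
  proof (rule L1_mod_approx)
    fix e :: real assume "e > 0"
    then have "\<forall>\<^sub>F i in sequentially. (\<integral>\<^sup>+x. ennreal (norm (f x - s i x)) \<partial>lborel) < ennreal e"
      by (intro order_tendstoD(2)[OF l]) auto
    then obtain i where "(\<integral>\<^sup>+x. ennreal (norm (f x - s i x)) \<partial>lborel) < ennreal e"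
      by (auto simp: eventually_sequentially)
    then show "\<exists>g\<in>borel_measurable borel. (\<integral>\<^sup>+x. ennreal (norm (f x - g x)) \<partial>lborel) \<le> ennreal e \<and>
         (\<lambda>n. L1_mod g (t n)) \<longlonglongrightarrow> 0"
      using lim.IH[of i] by (intro bexI[of _ "s i"]) auto
  qed auto
qed

text \<open>Cutting off large values leaves an integrable function \<open>h\<close> bounded by
  \<open>B\<close>, for which |h - h_t|^2 \<le> 2B |h - h_t| reduces the L2 claim to the L1 one. The
  cut-off part is small in L2 and translation does not change its norm.\<close>

lemma L2_sq_translation_tendsto:
  fixes f :: "'a::euclidean_space \<Rightarrow> complex"
  assumes f: "integrable lborel f" "f \<in> L2" and t: "t \<longlonglongrightarrow> 0"
  shows "(\<lambda>n. L2_sq (\<lambda>x. f x - f (x - t n))) \<longlonglongrightarrow> 0"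
proof (rule ennreal_tendsto_0I)
  fix e :: real assume e: "e > 0"
  have [measurable]: "f \<in> borel_measurable borel" using f by auto
  define g where "g B = (\<lambda>x. if norm (f x) \<le> real B then f x else 0)" for B :: nat
  have [measurable]: "g B \<in> borel_measurable borel" for B unfolding g_def by measurable
  have "(\<lambda>B. L2_sq (\<lambda>x. f x - g B x)) \<longlonglongrightarrow> (\<integral>\<^sup>+x. (0::ennreal) \<partial>(lborel :: 'a measure))"
    unfolding L2_sq_def
  proof (rule nn_integral_dominated_convergence[where w = "\<lambda>x. ennreal ((norm (f x))\<^sup>2)"])
    show "AE x in lborel. (\<lambda>B. ennreal ((norm (f x - g B x))\<^sup>2)) \<longlonglongrightarrow> 0"
    proof (intro AE_I2)
      fix x
      have "\<forall>\<^sub>F B in sequentially. ennreal ((norm (f x - g B x))\<^sup>2) = 0"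
        using eventually_ge_at_top[of "nat \<lceil>norm (f x)\<rceil>"]
        by eventually_elim (auto simp: g_def nat_le_iff ceiling_le_iff)
      then show "(\<lambda>B. ennreal ((norm (f x - g B x))\<^sup>2)) \<longlonglongrightarrow> 0" by (rule tendsto_eventually)
    qed
    show "(\<integral>\<^sup>+x. ennreal ((norm (f x))\<^sup>2) \<partial>lborel) < \<infinity>"
      using f(2) by (simp add: L2_iff L2_sq_def)
  qed (auto simp: g_def)
  then have "(\<lambda>B. L2_sq (\<lambda>x. f x - g B x)) \<longlonglongrightarrow> 0" by simp
  \<comment> \<open>The cut-off error enters with factor 4 (itself and its translate) and is doubled
    once more, so e/16 contributes e/2 in the end.\<close>
  then have "\<forall>\<^sub>F B in sequentially. L2_sq (\<lambda>x. f x - g B x) < ennreal (e/16)"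
    using e by (rule_tac order_tendstoD(2)) auto
  then obtain B where B: "L2_sq (\<lambda>x. f x - g B x) < ennreal (e/16)"
    by (auto simp: eventually_sequentially)
  define h where "h = g B"
  have [measurable]: "h \<in> borel_measurable borel" by (simp add: h_def)
  have h: "norm (h x) \<le> B" "norm (h x) \<le> norm (f x)" for x by (auto simp: h_def g_def)
  have "integrable lborel h"
    by (rule Bochner_Integration.integrable_bound[OF f(1)]) (use h in auto)
  from L1_mod_tendsto[OF this t] have "(\<lambda>n. ennreal (2 * B) * L1_mod h (t n)) \<longlonglongrightarrow> ennreal (2 * B) * 0"
    by (intro ennreal_tendsto_cmult) auto
  then have "\<forall>\<^sub>F n in sequentially. ennreal (2 * B) * L1_mod h (t n) < ennreal (e/4)"
    using e by (rule_tac order_tendstoD(2)) auto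
  then show "\<forall>\<^sub>F n in sequentially. L2_sq (\<lambda>x. f x - f (x - t n)) \<le> ennreal e"
  proof eventually_elim
    case (elim n)
    let ?s = "t n"
    have 1: "L2_sq (\<lambda>x. h x - h (x - ?s)) \<le> ennreal (2 * B) * L1_mod h ?s"
      unfolding L2_sq_def L1_mod_def
    proof (subst nn_integral_cmult[symmetric], measurable, intro nn_integral_mono)
      fix x
      have "norm (h x - h (x - ?s)) \<le> 2 * B"
        using norm_triangle_ineq4[of "h x" "h (x - ?s)"] h(1)[of x] h(1)[of "x - ?s"] by linarith
      then show "ennreal ((norm (h x - h (x - ?s)))\<^sup>2) \<le> ennreal (2 * B) * ennreal (norm (h x - h (x - ?s)))"
        by (auto simp: power2_eq_square simp flip: ennreal_mult intro!: ennreal_leI mult_right_mono)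
    qed
    have 2: "L2_sq (\<lambda>x. (f x - h x) - (f (x - ?s) - h (x - ?s))) \<le> 4 * L2_sq (\<lambda>x. f x - h x)"
    proof -
      have "L2_sq (\<lambda>x. (f x - h x) + (-1) * (f (x - ?s) - h (x - ?s))) \<le>
          2 * L2_sq (\<lambda>x. f x - h x) + 2 * L2_sq (\<lambda>x. (-1) * (f (x - ?s) - h (x - ?s)))"
        by (rule L2_sq_add_le2) measurable
      also have "L2_sq (\<lambda>x. (-1) * (f (x - ?s) - h (x - ?s))) = L2_sq (\<lambda>x. f (x - ?s) - h (x - ?s))"
        by (subst L2_sq_cmult) auto
      also have "\<dots> = L2_sq (\<lambda>x. f x - h x)" by (rule L2_sq_shift[of "\<lambda>x. f x - h x"]) measurable
      finally show ?thesis by (simp add: algebra_simps flip: distrib_right)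
    qed
    have "L2_sq (\<lambda>x. f x - f (x - ?s)) =
        L2_sq (\<lambda>x. (h x - h (x - ?s)) + ((f x - h x) - (f (x - ?s) - h (x - ?s))))"
      by (simp add: algebra_simps)
    also have "\<dots> \<le> 2 * L2_sq (\<lambda>x. h x - h (x - ?s)) + 2 * L2_sq (\<lambda>x. (f x - h x) - (f (x - ?s) - h (x - ?s)))"
      by (rule L2_sq_add_le2) measurable
    also have "\<dots> \<le> 2 * ennreal (e/4) + 2 * (4 * ennreal (e/16))"
    proof (intro add_mono mult_left_mono)
      show "L2_sq (\<lambda>x. h x - h (x - ?s)) \<le> ennreal (e/4)" using 1 elim by (meson less_imp_le order_trans)
      have "4 * L2_sq (\<lambda>x. f x - h x) \<le> 4 * ennreal (e/16)"
        using B unfolding h_def by (intro mult_left_mono less_imp_le) auto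
      with 2 show "L2_sq (\<lambda>x. (f x - h x) - (f (x - ?s) - h (x - ?s))) \<le> 4 * ennreal (e/16)"
        by (rule order_trans)
    qed auto
    also have "\<dots> = ennreal e"
    proof -
      have "2 * ennreal (e/4) = ennreal (2 * (e/4))" using e by (subst ennreal_mult) auto
      moreover have "4 * ennreal (e/16) = ennreal (4 * (e/16))" using e by (subst ennreal_mult) auto
      moreover have "2 * ennreal (4 * (e/16)) = ennreal (2 * (4 * (e/16)))" using e by (subst ennreal_mult) auto
      ultimately show ?thesis using e by (simp flip: ennreal_plus)
    qed
    finally show ?case .
  qed
qed

section \<open>The Fourier integral\<close>

lemma integrable_fourier_kernel:
  fixes f :: "'a::euclidean_space \<Rightarrow> complex"
  assumes "integrable lborel f"
  shows "integrable lborel (\<lambda>x. exp (- (\<i> * of_real (x \<bullet> \<xi>))) * f x)"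
  by (rule Bochner_Integration.integrable_bound[OF assms]) (use assms in \<open>auto simp: norm_mult\<close>)

lemma borel_measurable_fourier_integral [measurable]:
  fixes f :: "'a::euclidean_space \<Rightarrow> complex"
  assumes [measurable]: "f \<in> borel_measurable borel"
  shows "fourier_integral f \<in> borel_measurable borel"
  unfolding fourier_integral_def by measurable

lemma norm_fourier_integral_le:
  fixes f :: "'a::euclidean_space \<Rightarrow> complex"
  shows "norm (fourier_integral f \<xi>) \<le> (LINT x|lborel. norm (f x))"
  unfolding fourier_integral_def
  by (rule order_trans[OF integral_norm_bound]) (simp add: norm_mult)

lemma fourier_integral_add:
  fixes f g :: "'a::euclidean_space \<Rightarrow> complex"
  assumes "integrable lborel f" "integrable lborel g"
  shows "fourier_integral (\<lambda>x. f x + g x) \<xi> = fourier_integral f \<xi> + fourier_integral g \<xi>"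
  unfolding fourier_integral_def using assms
  by (simp add: distrib_left integrable_fourier_kernel)

lemma fourier_integral_cmult:
  fixes f :: "'a::euclidean_space \<Rightarrow> complex"
  shows "fourier_integral (\<lambda>x. c * f x) \<xi> = c * fourier_integral f \<xi>"
  unfolding fourier_integral_def by (simp add: mult.left_commute)

lemma fourier_integral_diff:
  fixes f g :: "'a::euclidean_space \<Rightarrow> complex"
  assumes "integrable lborel f" "integrable lborel g"
  shows "fourier_integral (\<lambda>x. f x - g x) \<xi> = fourier_integral f \<xi> - fourier_integral g \<xi>"
  unfolding fourier_integral_def using assms
  by (simp add: right_diff_distrib integrable_fourier_kernel)

lemma integrable_pair_mult:
  fixes f :: "'a::euclidean_space \<Rightarrow> complex" and g :: "'b::euclidean_space \<Rightarrow> complex"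
  assumes f: "integrable lborel f" and g: "integrable lborel g"
    and [measurable]: "k \<in> borel_measurable (lborel \<Otimes>\<^sub>M lborel)" and k: "\<And>z. norm (k z) \<le> 1"
  shows "integrable (lborel \<Otimes>\<^sub>M lborel) (\<lambda>(x, y). k (x, y) * (f x * g y))"
proof (rule Bochner_Integration.integrable_bound)
  have [measurable]: "f \<in> borel_measurable borel" "g \<in> borel_measurable borel" using f g by auto
  show "integrable (lborel \<Otimes>\<^sub>M lborel) (\<lambda>(x, y). f x * g y)"
    by (rule lborel_pair.Fubini_integrable) (use f g in \<open>auto simp: norm_mult\<close>)
  show "(\<lambda>(x, y). k (x, y) * (f x * g y)) \<in> borel_measurable (lborel \<Otimes>\<^sub>M lborel)" by measurable
  show "AE z in lborel \<Otimes>\<^sub>M lborel. norm (case z of (x, y) \<Rightarrow> k (x, y) * (f x * g y)) \<le> norm (case z of (x, y) \<Rightarrow> f x * g y)"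
    using k by (auto simp: norm_mult mult_left_le_one_le)
qed

text \<open>The kernel has modulus one and is symmetric in x and \<xi>, so Fubini applies to the
  product of two integrable functions and moves the transform to the other factor.\<close>

lemma fourier_integral_multiplication:
  fixes f g :: "'a::euclidean_space \<Rightarrow> complex"
  assumes f: "integrable lborel f" and g: "integrable lborel g"
  shows "(LINT \<xi>|lborel. fourier_integral f \<xi> * g \<xi>) = (LINT x|lborel. f x * fourier_integral g x)"
proof -
  have int: "integrable (lborel \<Otimes>\<^sub>M lborel) (\<lambda>(x, \<xi>). exp (- (\<i> * of_real (x \<bullet> \<xi>))) * (f x * g \<xi>))"
  proof -
    have "integrable (lborel \<Otimes>\<^sub>M lborel) (\<lambda>(x, y). (\<lambda>(x, \<xi>). exp (- (\<i> * of_real (x \<bullet> \<xi>)))) (x, y) * (f x * g y))"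
      by (rule integrable_pair_mult[OF f g]) (auto split: prod.splits)
    then show ?thesis by simp
  qed
  have "(LINT \<xi>|lborel. fourier_integral f \<xi> * g \<xi>) =
    (LINT \<xi>|lborel. LINT x|lborel. exp (- (\<i> * of_real (x \<bullet> \<xi>))) * (f x * g \<xi>))"
    unfolding fourier_integral_def by (simp add: mult.assoc flip: integral_mult_left_zero)
  also have "\<dots> = (LINT x|lborel. LINT \<xi>|lborel. exp (- (\<i> * of_real (x \<bullet> \<xi>))) * (f x * g \<xi>))"
    by (rule lborel_pair.Fubini_integral[OF int])
  also have "\<dots> = (LINT x|lborel. f x * fourier_integral g x)"
    unfolding fourier_integral_def by (simp add: mult_ac inner_commute flip: integral_mult_right_zero)
  finally show ?thesis .
qed

section \<open>Gaussians\<close>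

text \<open>Lebesgue measure is the image of a product of real Lebesgue measures over the basis.
  This reduces Gaussian integrals to dimension one.\<close>

lemma
  fixes f :: "'a::euclidean_space \<Rightarrow> real \<Rightarrow> complex"
  assumes f: "\<And>b. b \<in> Basis \<Longrightarrow> integrable lborel (f b)"
  shows integral_lborel_prod: "(LINT x|lborel. (\<Prod>b\<in>Basis. f b (x \<bullet> b))) = (\<Prod>b\<in>Basis. (LINT t|lborel. f b t))"
    and integrable_lborel_prod: "integrable lborel (\<lambda>x::'a. \<Prod>b\<in>Basis. f b (x \<bullet> b))"
proof -
  interpret product_sigma_finite "\<lambda>_::'a. lborel :: real measure" ..
  have [measurable]: "b \<in> Basis \<Longrightarrow> f b \<in> borel_measurable borel" for b using f by auto
  have eq: "(\<Prod>b\<in>Basis. f b ((\<Sum>b\<in>Basis. g b *\<^sub>R b) \<bullet> b)) = (\<Prod>b\<in>Basis. f b (g b))" for g :: "'a \<Rightarrow> real"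
    by (intro prod.cong) auto
  show "(LINT x|lborel. (\<Prod>b\<in>Basis. f b (x \<bullet> b))) = (\<Prod>b\<in>Basis. (LINT t|lborel. f b t))"
    by (subst lborel_eq, subst integral_distr) (auto simp: eq intro!: product_integral_prod f)
  show "integrable lborel (\<lambda>x::'a. \<Prod>b\<in>Basis. f b (x \<bullet> b))"
    by (subst lborel_eq, subst integrable_distr_eq) (auto simp: eq intro!: product_integrable_prod f)
qed

text \<open>This is the characteristic function of the standard normal distribution with the
  normalizing factor cleared; it is taken at \<open>- t\<close> because of the sign in the Fourier
  kernel.\<close>

lemma
  fixes t :: real
  shows fourier_gauss_real: "(LINT x|lborel. exp (- (\<i> * of_real (x * t))) * of_real (exp (- x\<^sup>2 / 2))) =
      complex_of_real (sqrt (2 * pi) * exp (- t\<^sup>2 / 2))"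
    and integrable_gauss_real: "integrable lborel (\<lambda>x::real. exp (- (\<i> * of_real (x * t))) * complex_of_real (exp (- x\<^sup>2 / 2)))"
proof -
  have "integrable lborel std_normal_density" by (rule integrable_normal_density) simp
  then have "integrable lborel (\<lambda>x. sqrt (2 * pi) * std_normal_density x)" by simp
  then have 1: "integrable lborel (\<lambda>x::real. complex_of_real (exp (- x\<^sup>2 / 2)))"
    by (intro integrable_of_real) (simp add: std_normal_density_def)
  show "integrable lborel (\<lambda>x::real. exp (- (\<i> * of_real (x * t))) * complex_of_real (exp (- x\<^sup>2 / 2)))"
    using integrable_fourier_kernel[OF 1, of t] by simp
  have "complex_of_real (exp (- (t^2) / 2)) = char std_normal_distribution (- t)"
    by (simp add: char_std_normal_distribution)
  also have "\<dots> = (LINT x|lborel. std_normal_density x *\<^sub>R iexp (- t * x))"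
    unfolding char_def by (subst integral_density) (auto simp: normal_density_nonneg)
  also have "\<dots> = (LINT x|lborel. of_real (1 / sqrt (2 * pi)) *
      (exp (- (\<i> * of_real (x * t))) * of_real (exp (- x\<^sup>2 / 2))))"
    by (intro Bochner_Integration.integral_cong) (auto simp: std_normal_density_def scaleR_conv_of_real mult_ac)
  also have "\<dots> = of_real (1 / sqrt (2 * pi)) * (LINT x|lborel. exp (- (\<i> * of_real (x * t))) * of_real (exp (- x\<^sup>2 / 2)))"
    by (rule integral_mult_right_zero)
  finally show "(LINT x|lborel. exp (- (\<i> * of_real (x * t))) * of_real (exp (- x\<^sup>2 / 2))) =
      complex_of_real (sqrt (2 * pi) * exp (- t\<^sup>2 / 2))"
    by (simp add: field_simps)
qed

text \<open>Normalized by its value 1 at the origin instead of its integral: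
  \<open>gauss (s *\<^sub>R x)\<close> increases to 1 as s decreases to 0 and so serves as a
  convergence factor.\<close>

definition gauss :: "'a::euclidean_space \<Rightarrow> real" where
  "gauss x = exp (- (norm x)\<^sup>2 / 2)"

lemma gauss_measurable [measurable]: "gauss \<in> borel_measurable borel"
  unfolding gauss_def by measurable

lemma gauss_pos: "gauss x > 0"
  by (simp add: gauss_def)

lemma gauss_0: "gauss 0 = 1"
  by (simp add: gauss_def)

lemma gauss_prod:
  "exp (- (\<i> * of_real (x \<bullet> \<xi>))) * of_real (gauss x) =
    (\<Prod>b\<in>Basis. exp (- (\<i> * of_real ((x \<bullet> b) * (\<xi> \<bullet> b)))) * complex_of_real (exp (- (x \<bullet> b)\<^sup>2 / 2)))"
proof -
  have "(norm x)\<^sup>2 = (\<Sum>b\<in>Basis. (x \<bullet> b)\<^sup>2)"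
    unfolding power2_norm_eq_inner by (subst euclidean_inner) (simp add: power2_eq_square)
  then have "gauss x = (\<Prod>b\<in>Basis. exp (- (x \<bullet> b)\<^sup>2 / 2))"
    unfolding gauss_def by (simp add: exp_sum[symmetric] sum_negf sum_divide_distrib)
  moreover have "exp (- (\<i> * of_real (x \<bullet> \<xi>))) = (\<Prod>b\<in>Basis. exp (- (\<i> * complex_of_real ((x \<bullet> b) * (\<xi> \<bullet> b)))))"
    by (subst euclidean_inner) (simp add: exp_sum[symmetric] sum_negf sum_distrib_left)
  ultimately show ?thesis by (simp add: prod.distrib)
qed

lemma integrable_gauss: "integrable lborel (\<lambda>x::'a::euclidean_space. gauss x)"
proof -
  have "integrable lborel (\<lambda>x::'a. exp (- (\<i> * of_real (x \<bullet> 0))) * complex_of_real (gauss x))"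
    unfolding gauss_prod by (rule integrable_lborel_prod) (rule integrable_gauss_real)
  from integrable_Re[OF this] show ?thesis by simp
qed

lemma fourier_gauss:
  fixes \<xi> :: "'a::euclidean_space"
  shows "fourier_integral (\<lambda>x. of_real (gauss x)) \<xi> = of_real (sqrt (2 * pi) ^ DIM('a) * gauss \<xi>)"
proof -
  have "fourier_integral (\<lambda>x. of_real (gauss x)) \<xi> =
      (\<Prod>b\<in>Basis. complex_of_real (sqrt (2 * pi) * exp (- (\<xi> \<bullet> b)\<^sup>2 / 2)))"
    unfolding fourier_integral_def gauss_prod
    by (subst integral_lborel_prod, rule integrable_gauss_real, rule prod.cong[OF refl], rule fourier_gauss_real)
  also have "\<dots> = of_real (sqrt (2 * pi) ^ DIM('a) * gauss \<xi>)"
  proof -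
    have "complex_of_real (gauss \<xi>) = (\<Prod>b\<in>Basis. complex_of_real (exp (- (\<xi> \<bullet> b)\<^sup>2 / 2)))"
      using gauss_prod[of \<xi> 0] by simp
    then show ?thesis by (simp add: prod.distrib)
  qed
  finally show ?thesis .
qed

lemma integral_gauss: "(LINT x|lborel. gauss (x::'a::euclidean_space)) = sqrt (2 * pi) ^ DIM('a)"
proof -
  have "complex_of_real (LINT x|lborel. gauss (x::'a)) = complex_of_real (sqrt (2 * pi) ^ DIM('a))"
    using fourier_gauss[of "0::'a"] unfolding fourier_integral_def
    by (simp add: gauss_0 del: of_real_power)
  then show ?thesis using of_real_eq_iff by blast
qed

lemma fourier_gauss_scaled:
  fixes \<xi> :: "'a::euclidean_space"
  assumes s: "s > 0"
  shows "fourier_integral (\<lambda>x. of_real (gauss (s *\<^sub>R x))) \<xi> =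
    of_real (sqrt (2 * pi) ^ DIM('a) / s ^ DIM('a) * gauss (\<xi> /\<^sub>R s))"
proof -
  have "of_real (sqrt (2 * pi) ^ DIM('a) * gauss (\<xi> /\<^sub>R s)) = fourier_integral (\<lambda>x. of_real (gauss x)) (\<xi> /\<^sub>R s)"
    by (simp add: fourier_gauss)
  also have "\<dots> = (s ^ DIM('a)) *\<^sub>R fourier_integral (\<lambda>x. of_real (gauss (s *\<^sub>R x))) \<xi>"
  proof -
    have "(s *\<^sub>R x) \<bullet> (\<xi> /\<^sub>R s) = x \<bullet> \<xi>" for x using s by (simp only: inner_scaleR_left inner_scaleR_right) simp
    then show ?thesis unfolding fourier_integral_def using s
      by (subst integral_lborel_affine[where c = s and t = 0]) (auto simp del: inner_scaleR_left inner_scaleR_right)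
  qed
  finally show ?thesis using s by (simp add: scaleR_conv_of_real field_simps)
qed

section \<open>Plancherel's theorem for integrable functions\<close>

lemma L2_mult_integrable:
  fixes f g :: "'a::euclidean_space \<Rightarrow> complex"
  assumes f: "f \<in> L2" and g: "g \<in> L2"
  shows "integrable lborel (\<lambda>x. f x * g x)"
proof (rule Bochner_Integration.integrable_bound)
  have [measurable]: "f \<in> borel_measurable borel" "g \<in> borel_measurable borel" using f g by auto
  show "integrable lborel (\<lambda>x. (norm (f x))\<^sup>2 + (norm (g x))\<^sup>2)" using f g by (auto simp: L2_def)
  show "(\<lambda>x. f x * g x) \<in> borel_measurable lborel" by measurable
  have "norm (f x) * norm (g x) \<le> (norm (f x))\<^sup>2 + (norm (g x))\<^sup>2" for x
    using sum_squares_bound[of "norm (f x)" "norm (g x)"] mult_nonneg_nonneg[OF norm_ge_zero norm_ge_zero, of "f x" "g x"]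
    by linarith
  then show "AE x in lborel. norm (f x * g x) \<le> norm ((norm (f x))\<^sup>2 + (norm (g x))\<^sup>2)"
    by (auto simp: norm_mult)
qed

lemma L2_affine:
  fixes f :: "'a::euclidean_space \<Rightarrow> complex"
  assumes f: "f \<in> L2" and c: "c \<noteq> 0"
  shows "(\<lambda>x. f (t + c *\<^sub>R x)) \<in> L2"
proof -
  have [measurable]: "f \<in> borel_measurable borel" using f by auto
  show ?thesis using f c integrable_lborel_affine[of "\<lambda>x. (norm (f x))\<^sup>2" c t] by (auto simp: L2_def)
qed

lemma L2_shift:
  fixes f :: "'a::euclidean_space \<Rightarrow> complex"
  shows "f \<in> L2 \<Longrightarrow> (\<lambda>x. f (x - t)) \<in> L2"
  using L2_affine[of f 1 "-t"] by simp

lemma two_Re_cnj: "2 * Re (a * cnj b) = (norm a)\<^sup>2 + (norm b)\<^sup>2 - (norm (a - b))\<^sup>2"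
  unfolding cmod_power2 by (simp add: power2_eq_square algebra_simps)

text \<open>The multiplication formula, applied twice, moves both Fourier transforms onto the Gaussian.\<close>
lemma fourier_integral_regularized:
  fixes f :: "'a::euclidean_space \<Rightarrow> complex"
  assumes f: "integrable lborel f" and s: "s > 0"
  shows "(LINT \<xi>|lborel. (norm (fourier_integral f \<xi>))\<^sup>2 * gauss (s *\<^sub>R \<xi>)) =
     sqrt (2 * pi) ^ DIM('a) * Re (LINT x|lborel. f x * (LINT z|lborel. cnj (f (x - s *\<^sub>R z)) * of_real (gauss z)))"
    and "integrable lborel (\<lambda>\<xi>. (norm (fourier_integral f \<xi>))\<^sup>2 * gauss (s *\<^sub>R \<xi>))"
proof -
  have [measurable]: "f \<in> borel_measurable borel" using f by auto
  define B where "B = (LINT x|lborel. norm (f x))"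
  have gs: "integrable lborel (\<lambda>\<xi>::'a. gauss (s *\<^sub>R \<xi>))"
    using integrable_lborel_affine[OF integrable_gauss, of s 0] s by simp
  have B: "norm (fourier_integral f \<xi>) \<le> B" for \<xi> unfolding B_def by (rule norm_fourier_integral_le)
  define h where "h \<xi> = of_real (gauss (s *\<^sub>R \<xi>)) * cnj (fourier_integral f \<xi>)" for \<xi>
  have h: "integrable lborel h"
  proof (rule Bochner_Integration.integrable_bound[of _ "\<lambda>\<xi>. B * gauss (s *\<^sub>R \<xi>)"])
    show "AE \<xi> in lborel. norm (h \<xi>) \<le> norm (B * gauss (s *\<^sub>R \<xi>))"
    proof (intro AE_I2)
      fix \<xi>
      have "norm (h \<xi>) = norm (fourier_integral f \<xi>) * gauss (s *\<^sub>R \<xi>)"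
        using gauss_pos[of "s *\<^sub>R \<xi>"] by (simp add: h_def norm_mult)
      also have "\<dots> \<le> B * gauss (s *\<^sub>R \<xi>)" by (intro mult_right_mono B less_imp_le gauss_pos)
      finally show "norm (h \<xi>) \<le> norm (B * gauss (s *\<^sub>R \<xi>))" by simp
    qed
  qed (use gs in \<open>auto simp: h_def[abs_def]\<close>)
  \<comment> \<open>Reflecting and conjugating \<open>f\<close> conjugates its transform. The
    squared modulus thereby becomes a product of two Fourier transforms.\<close>
  define ft where "ft y = cnj (f (- y))" for y
  have ft: "integrable lborel ft"
    using integrable_cnj[OF integrable_lborel_affine[OF f, of "-1" 0]] by (simp add: ft_def[abs_def])
  have [measurable]: "ft \<in> borel_measurable borel" using ft by auto
  have FIft: "fourier_integral ft \<xi> = cnj (fourier_integral f \<xi>)" for \<xi>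
  proof -
    have "fourier_integral ft \<xi> = (LINT x|lborel. exp (- (\<i> * of_real (- x \<bullet> \<xi>))) * ft (- x))"
      unfolding fourier_integral_def
      by (subst integral_lborel_reflect[symmetric, where t = 0]) auto
    also have "\<dots> = (LINT x|lborel. cnj (exp (- (\<i> * of_real (x \<bullet> \<xi>))) * f x))"
      by (simp add: ft_def exp_cnj del: Bochner_Integration.integral_cnj)
    also have "\<dots> = cnj (fourier_integral f \<xi>)"
      unfolding fourier_integral_def by (rule Bochner_Integration.integral_cnj)
    finally show ?thesis .
  qed
  have FIh: "fourier_integral h x = of_real (sqrt (2 * pi) ^ DIM('a)) * (LINT z|lborel. cnj (f (x - s *\<^sub>R z)) * of_real (gauss z))" for x
  proof -
    \<comment> \<open>The oscillating factor recentres the transform of the scaled Gaussian at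
      \<open>- x\<close>, which produces a convolution with an approximate identity.\<close>
    define w where "w \<xi> = exp (- (\<i> * of_real (\<xi> \<bullet> x))) * complex_of_real (gauss (s *\<^sub>R \<xi>))" for \<xi>
    have w: "integrable lborel w" unfolding w_def[abs_def]
      by (rule integrable_fourier_kernel) (use gs in auto)
    have FIw: "fourier_integral w y = of_real (sqrt (2 * pi) ^ DIM('a) / s ^ DIM('a) * gauss ((x + y) /\<^sub>R s))" for y
    proof -
      have "fourier_integral w y = fourier_integral (\<lambda>x. of_real (gauss (s *\<^sub>R x))) (x + y)"
        unfolding fourier_integral_def w_def
        by (intro Bochner_Integration.integral_cong)
           (auto simp: inner_add_right distrib_left exp_add[symmetric] algebra_simps)
      then show ?thesis using fourier_gauss_scaled[OF s] by simp
    qed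
    have "fourier_integral h x = (LINT \<xi>|lborel. fourier_integral ft \<xi> * w \<xi>)"
      unfolding FIft w_def h_def fourier_integral_def[of "\<lambda>\<xi>. of_real (gauss (s *\<^sub>R \<xi>)) * cnj (fourier_integral f \<xi>)"]
      by (simp add: mult_ac)
    also have "\<dots> = (LINT y|lborel. ft y * fourier_integral w y)"
      by (rule fourier_integral_multiplication[OF ft w])
    \<comment> \<open>The substitution y = -x + s z undoes recentring and scaling; its Jacobian s^d
      cancels the factor s^(-d) in the transform of \<open>w\<close>.\<close>
    also have "\<dots> = (s ^ DIM('a)) *\<^sub>R (LINT z|lborel. ft (- x + s *\<^sub>R z) * fourier_integral w (- x + s *\<^sub>R z))"
      by (subst integral_lborel_affine[where c = s and t = "-x"]) (use s w in auto)
    also have "\<dots> = (s ^ DIM('a)) *\<^sub>R (LINT z|lborel. of_real (sqrt (2 * pi) ^ DIM('a) / s ^ DIM('a)) * (cnj (f (x - s *\<^sub>R z)) * of_real (gauss z)))"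
      unfolding FIw using s by (simp add: ft_def mult_ac)
    also have "\<dots> = of_real (sqrt (2 * pi) ^ DIM('a)) * (LINT z|lborel. cnj (f (x - s *\<^sub>R z)) * of_real (gauss z))"
      unfolding integral_mult_right_zero using s by (simp add: scaleR_conv_of_real)
    finally show ?thesis .
  qed
  have eq: "fourier_integral f \<xi> * h \<xi> = of_real ((norm (fourier_integral f \<xi>))\<^sup>2 * gauss (s *\<^sub>R \<xi>))" for \<xi>
    by (simp add: h_def complex_norm_square mult_ac del: of_real_power)
  have "(LINT \<xi>|lborel. fourier_integral f \<xi> * h \<xi>) = (LINT x|lborel. f x * fourier_integral h x)"
    by (rule fourier_integral_multiplication[OF f h])
  also have "\<dots> = of_real (sqrt (2 * pi) ^ DIM('a)) * (LINT x|lborel. f x * (LINT z|lborel. cnj (f (x - s *\<^sub>R z)) * of_real (gauss z)))"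
    unfolding FIh by (subst integral_mult_right_zero[symmetric]) (simp add: mult_ac)
  finally have "Re (LINT \<xi>|lborel. fourier_integral f \<xi> * h \<xi>) =
     sqrt (2 * pi) ^ DIM('a) * Re (LINT x|lborel. f x * (LINT z|lborel. cnj (f (x - s *\<^sub>R z)) * of_real (gauss z)))"
    by (simp del: of_real_power)
  then show "(LINT \<xi>|lborel. (norm (fourier_integral f \<xi>))\<^sup>2 * gauss (s *\<^sub>R \<xi>)) =
     sqrt (2 * pi) ^ DIM('a) * Re (LINT x|lborel. f x * (LINT z|lborel. cnj (f (x - s *\<^sub>R z)) * of_real (gauss z)))"
    unfolding eq by (simp only: Bochner_Integration.integral_complex_of_real Re_complex_of_real)
  show "integrable lborel (\<lambda>\<xi>. (norm (fourier_integral f \<xi>))\<^sup>2 * gauss (s *\<^sub>R \<xi>))"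
  proof (rule Bochner_Integration.integrable_bound[of _ "\<lambda>\<xi>. B\<^sup>2 * gauss (s *\<^sub>R \<xi>)"])
    show "AE \<xi> in lborel. norm ((norm (fourier_integral f \<xi>))\<^sup>2 * gauss (s *\<^sub>R \<xi>)) \<le> norm (B\<^sup>2 * gauss (s *\<^sub>R \<xi>))"
      using B gauss_pos by (auto simp: abs_mult less_imp_le intro!: mult_right_mono power_mono)
  qed (use gs in auto)
qed

section \<open>Autocorrelation and the limit of the Gaussian regularization\<close>

definition L2_mod :: "('a::euclidean_space \<Rightarrow> complex) \<Rightarrow> 'a \<Rightarrow> real" where
  "L2_mod f t = (LINT x|lborel. (norm (f x - f (x - t)))\<^sup>2)"

lemma L2_mod_measurable [measurable]:
  assumes [measurable]: "f \<in> borel_measurable borel"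
  shows "L2_mod f \<in> borel_measurable borel"
  unfolding L2_mod_def by measurable

text \<open>Polarization, together with the fact that a translate has the same norm. In this form,
  continuity of the autocorrelation at 0 is continuity of translations in L2.\<close>

lemma integral_autocorrelation:
  fixes f :: "'a::euclidean_space \<Rightarrow> complex"
  assumes f: "f \<in> L2"
  shows "2 * Re (LINT x|lborel. f x * cnj (f (x - t))) = 2 * (LINT x|lborel. (norm (f x))\<^sup>2) - L2_mod f t"
proof -
  have [measurable]: "f \<in> borel_measurable borel" using f by auto
  have ft: "(\<lambda>x. f (x - t)) \<in> L2" by (rule L2_shift[OF f])
  have d: "(\<lambda>x. f x - f (x - t)) \<in> L2" by (rule L2_diff[OF f ft])
  have int: "integrable lborel (\<lambda>x. f x * cnj (f (x - t)))" by (rule L2_mult_integrable[OF f L2_cnj[OF ft]])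
  have i: "integrable lborel (\<lambda>x. (norm (f x))\<^sup>2)" "integrable lborel (\<lambda>x. (norm (f (x - t)))\<^sup>2)"
    "integrable lborel (\<lambda>x. (norm (f x - f (x - t)))\<^sup>2)"
    using f ft d by (auto simp: L2_def)
  have s: "(LINT x|lborel. (norm (f (x - t)))\<^sup>2) = (LINT x|lborel. (norm (f x))\<^sup>2)"
    using integral_lborel_shift[of "\<lambda>x. (norm (f x))\<^sup>2" "-t"] by simp
  have "2 * Re (LINT x|lborel. f x * cnj (f (x - t))) = (LINT x|lborel. 2 * Re (f x * cnj (f (x - t))))"
    by (subst integral_Re[OF int, symmetric]) (simp only: integral_mult_right_zero)
  also have "\<dots> = (LINT x|lborel. (norm (f x))\<^sup>2 + (norm (f (x - t)))\<^sup>2 - (norm (f x - f (x - t)))\<^sup>2)"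
    unfolding two_Re_cnj ..
  also have "\<dots> = 2 * (LINT x|lborel. (norm (f x))\<^sup>2) - L2_mod f t"
    using i s by (simp add: L2_mod_def)
  finally show ?thesis .
qed

lemma L2_mod_bounds:
  fixes f :: "'a::euclidean_space \<Rightarrow> complex"
  assumes f: "f \<in> L2"
  shows "0 \<le> L2_mod f t" "L2_mod f t \<le> 4 * (LINT x|lborel. (norm (f x))\<^sup>2)"
proof -
  have [measurable]: "f \<in> borel_measurable borel" using f by auto
  have ft: "(\<lambda>x. f (x - t)) \<in> L2" by (rule L2_shift[OF f])
  have i: "integrable lborel (\<lambda>x. (norm (f x))\<^sup>2)" "integrable lborel (\<lambda>x. (norm (f (x - t)))\<^sup>2)"
    using f ft by (auto simp: L2_def)
  have s: "(LINT x|lborel. (norm (f (x - t)))\<^sup>2) = (LINT x|lborel. (norm (f x))\<^sup>2)"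
    using integral_lborel_shift[of "\<lambda>x. (norm (f x))\<^sup>2" "-t"] by simp
  show "0 \<le> L2_mod f t" by (simp add: L2_mod_def)
  have "L2_mod f t \<le> (LINT x|lborel. 2 * (norm (f x))\<^sup>2 + 2 * (norm (f (x - t)))\<^sup>2)"
    unfolding L2_mod_def
  proof (rule integral_mono_AE')
    have "(norm (f x - f (x - t)))\<^sup>2 \<le> 2 * (norm (f x))\<^sup>2 + 2 * (norm (f (x - t)))\<^sup>2" for x
      using norm_add_sq_le[of 1 "f x" "- f (x - t)"] by simp
    then show "AE x in lborel. (norm (f x - f (x - t)))\<^sup>2 \<le> 2 * (norm (f x))\<^sup>2 + 2 * (norm (f (x - t)))\<^sup>2" by auto
  qed (use i in auto)
  also have "\<dots> = 4 * (LINT x|lborel. (norm (f x))\<^sup>2)" using i s by simp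
  finally show "L2_mod f t \<le> 4 * (LINT x|lborel. (norm (f x))\<^sup>2)" .
qed

text \<open>Inserting the autocorrelation formula splits off a main term independent of
  \<open>s\<close> and leaves a Gaussian average of translation moduli as error. The main constant
  (2\<pi>)^d is a product of two factors \<open>sqrt (2 * pi) ^ DIM('a)\<close>: one from the
  transform of the Gaussian, one from its integral.\<close>

lemma fourier_integral_regularized':
  fixes f :: "'a::euclidean_space \<Rightarrow> complex"
  assumes f: "integrable lborel f" "f \<in> L2" and s: "s > 0"
  shows "(LINT \<xi>|lborel. (norm (fourier_integral f \<xi>))\<^sup>2 * gauss (s *\<^sub>R \<xi>)) =
     (2 * pi) ^ DIM('a) * (LINT x|lborel. (norm (f x))\<^sup>2) -
     sqrt (2 * pi) ^ DIM('a) / 2 * (LINT z|lborel. gauss z * L2_mod f (s *\<^sub>R z))"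
proof -
  have [measurable]: "f \<in> borel_measurable borel" using f by auto
  define I where "I = (LINT x|lborel. (norm (f x))\<^sup>2)"
  define A where "A t = (LINT x|lborel. f x * cnj (f (x - t)))" for t
  have A: "2 * Re (A t) = 2 * I - L2_mod f t" for t
    unfolding A_def I_def by (rule integral_autocorrelation[OF f(2)])
  have intA: "integrable lborel (\<lambda>x. f x * cnj (f (x - t)))" for t
    by (rule L2_mult_integrable[OF f(2) L2_cnj[OF L2_shift[OF f(2)]]])
  have [measurable]: "A \<in> borel_measurable borel" unfolding A_def by measurable
  \<comment> \<open>The arithmetic-geometric mean inequality and translation invariance give a bound
    uniform in \<open>t\<close>, which serves both for Fubini and for dominating the Gaussian
    average.\<close>
  have boundN: "(LINT x|lborel. norm (f x * cnj (f (x - t)))) \<le> I" for t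
  proof -
    have i: "integrable lborel (\<lambda>x. (norm (f x))\<^sup>2)" "integrable lborel (\<lambda>x. (norm (f (x - t)))\<^sup>2)"
      using f L2_shift[OF f(2), of t] by (auto simp: L2_def)
    have "(LINT x|lborel. norm (f x * cnj (f (x - t)))) \<le> (LINT x|lborel. ((norm (f x))\<^sup>2 + (norm (f (x - t)))\<^sup>2) / 2)"
    proof (rule integral_mono_AE')
      have "norm (f x * cnj (f (x - t))) \<le> ((norm (f x))\<^sup>2 + (norm (f (x - t)))\<^sup>2) / 2" for x
        using sum_squares_bound[of "norm (f x)" "norm (f (x-t))"] by (simp add: norm_mult)
      then show "AE x in lborel. norm (f x * cnj (f (x - t))) \<le> ((norm (f x))\<^sup>2 + (norm (f (x - t)))\<^sup>2) / 2" by auto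
    qed (use i in auto)
    also have "\<dots> = I"
      using i integral_lborel_shift[of "\<lambda>x. (norm (f x))\<^sup>2" "-t"] by (simp add: I_def)
    finally show ?thesis .
  qed
  have intK: "integrable (lborel \<Otimes>\<^sub>M lborel) (\<lambda>(z, x). f x * cnj (f (x - s *\<^sub>R z)) * of_real (gauss z))"
  proof (rule lborel_pair.Fubini_integrable)
    show "integrable lborel (\<lambda>z. LINT x|lborel. norm (case (z, x) of (z, x) \<Rightarrow> f x * cnj (f (x - s *\<^sub>R z)) * complex_of_real (gauss z)))"
    proof (rule Bochner_Integration.integrable_bound[of _ "\<lambda>z. I * gauss z"])
      show "AE z in lborel. norm (LINT x|lborel. norm (case (z, x) of (z, x) \<Rightarrow> f x * cnj (f (x - s *\<^sub>R z)) * complex_of_real (gauss z)))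
         \<le> norm (I * gauss z)"
      proof (intro AE_I2)
        fix z
        have "norm (LINT x|lborel. norm (f x * cnj (f (x - s *\<^sub>R z)) * complex_of_real (gauss z))) =
            (LINT x|lborel. norm (f x * cnj (f (x - s *\<^sub>R z)))) * gauss z"
          using gauss_pos[of z] by (simp add: norm_mult abs_mult)
        also have "\<dots> \<le> I * gauss z" using gauss_pos[of z] by (intro mult_right_mono boundN) auto
        also have "\<dots> \<le> norm (I * gauss z)" by simp
        finally show "norm (LINT x|lborel. norm (case (z, x) of (z, x) \<Rightarrow> f x * cnj (f (x - s *\<^sub>R z)) * complex_of_real (gauss z)))
         \<le> norm (I * gauss z)" by simp
      qed
    qed (use integrable_gauss in auto)
    show "AE z in lborel. integrable lborel (\<lambda>x. case (z, x) of (z, x) \<Rightarrow> f x * cnj (f (x - s *\<^sub>R z)) * complex_of_real (gauss z))"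
      using intA by auto
  qed measurable
  have "(LINT x|lborel. f x * (LINT z|lborel. cnj (f (x - s *\<^sub>R z)) * of_real (gauss z))) =
      (LINT x|lborel. LINT z|lborel. f x * cnj (f (x - s *\<^sub>R z)) * of_real (gauss z))"
    by (simp add: mult.assoc)
  also have "\<dots> = (LINT z|lborel. LINT x|lborel. f x * cnj (f (x - s *\<^sub>R z)) * of_real (gauss z))"
    using lborel_pair.Fubini_integral[OF intK] by simp
  also have "\<dots> = (LINT z|lborel. A (s *\<^sub>R z) * of_real (gauss z))"
    by (simp add: A_def)
  finally have e: "(LINT x|lborel. f x * (LINT z|lborel. cnj (f (x - s *\<^sub>R z)) * of_real (gauss z))) =
    (LINT z|lborel. A (s *\<^sub>R z) * of_real (gauss z))" .
  have Abound: "norm (A t) \<le> I" for t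
    unfolding A_def by (rule order_trans[OF integral_norm_bound boundN])
  have intAg: "integrable lborel (\<lambda>z::'a. A (s *\<^sub>R z) * of_real (gauss z))"
    by (rule Bochner_Integration.integrable_bound[of _ "\<lambda>z. I * gauss z"])
       (use integrable_gauss Abound gauss_pos in \<open>auto simp: norm_mult abs_mult less_imp_le intro!: mult_right_mono order_trans[OF Abound]\<close>)
  have ReA: "Re (A t) = I - L2_mod f t / 2" for t using A[of t] by simp
  have intm: "integrable lborel (\<lambda>z. gauss z * L2_mod f (s *\<^sub>R z))"
  proof (rule Bochner_Integration.integrable_bound[of _ "\<lambda>z. 4 * I * gauss z"])
    show "AE z in lborel. norm (gauss z * L2_mod f (s *\<^sub>R z)) \<le> norm (4 * I * gauss z)"
    proof (intro AE_I2)
      fix z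
      have "norm (gauss z * L2_mod f (s *\<^sub>R z)) = L2_mod f (s *\<^sub>R z) * gauss z"
        using gauss_pos[of z] L2_mod_bounds(1)[OF f(2)] by (simp add: abs_mult mult.commute)
      also have "\<dots> \<le> 4 * I * gauss z"
        unfolding I_def by (intro mult_right_mono L2_mod_bounds f less_imp_le gauss_pos)
      finally show "norm (gauss z * L2_mod f (s *\<^sub>R z)) \<le> norm (4 * I * gauss z)" by simp
    qed
  qed (use integrable_gauss in auto)
  have "Re (LINT z|lborel. A (s *\<^sub>R z) * of_real (gauss z)) = (LINT z|lborel. I * gauss z - gauss z * L2_mod f (s *\<^sub>R z) / 2)"
    using intAg by (simp flip: integral_Re add: ReA algebra_simps)
  also have "\<dots> = I * sqrt (2 * pi) ^ DIM('a) - (LINT z|lborel. gauss z * L2_mod f (s *\<^sub>R z)) / 2"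
    by (subst Bochner_Integration.integral_diff)
       (use intm integrable_gauss in \<open>auto simp: integral_gauss\<close>)
  finally have "(LINT \<xi>|lborel. (norm (fourier_integral f \<xi>))\<^sup>2 * gauss (s *\<^sub>R \<xi>)) =
     sqrt (2 * pi) ^ DIM('a) * (I * sqrt (2 * pi) ^ DIM('a) - (LINT z|lborel. gauss z * L2_mod f (s *\<^sub>R z)) / 2)"
    unfolding fourier_integral_regularized[OF f(1) s] e by simp
  also have "\<dots> = (sqrt (2 * pi) * sqrt (2 * pi)) ^ DIM('a) * I -
     sqrt (2 * pi) ^ DIM('a) / 2 * (LINT z|lborel. gauss z * L2_mod f (s *\<^sub>R z))"
    unfolding power_mult_distrib by (simp add: algebra_simps)
  finally show ?thesis by (simp add: I_def)
qed

text \<open>As s decreases to 0, the left side of the regularized identity increases to the squared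
  norm by monotone convergence, so square integrability of the transform is obtained along the way.
  On the right the translation moduli vanish by dominated convergence.\<close>

theorem Plancherel_integrable:
  fixes f :: "'a::euclidean_space \<Rightarrow> complex"
  assumes f: "integrable lborel f" "f \<in> L2"
  shows "L2_sq (fourier_integral f) = ennreal ((2 * pi) ^ DIM('a)) * L2_sq f"
proof -
  have [measurable]: "f \<in> borel_measurable borel" using f by auto
  define I where "I = (LINT x|lborel. (norm (f x))\<^sup>2)"
  define s :: "nat \<Rightarrow> real" where "s n = 1 / Suc n" for n
  have s: "s n > 0" for n by (simp add: s_def)
  have s0: "s \<longlonglongrightarrow> 0" unfolding s_def by (rule LIMSEQ_Suc[OF lim_1_over_n])
  have "(\<lambda>n. LINT z|lborel. gauss z * L2_mod f (s n *\<^sub>R z)) \<longlonglongrightarrow> (LINT z|(lborel::'a measure). (0::real))"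
  proof (rule integral_dominated_convergence[where w = "\<lambda>z. 4 * I * gauss z"])
    show "AE z in lborel. (\<lambda>n. gauss z * L2_mod f (s n *\<^sub>R z)) \<longlonglongrightarrow> 0"
    proof (intro AE_I2)
      fix z :: 'a
      have "(\<lambda>n. s n *\<^sub>R z) \<longlonglongrightarrow> 0 *\<^sub>R z" by (intro tendsto_intros s0)
      then have "(\<lambda>n. L2_sq (\<lambda>x. f x - f (x - s n *\<^sub>R z))) \<longlonglongrightarrow> 0"
        using L2_sq_translation_tendsto[OF f] by simp
      moreover have "L2_sq (\<lambda>x. f x - f (x - s n *\<^sub>R z)) = ennreal (L2_mod f (s n *\<^sub>R z))" for n
        unfolding L2_mod_def by (rule L2_sq_eq_integral) (intro L2_diff L2_shift f)
      ultimately have "(\<lambda>n. L2_mod f (s n *\<^sub>R z)) \<longlonglongrightarrow> 0"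
        using L2_mod_bounds(1)[OF f(2)] by (simp add: tendsto_ennreal_iff[of _ _ 0] flip: ennreal_0)
      then show "(\<lambda>n. gauss z * L2_mod f (s n *\<^sub>R z)) \<longlonglongrightarrow> 0" by (rule tendsto_mult_right_zero)
    qed
    show "AE z in lborel. norm (gauss z * L2_mod f (s n *\<^sub>R z)) \<le> 4 * I * gauss z" for n
    proof (intro AE_I2)
      fix z
      have "norm (gauss z * L2_mod f (s n *\<^sub>R z)) = L2_mod f (s n *\<^sub>R z) * gauss z"
        using gauss_pos[of z] L2_mod_bounds(1)[OF f(2)] by (simp add: abs_mult mult.commute)
      also have "\<dots> \<le> 4 * I * gauss z"
        unfolding I_def by (intro mult_right_mono L2_mod_bounds f less_imp_le gauss_pos)
      finally show "norm (gauss z * L2_mod f (s n *\<^sub>R z)) \<le> 4 * I * gauss z" .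
    qed
  qed (use integrable_gauss in auto)
  then have "(\<lambda>n. (2 * pi) ^ DIM('a) * I -
     sqrt (2 * pi) ^ DIM('a) / 2 * (LINT z|lborel. gauss z * L2_mod f (s n *\<^sub>R z))) \<longlonglongrightarrow> (2 * pi) ^ DIM('a) * I - sqrt (2 * pi) ^ DIM('a) / 2 * 0"
    by (intro tendsto_intros) simp
  then have lim1: "(\<lambda>n. LINT \<xi>|lborel. (norm (fourier_integral f \<xi>))\<^sup>2 * gauss (s n *\<^sub>R \<xi>)) \<longlonglongrightarrow> (2 * pi) ^ DIM('a) * I"
    unfolding fourier_integral_regularized'[OF f s] I_def by simp
  have nn: "(\<integral>\<^sup>+\<xi>. ennreal ((norm (fourier_integral f \<xi>))\<^sup>2 * gauss (s n *\<^sub>R \<xi>)) \<partial>lborel) =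
    ennreal (LINT \<xi>|lborel. (norm (fourier_integral f \<xi>))\<^sup>2 * gauss (s n *\<^sub>R \<xi>))" for n
    by (rule nn_integral_eq_integral[OF fourier_integral_regularized(2)[OF f(1) s]])
       (auto intro!: mult_nonneg_nonneg less_imp_le[OF gauss_pos])
  have "(\<lambda>n. \<integral>\<^sup>+\<xi>. ennreal ((norm (fourier_integral f \<xi>))\<^sup>2 * gauss (s n *\<^sub>R \<xi>)) \<partial>lborel) \<longlonglongrightarrow> L2_sq (fourier_integral f)"
    unfolding L2_sq_def
  proof (rule nn_integral_LIMSEQ)
    show "incseq (\<lambda>n \<xi>. ennreal ((norm (fourier_integral f \<xi>))\<^sup>2 * gauss (s n *\<^sub>R \<xi>)))"
    proof (intro incseq_SucI le_funI ennreal_leI mult_left_mono)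
      fix n and \<xi> :: 'a
      have "s (Suc n) * norm \<xi> \<le> s n * norm \<xi>" by (intro mult_right_mono) (auto simp: s_def field_simps)
      then have "(s (Suc n) * norm \<xi>)\<^sup>2 \<le> (s n * norm \<xi>)\<^sup>2"
        using s[of "Suc n"] by (intro power_mono) auto
      then show "gauss (s n *\<^sub>R \<xi>) \<le> gauss (s (Suc n) *\<^sub>R \<xi>)"
        by (simp add: gauss_def power_mult_distrib)
    qed auto
    fix \<xi> :: 'a
    have "(\<lambda>n. (norm (fourier_integral f \<xi>))\<^sup>2 * exp (- (norm (s n *\<^sub>R \<xi>))\<^sup>2 / 2)) \<longlonglongrightarrow>
        (norm (fourier_integral f \<xi>))\<^sup>2 * exp (- (norm (0 *\<^sub>R \<xi>))\<^sup>2 / 2)"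
      by (intro tendsto_intros s0) auto
    then show "(\<lambda>n. ennreal ((norm (fourier_integral f \<xi>))\<^sup>2 * gauss (s n *\<^sub>R \<xi>))) \<longlonglongrightarrow> ennreal ((norm (fourier_integral f \<xi>))\<^sup>2)"
      unfolding gauss_def by (intro tendsto_ennrealI) simp
  qed measurable
  moreover have "(\<lambda>n. \<integral>\<^sup>+\<xi>. ennreal ((norm (fourier_integral f \<xi>))\<^sup>2 * gauss (s n *\<^sub>R \<xi>)) \<partial>lborel) \<longlonglongrightarrow> ennreal ((2 * pi) ^ DIM('a) * I)"
    unfolding nn by (intro tendsto_ennrealI lim1)
  ultimately have "L2_sq (fourier_integral f) = ennreal ((2 * pi) ^ DIM('a) * I)"
    by (rule LIMSEQ_unique)
  then show ?thesis unfolding L2_sq_eq_integral[OF f(2)] I_def by (simp add: ennreal_mult)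
qed

lemma fourier_integral_L2: "integrable lborel f \<Longrightarrow> f \<in> L2 \<Longrightarrow> fourier_integral f \<in> L2"
  for f :: "'a::euclidean_space \<Rightarrow> complex"
  using Plancherel_integrable[of f] by (auto simp: L2_iff ennreal_mult_less_top)

section \<open>The Fourier transform on \<open>L\<^sup>2\<close>\<close>

abbreviation ball_trunc :: "real \<Rightarrow> ('a::euclidean_space \<Rightarrow> complex) \<Rightarrow> 'a \<Rightarrow> complex" where
  "ball_trunc R f \<equiv> (\<lambda>x. indicator (cball 0 R) x * f x)"

lemma ball_trunc_L2: "f \<in> L2 \<Longrightarrow> ball_trunc R f \<in> L2"
  unfolding L2_iff by (auto intro!: le_less_trans[OF L2_sq_mono[of _ f]] simp: indicator_def)

lemma ball_trunc_integrable:
  fixes f :: "'a::euclidean_space \<Rightarrow> complex"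
  assumes f: "f \<in> L2"
  shows "integrable lborel (ball_trunc R f)"
proof (rule L2_mult_integrable[OF _ f])
  have "L2_sq (indicator (cball 0 R) :: 'a \<Rightarrow> complex) = (\<integral>\<^sup>+x. indicator (cball 0 R) x \<partial>(lborel :: 'a measure))"
    unfolding L2_sq_def by (intro nn_integral_cong) (auto simp: indicator_def)
  also have "\<dots> < \<infinity>" using emeasure_bounded_finite[of "cball 0 R :: 'a set"] by simp
  finally show "(indicator (cball 0 R) :: 'a \<Rightarrow> complex) \<in> L2"
    by (auto simp: L2_iff intro!: borel_measurable_indicator)
qed

text \<open>Dominated convergence is applied along integer radii. The error decreases with the
  radius, so the limit over real radii follows.\<close>

lemma ball_trunc_tendsto:
  fixes f :: "'a::euclidean_space \<Rightarrow> complex"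
  assumes f: "f \<in> L2"
  shows "L2_tendsto (\<lambda>R. ball_trunc R f) f at_top"
proof -
  have [measurable]: "f \<in> borel_measurable borel" using f by auto
  have "(\<lambda>n. L2_sq (\<lambda>x. ball_trunc (real n) f x - f x)) \<longlonglongrightarrow> (\<integral>\<^sup>+x. (0::ennreal) \<partial>(lborel :: 'a measure))"
    unfolding L2_sq_def
  proof (rule nn_integral_dominated_convergence[where w = "\<lambda>x. ennreal ((norm (f x))\<^sup>2)"])
    show "AE x in lborel. (\<lambda>n. ennreal ((norm (ball_trunc (real n) f x - f x))\<^sup>2)) \<longlonglongrightarrow> 0"
    proof (intro AE_I2)
      fix x :: 'a
      have "\<forall>\<^sub>F n in sequentially. ennreal ((norm (ball_trunc (real n) f x - f x))\<^sup>2) = 0"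
        using eventually_ge_at_top[of "nat \<lceil>norm x\<rceil>"]
        by eventually_elim (auto simp: nat_le_iff ceiling_le_iff)
      then show "(\<lambda>n. ennreal ((norm (ball_trunc (real n) f x - f x))\<^sup>2)) \<longlonglongrightarrow> 0" by (rule tendsto_eventually)
    qed
    show "(\<integral>\<^sup>+x. ennreal ((norm (f x))\<^sup>2) \<partial>lborel) < \<infinity>"
      using f by (simp add: L2_iff L2_sq_def)
  qed (auto simp: indicator_def)
  then have lim: "(\<lambda>n. L2_sq (\<lambda>x. ball_trunc (real n) f x - f x)) \<longlonglongrightarrow> 0" by simp
  show ?thesis unfolding L2_tendsto_iff
  proof (rule ennreal_tendsto_0I)
    fix e :: real assume "e > 0"
    then have "\<forall>\<^sub>F n in sequentially. L2_sq (\<lambda>x. ball_trunc (real n) f x - f x) < ennreal e"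
      by (intro order_tendstoD(2)[OF lim]) auto
    then obtain n where n: "L2_sq (\<lambda>x. ball_trunc (real n) f x - f x) < ennreal e"
      by (blast dest: eventually_happens'[OF sequentially_bot])
    show "\<forall>\<^sub>F R in at_top. L2_sq (\<lambda>x. ball_trunc R f x - f x) \<le> ennreal e"
      using eventually_ge_at_top[of "real n"]
    proof eventually_elim
      case (elim R)
      have "L2_sq (\<lambda>x. ball_trunc R f x - f x) \<le> L2_sq (\<lambda>x. ball_trunc (real n) f x - f x)"
        using elim by (intro L2_sq_mono) (auto simp: indicator_def)
      with n show ?case by (meson less_imp_le order_trans)
    qed
  qed
qed

lemma ball_trunc_LIMSEQ:
  "f \<in> L2 \<Longrightarrow> L2_tendsto (\<lambda>n. ball_trunc (real n) f) f sequentially"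
  using ball_trunc_tendsto[of f] filterlim_real_sequentially unfolding L2_tendsto_iff
  by (rule filterlim_compose)

text \<open>Testing against every \<open>h \<in> L\<^sup>1 \<inter> L\<^sup>2\<close> makes the predicate insensitive to the choice of
  an approximating sequence.\<close>
definition L2_fourier :: "('a::euclidean_space \<Rightarrow> complex) \<Rightarrow> ('a \<Rightarrow> complex) \<Rightarrow> bool" where
  "L2_fourier f F \<longleftrightarrow> f \<in> L2 \<and> F \<in> L2 \<and> (\<forall>h \<in> L2. integrable lborel h \<longrightarrow>
     L2_sq (\<lambda>\<xi>. fourier_integral h \<xi> - F \<xi>) = ennreal ((2 * pi) ^ DIM('a)) * L2_sq (\<lambda>x. h x - f x))"

lemma L2_fourier_L2: "L2_fourier f F \<Longrightarrow> f \<in> L2" "L2_fourier f F \<Longrightarrow> F \<in> L2"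
  by (auto simp: L2_fourier_def)

lemma L2_fourier_eq:
  "L2_fourier f F \<Longrightarrow> h \<in> L2 \<Longrightarrow> integrable lborel h \<Longrightarrow>
     L2_sq (\<lambda>\<xi>. fourier_integral h \<xi> - F \<xi>) = ennreal ((2 * pi) ^ DIM('a)) * L2_sq (\<lambda>x. h x - f x)"
  for f :: "'a::euclidean_space \<Rightarrow> complex"
  by (auto simp: L2_fourier_def)

lemma Plancherel_integrable_diff:
  fixes f g :: "'a::euclidean_space \<Rightarrow> complex"
  assumes "integrable lborel f" "f \<in> L2" "integrable lborel g" "g \<in> L2"
  shows "L2_sq (\<lambda>\<xi>. fourier_integral f \<xi> - fourier_integral g \<xi>) = ennreal ((2 * pi) ^ DIM('a)) * L2_sq (\<lambda>x. f x - g x)"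
proof -
  have "fourier_integral (\<lambda>x. f x - g x) = (\<lambda>\<xi>. fourier_integral f \<xi> - fourier_integral g \<xi>)"
    by (rule ext) (rule fourier_integral_diff[OF assms(1,3)])
  with Plancherel_integrable[of "\<lambda>x. f x - g x"] assms show ?thesis by (simp add: L2_diff)
qed

lemma L2_tendsto_diff_const:
  "L2_tendsto F f A \<Longrightarrow> L2_tendsto (\<lambda>j x. h x - F j x) (\<lambda>x. h x - f x) A"
  unfolding L2_tendsto_iff by (simp add: L2_sq_minus_commute[of "F _" f])

text \<open>For each term of the sequence the test identity is Plancherel's theorem for a difference
  of integrable functions; both sides are continuous under L2 convergence.\<close>

lemma L2_fourierI_seq:
  fixes f :: "'a::euclidean_space \<Rightarrow> complex" and h :: "nat \<Rightarrow> 'a \<Rightarrow> complex"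
  assumes f: "f \<in> L2" "F \<in> L2" and h: "\<And>j. integrable lborel (h j)" "\<And>j. h j \<in> L2"
    and lim: "L2_tendsto h f sequentially" "L2_tendsto (\<lambda>j. fourier_integral (h j)) F sequentially"
  shows "L2_fourier f F"
  unfolding L2_fourier_def
proof (intro conjI f ballI impI)
  fix g :: "'a \<Rightarrow> complex" assume g: "g \<in> L2" "integrable lborel g"
  have "(\<lambda>j. L2_sq (\<lambda>\<xi>. fourier_integral g \<xi> - fourier_integral (h j) \<xi>)) \<longlonglongrightarrow> L2_sq (\<lambda>\<xi>. fourier_integral g \<xi> - F \<xi>)"
    by (intro L2_tendsto_L2_sq L2_tendsto_diff_const lim L2_diff fourier_integral_L2 f g h)
  moreover have "(\<lambda>j. ennreal ((2 * pi) ^ DIM('a)) * L2_sq (\<lambda>x. g x - h j x)) \<longlonglongrightarrow> ennreal ((2 * pi) ^ DIM('a)) * L2_sq (\<lambda>x. g x - f x)"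
    by (intro ennreal_tendsto_cmult L2_tendsto_L2_sq L2_tendsto_diff_const lim L2_diff f g h) auto
  ultimately show "L2_sq (\<lambda>\<xi>. fourier_integral g \<xi> - F \<xi>) = ennreal ((2 * pi) ^ DIM('a)) * L2_sq (\<lambda>x. g x - f x)"
    using Plancherel_integrable_diff[OF g(2,1) h] by (auto intro: LIMSEQ_unique)
qed

lemma L2_fourier_integral: "integrable lborel f \<Longrightarrow> f \<in> L2 \<Longrightarrow> L2_fourier f (fourier_integral f)"
  for f :: "'a::euclidean_space \<Rightarrow> complex"
  unfolding L2_fourier_def by (auto simp: fourier_integral_L2 Plancherel_integrable_diff)

text \<open>The approximants are themselves admissible test functions, so the defining identity
  turns convergence of \<open>h\<close> into convergence of the transforms.\<close>

lemma L2_fourier_tendsto: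
  fixes f :: "'a::euclidean_space \<Rightarrow> complex"
  assumes f: "L2_fourier f F" and h: "\<And>j. integrable lborel (h j)" "\<And>j. h j \<in> L2"
    and lim: "L2_tendsto h f A"
  shows "L2_tendsto (\<lambda>j. fourier_integral (h j)) F A"
proof -
  have "((\<lambda>j. ennreal ((2 * pi) ^ DIM('a)) * L2_sq (\<lambda>x. h j x - f x)) \<longlongrightarrow> ennreal ((2 * pi) ^ DIM('a)) * 0) A"
    using lim unfolding L2_tendsto_iff by (intro ennreal_tendsto_cmult) auto
  then show ?thesis
    unfolding L2_tendsto_iff by (simp add: L2_fourier_eq[OF f h(2) h(1)])
qed

text \<open>A convergent sequence is Cauchy, and an isometry up to the factor \<open>c\<close>
  carries this over to the images. The images are kept abstract so that the full and the partial
  Fourier transform share the argument.\<close>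

lemma L2_complete_transfer:
  fixes h :: "nat \<Rightarrow> 'a::euclidean_space \<Rightarrow> complex" and H :: "nat \<Rightarrow> 'b::euclidean_space \<Rightarrow> complex"
  assumes h: "\<And>j. h j \<in> L2" and H: "\<And>j. H j \<in> L2" and f: "f \<in> L2" and c: "c > 0"
    and lim: "L2_tendsto h f sequentially"
    and eq: "\<And>m n. L2_sq (\<lambda>x. H m x - H n x) = ennreal c * L2_sq (\<lambda>x. h m x - h n x)"
  obtains r where "strict_mono r"
    "(\<lambda>x. if convergent (\<lambda>k. H (r k) x) then lim (\<lambda>k. H (r k) x) else 0) \<in> L2"
    "L2_tendsto H (\<lambda>x. if convergent (\<lambda>k. H (r k) x) then lim (\<lambda>k. H (r k) x) else 0) sequentially"
proof (rule L2_complete[of H])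
  have [measurable]: "h j \<in> borel_measurable borel" "f \<in> borel_measurable borel" for j using f h by auto
  fix e :: real assume e: "e > 0"
  \<comment> \<open>The two errors, each doubled, add up to at most 4 e / (5 c); the factor
    \<open>c\<close> leaves 4 e / 5, strictly below e.\<close>
  have "\<forall>\<^sub>F j in sequentially. L2_sq (\<lambda>x. h j x - f x) < ennreal (e / (5 * c))"
    using e c by (intro order_tendstoD(2)[OF lim[unfolded L2_tendsto_iff]]) auto
  then obtain M where M: "\<And>j. j \<ge> M \<Longrightarrow> L2_sq (\<lambda>x. h j x - f x) < ennreal (e / (5 * c))"
    by (auto simp: eventually_sequentially)
  have "L2_sq (\<lambda>x. H m x - H n x) < ennreal e" if mn: "m \<ge> M" "n \<ge> M" for m n
  proof -
    have "L2_sq (\<lambda>x. h m x - h n x) \<le> 2 * L2_sq (\<lambda>x. h m x - f x) + 2 * L2_sq (\<lambda>x. h n x - f x)"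
      using L2_sq_triangle2[of "h m" f "h n"] by (simp add: L2_sq_minus_commute[of f])
    also have "\<dots> \<le> 2 * ennreal (e / (5 * c)) + 2 * ennreal (e / (5 * c))"
      using M mn by (intro add_mono mult_left_mono) (auto intro: less_imp_le)
    also have "\<dots> = 4 * ennreal (e / (5 * c))"
      by (simp flip: distrib_right)
    also have "\<dots> = ennreal (4 * (e / (5 * c)))"
      using e c by (subst ennreal_mult) auto
    finally have "ennreal c * L2_sq (\<lambda>x. h m x - h n x) \<le> ennreal c * ennreal (4 * (e / (5 * c)))"
      by (rule mult_left_mono) simp
    also have "\<dots> = ennreal (e * (4 / 5))"
      using e c by (subst ennreal_mult[symmetric]) auto
    also have "\<dots> < ennreal e" using e by (intro ennreal_lessI) auto
    finally show ?thesis by (simp add: eq)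
  qed
  then show "\<exists>M. \<forall>m\<ge>M. \<forall>n\<ge>M. L2_sq (\<lambda>x. H m x - H n x) < ennreal e" by blast
qed (use H that in blast)+

text \<open>Symmetries of all the \<open>fourier_integral (h j)\<close> pass to the transform.\<close>
lemma L2_fourier_exists_seq:
  fixes f :: "'a::euclidean_space \<Rightarrow> complex" and h :: "nat \<Rightarrow> 'a \<Rightarrow> complex"
  assumes f: "f \<in> L2" and h: "\<And>j. integrable lborel (h j)" "\<And>j. h j \<in> L2"
    and lim: "L2_tendsto h f sequentially"
  obtains r where "L2_fourier f (\<lambda>\<xi>. if convergent (\<lambda>k. fourier_integral (h (r k)) \<xi>)
    then lim (\<lambda>k. fourier_integral (h (r k)) \<xi>) else 0)"
proof (rule L2_complete_transfer[OF h(2) fourier_integral_L2[OF h] f _ lim])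
  show "L2_sq (\<lambda>\<xi>. fourier_integral (h m) \<xi> - fourier_integral (h n) \<xi>) =
      ennreal ((2 * pi) ^ DIM('a)) * L2_sq (\<lambda>x. h m x - h n x)" for m n
    by (rule Plancherel_integrable_diff) (rule h)+
qed (use that L2_fourierI_seq[OF f _ h lim] in auto)

lemma L2_fourier_exists:
  fixes f :: "'a::euclidean_space \<Rightarrow> complex"
  assumes f: "f \<in> L2"
  obtains F where "L2_fourier f F"
  using L2_fourier_exists_seq[OF f ball_trunc_integrable[OF f] ball_trunc_L2[OF f] ball_trunc_LIMSEQ[OF f]] by blast

lemma L2_fourier_cong_AE:
  assumes "L2_fourier f F" and [measurable]: "f' \<in> borel_measurable borel" "F' \<in> borel_measurable borel"
    and ae: "AE x in lborel. f x = f' x" "AE x in lborel. F x = F' x"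
  shows "L2_fourier f' F'"
proof -
  have 1: "L2_sq (\<lambda>x. h x - f x) = L2_sq (\<lambda>x. h x - f' x)" for h
    by (rule L2_sq_cong_AE) (use ae in auto)
  have 2: "L2_sq (\<lambda>x. h x - F x) = L2_sq (\<lambda>x. h x - F' x)" for h
    by (rule L2_sq_cong_AE) (use ae in auto)
  have "L2_sq f = L2_sq f'" "L2_sq F = L2_sq F'" by (intro L2_sq_cong_AE ae)+
  then show ?thesis using assms(1) by (auto simp: L2_fourier_def 1 2 L2_iff)
qed

text \<open>The zero function is used as test function.\<close>

lemma L2_fourier_isometry:
  fixes f :: "'a::euclidean_space \<Rightarrow> complex"
  shows "L2_fourier f F \<Longrightarrow> L2_sq F = ennreal ((2 * pi) ^ DIM('a)) * L2_sq f"
  using L2_fourier_eq[of f F "\<lambda>_. 0"]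
  by (simp add: fourier_integral_def L2_iff L2_sq_def)

lemma L2_fourier_add:
  fixes f :: "'a::euclidean_space \<Rightarrow> complex"
  assumes f: "L2_fourier f F" and g: "L2_fourier g G"
  shows "L2_fourier (\<lambda>x. f x + g x) (\<lambda>x. F x + G x)"
proof -
  note L = L2_fourier_L2[OF f] L2_fourier_L2[OF g]
  note i = ball_trunc_integrable[OF L(1)] ball_trunc_integrable[OF L(3)]
    and l2 = ball_trunc_L2[OF L(1)] ball_trunc_L2[OF L(3)]
    and t = ball_trunc_LIMSEQ[OF L(1)] ball_trunc_LIMSEQ[OF L(3)]
  show ?thesis
  proof (rule L2_fourierI_seq[where h = "\<lambda>n x. ball_trunc (real n) f x + ball_trunc (real n) g x"])
    show "L2_tendsto (\<lambda>j. fourier_integral (\<lambda>x. ball_trunc (real j) f x + ball_trunc (real j) g x)) (\<lambda>x. F x + G x) sequentially"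
      unfolding fourier_integral_add[OF i, abs_def]
      by (intro L2_tendsto_add L2_fourier_tendsto[OF f] L2_fourier_tendsto[OF g] i l2 t L2_measurable fourier_integral_L2 L)
  qed (intro L2_add L Bochner_Integration.integrable_add i l2 L2_tendsto_add t L2_measurable)+
qed

lemma L2_fourier_cmult:
  fixes f :: "'a::euclidean_space \<Rightarrow> complex"
  assumes f: "L2_fourier f F"
  shows "L2_fourier (\<lambda>x. c * f x) (\<lambda>x. c * F x)"
proof -
  note L = L2_fourier_L2[OF f]
  note i = ball_trunc_integrable[OF L(1)] and l2 = ball_trunc_L2[OF L(1)] and t = ball_trunc_LIMSEQ[OF L(1)]
  show ?thesis
  proof (rule L2_fourierI_seq[where h = "\<lambda>n x. c * ball_trunc (real n) f x"])
    show "L2_tendsto (\<lambda>j. fourier_integral (\<lambda>x. c * ball_trunc (real j) f x)) (\<lambda>x. c * F x) sequentially"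
      unfolding fourier_integral_cmult[abs_def]
      by (intro L2_tendsto_cmult L2_fourier_tendsto[OF f] i l2 t L2_measurable fourier_integral_L2 L)
  qed (intro L2_cmult L integrable_mult_right i l2 L2_tendsto_cmult t L2_measurable)+
qed

lemma L2_fourier_diff:
  fixes f :: "'a::euclidean_space \<Rightarrow> complex"
  assumes f: "L2_fourier f F" and g: "L2_fourier g G"
  shows "L2_fourier (\<lambda>x. f x - g x) (\<lambda>x. F x - G x)"
  using L2_fourier_add[OF f L2_fourier_cmult[OF g, of "-1"]] by simp

lemma L2_fourier_diff_isometry:
  fixes f :: "'a::euclidean_space \<Rightarrow> complex"
  assumes "L2_fourier f F" "L2_fourier g G"
  shows "L2_sq (\<lambda>x. F x - G x) = ennreal ((2 * pi) ^ DIM('a)) * L2_sq (\<lambda>x. f x - g x)"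
  by (rule L2_fourier_isometry[OF L2_fourier_diff[OF assms]])

lemma AE_eq_iff_L2_sq:
  assumes [measurable]: "f \<in> borel_measurable borel" "g \<in> borel_measurable borel"
  shows "(AE x in lborel. f x = g x) \<longleftrightarrow> L2_sq (\<lambda>x. f x - g x) = 0"
  by (subst L2_sq_eq_0_iff) auto

lemma L2_fourier_unique:
  fixes f :: "'a::euclidean_space \<Rightarrow> complex"
  assumes "L2_fourier f F" "L2_fourier g G" "AE x in lborel. f x = g x"
  shows "AE x in lborel. F x = G x"
proof -
  note L = L2_fourier_L2[OF assms(1)] L2_fourier_L2[OF assms(2)]
  have "L2_sq (\<lambda>x. f x - g x) = 0" using assms(3) by (simp add: AE_eq_iff_L2_sq[symmetric] L L2_measurable)
  then show ?thesis using L2_fourier_diff_isometry[OF assms(1,2)]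
    by (simp add: AE_eq_iff_L2_sq L L2_measurable)
qed

lemma L2_fourier_closed:
  fixes f :: "'a::euclidean_space \<Rightarrow> complex" and h :: "nat \<Rightarrow> 'a \<Rightarrow> complex"
  assumes f: "f \<in> L2" "F \<in> L2" and h: "\<And>j. L2_fourier (h j) (H j)"
    and lim: "L2_tendsto h f sequentially" "L2_tendsto H F sequentially"
  shows "L2_fourier f F"
  unfolding L2_fourier_def
proof (intro conjI f ballI impI)
  fix g :: "'a \<Rightarrow> complex" assume g: "g \<in> L2" "integrable lborel g"
  have "(\<lambda>j. L2_sq (\<lambda>\<xi>. fourier_integral g \<xi> - H j \<xi>)) \<longlonglongrightarrow> L2_sq (\<lambda>\<xi>. fourier_integral g \<xi> - F \<xi>)"
    by (intro L2_tendsto_L2_sq L2_tendsto_diff_const lim L2_diff fourier_integral_L2 f g L2_fourier_L2[OF h])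
  moreover have "(\<lambda>j. ennreal ((2 * pi) ^ DIM('a)) * L2_sq (\<lambda>x. g x - h j x)) \<longlonglongrightarrow> ennreal ((2 * pi) ^ DIM('a)) * L2_sq (\<lambda>x. g x - f x)"
    by (intro ennreal_tendsto_cmult L2_tendsto_L2_sq L2_tendsto_diff_const lim L2_diff f g L2_fourier_L2[OF h]) auto
  ultimately show "L2_sq (\<lambda>\<xi>. fourier_integral g \<xi> - F \<xi>) = ennreal ((2 * pi) ^ DIM('a)) * L2_sq (\<lambda>x. g x - f x)"
    using L2_fourier_eq[OF h g] by (auto intro: LIMSEQ_unique)
qed

text \<open>For \<open>f\<close> in L2 the two alternatives of \<open>has_fourier\<close> agree: the
  integral satisfies the test identity by Plancherel, and the limit over balls is an instance of an
  approximating sequence with integer radii.\<close>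

lemma has_fourier_iff_L2_fourier:
  fixes f :: "'a::euclidean_space \<Rightarrow> complex"
  assumes f: "f \<in> L2"
  shows "has_fourier f F \<longleftrightarrow> L2_fourier f F"
proof
  assume *: "L2_fourier f F"
  then have "L2_tendsto (\<lambda>R. fourier_integral (ball_trunc R f)) F at_top"
    by (rule L2_fourier_tendsto[OF _ ball_trunc_integrable[OF f] ball_trunc_L2[OF f] ball_trunc_tendsto[OF f]])
  then show "has_fourier f F"
    using L2_fourier_L2[OF *] by (auto simp: has_fourier_def L2_measurable)
next
  assume *: "has_fourier f F"
  then have [measurable]: "F \<in> borel_measurable borel" "f \<in> borel_measurable borel" using f by (auto simp: has_fourier_def)
  from * consider "integrable lborel f" "AE x in lborel. F x = fourier_integral f x"
    | "F \<in> L2" "L2_tendsto (\<lambda>R::real. fourier_integral (ball_trunc R f)) F at_top"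
    by (auto simp: has_fourier_def ae_eq_def)
  then show "L2_fourier f F"
  proof cases
    case 1
    then show ?thesis by (intro L2_fourier_cong_AE[OF L2_fourier_integral[OF 1(1) f]]) auto
  next
    case 2
    have "L2_tendsto (\<lambda>n. fourier_integral (ball_trunc (real n) f)) F sequentially"
      using 2(2) filterlim_real_sequentially unfolding L2_tendsto_iff by (rule filterlim_compose)
    with 2(1) f show ?thesis
      by (intro L2_fourierI_seq[OF _ _ ball_trunc_integrable[OF f] ball_trunc_L2[OF f] ball_trunc_LIMSEQ[OF f]])
  qed
qed

lemma L2_fourier_fourier:
  assumes "f \<in> L2"
  shows "L2_fourier f (fourier f)"
  using someI_ex[of "has_fourier f"] L2_fourier_exists[OF assms]
  unfolding fourier_def has_fourier_iff_L2_fourier[OF assms] by blast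

section \<open>Fourier inversion on \<open>L\<^sup>2\<close>\<close>

text \<open>Real-valued, since polarization subtracts squared norms; it agrees with
  \<open>L2_sq\<close> wherever that is finite.\<close>

definition L2_re :: "('a::euclidean_space \<Rightarrow> complex) \<Rightarrow> real" where
  "L2_re f = enn2real (L2_sq f)"

lemma L2_re_integral: "f \<in> L2 \<Longrightarrow> L2_re f = (LINT x|lborel. (norm (f x))\<^sup>2)"
  by (simp add: L2_re_def L2_sq_eq_integral)

text \<open>The conjugate on \<open>b\<close> makes the cross term the bilinear integral of
  \<open>a x * b x\<close>, the pairing that occurs in the multiplication formula.\<close>

lemma L2_re_polar:
  fixes a b :: "'a::euclidean_space \<Rightarrow> complex"
  assumes a: "a \<in> L2" and b: "b \<in> L2"
  shows "L2_re (\<lambda>x. a x + cnj (b x)) = L2_re a + L2_re b + 2 * Re (LINT x|lborel. a x * b x)"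
proof -
  have ab: "(\<lambda>x. a x + cnj (b x)) \<in> L2" by (intro L2_add L2_cnj a b)
  have int: "integrable lborel (\<lambda>x. a x * b x)" by (rule L2_mult_integrable[OF a b])
  have i: "integrable lborel (\<lambda>x. (norm (a x))\<^sup>2)" "integrable lborel (\<lambda>x. (norm (b x))\<^sup>2)"
    using a b by (auto simp: L2_def)
  have "(norm (a x + cnj (b x)))\<^sup>2 = (norm (a x))\<^sup>2 + (norm (b x))\<^sup>2 + 2 * Re (a x * b x)" for x
    unfolding cmod_power2 by (simp add: power2_eq_square algebra_simps)
  then have "L2_re (\<lambda>x. a x + cnj (b x)) = (LINT x|lborel. (norm (a x))\<^sup>2 + (norm (b x))\<^sup>2 + 2 * Re (a x * b x))"
    unfolding L2_re_integral[OF ab] by simp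
  also have "\<dots> = (LINT x|lborel. (norm (a x))\<^sup>2 + (norm (b x))\<^sup>2) + (LINT x|lborel. 2 * Re (a x * b x))"
    by (rule Bochner_Integration.integral_add) (use i integrable_Re[OF int] in \<open>auto simp del: times_complex.sel\<close>)
  also have "(LINT x|lborel. 2 * Re (a x * b x)) = 2 * Re (LINT x|lborel. a x * b x)"
    by (subst integral_Re[OF int, symmetric]) (simp only: integral_mult_right_zero)
  finally show ?thesis using i by (simp add: L2_re_integral a b)
qed

lemma L2_tendsto_L2_re:
  assumes "\<And>j. F j \<in> L2" "f \<in> L2" "L2_tendsto F f A"
  shows "((\<lambda>j. L2_re (F j)) \<longlongrightarrow> L2_re f) A"
proof -
  have "ennreal (enn2real (L2_sq f)) = L2_sq f" using L2_sq_finite[OF assms(2)] by simp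
  then show ?thesis
    unfolding L2_re_def using L2_tendsto_L2_sq[OF assms] by (intro tendsto_enn2real) auto
qed

text \<open>By polarization this says \<open>Re (\<integral> U v) = Re (\<integral> u V)\<close>; in this form it passes to
  \<open>L\<^sup>2\<close>-limits by continuity of the norm alone.\<close>
lemma L2_fourier_duality:
  fixes u v :: "'a::euclidean_space \<Rightarrow> complex"
  assumes u: "L2_fourier u U" and v: "L2_fourier v V"
  shows "L2_re (\<lambda>x. U x + cnj (v x)) - L2_re U - L2_re v = L2_re (\<lambda>x. V x + cnj (u x)) - L2_re V - L2_re u"
proof -
  note L = L2_fourier_L2[OF u] L2_fourier_L2[OF v]
  define un where "un n = ball_trunc (real n) u" for n
  define vn where "vn n = ball_trunc (real n) v" for n
  have i: "integrable lborel (un n)" "integrable lborel (vn n)" for n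
    unfolding un_def vn_def by (intro ball_trunc_integrable L)+
  have l2: "un n \<in> L2" "vn n \<in> L2" for n unfolding un_def vn_def by (intro ball_trunc_L2 L)+
  have t: "L2_tendsto un u sequentially" "L2_tendsto vn v sequentially"
    unfolding un_def vn_def by (intro ball_trunc_LIMSEQ L)+
  have T: "L2_tendsto (\<lambda>n. fourier_integral (un n)) U sequentially" "L2_tendsto (\<lambda>n. fourier_integral (vn n)) V sequentially"
    by (rule L2_fourier_tendsto[OF u i(1) l2(1) t(1)], rule L2_fourier_tendsto[OF v i(2) l2(2) t(2)])
  note L2n = fourier_integral_L2[OF i(1) l2(1)] fourier_integral_L2[OF i(2) l2(2)]
  let ?A = "\<lambda>n. L2_re (\<lambda>x. fourier_integral (un n) x + cnj (vn n x)) - L2_re (fourier_integral (un n)) - L2_re (vn n)"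
  let ?B = "\<lambda>n. L2_re (\<lambda>x. fourier_integral (vn n) x + cnj (un n x)) - L2_re (fourier_integral (vn n)) - L2_re (un n)"
  have "?A \<longlonglongrightarrow> L2_re (\<lambda>x. U x + cnj (v x)) - L2_re U - L2_re v"
    by (intro tendsto_diff L2_tendsto_L2_re L2_tendsto_add L2_tendsto_cnj L2_add L2_cnj L2_measurable L L2n l2 t T)
  moreover have "?B \<longlonglongrightarrow> L2_re (\<lambda>x. V x + cnj (u x)) - L2_re V - L2_re u"
    by (intro tendsto_diff L2_tendsto_L2_re L2_tendsto_add L2_tendsto_cnj L2_add L2_cnj L2_measurable L L2n l2 t T)
  \<comment> \<open>For truncations both functions are integrable, and by polarization the claim is
    the real part of the multiplication formula.\<close>
  moreover have "?A n = ?B n" for n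
    using fourier_integral_multiplication[OF i(1) i(2), of n n]
    by (simp add: L2_re_polar[OF L2n(1) l2(2)] L2_re_polar[OF L2n(2) l2(1)] mult.commute)
  ultimately show ?thesis by (auto intro: LIMSEQ_unique)
qed

lemma L2_re_cmult: "f \<in> L2 \<Longrightarrow> L2_re (\<lambda>x. c * f x) = (norm c)\<^sup>2 * L2_re f"
  by (simp add: L2_re_def L2_sq_cmult L2_measurable enn2real_mult)

text \<open>With \<open>K\<close> the transform of the conjugate of \<open>F\<close>, the squared
  distance between \<open>K\<close> and \<open>c\<close> times the conjugate of \<open>f\<close> is
  expanded. Duality evaluates the cross term and the isometry the other two; they cancel
  exactly.\<close>

theorem L2_fourier_inversion:
  fixes f :: "'a::euclidean_space \<Rightarrow> complex"
  assumes f: "L2_fourier f F"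
  shows "L2_fourier (\<lambda>x. cnj (F x)) (\<lambda>x. of_real ((2 * pi) ^ DIM('a)) * cnj (f x))"
proof -
  define c :: real where "c = (2 * pi) ^ DIM('a)"
  have c: "c > 0" by (simp add: c_def)
  note L = L2_fourier_L2[OF f]
  have cF: "(\<lambda>x. cnj (F x)) \<in> L2" by (rule L2_cnj[OF L(2)])
  obtain K where K: "L2_fourier (\<lambda>x. cnj (F x)) K" using L2_fourier_exists[OF cF] .
  note LK = L2_fourier_L2(2)[OF K]
  have iso: "L2_re F = c * L2_re f" if "L2_fourier f F" for f F :: "'a \<Rightarrow> complex"
    using L2_fourier_isometry[OF that] c unfolding c_def[symmetric] by (simp add: L2_re_def enn2real_mult)
  have [simp]: "L2_re (\<lambda>x. cnj (g x)) = L2_re g" for g :: "'a \<Rightarrow> complex" by (simp add: L2_re_def)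
  \<comment> \<open>Duality for the pair cnj F and -c f. Its right side is ((1 - c)^2 - c^2 - 1)
    |F|^2 = -2c |F|^2, while |K|^2 and |c f|^2 are each c |F|^2.\<close>
  have "L2_re (\<lambda>x. K x + cnj (of_real (- c) * f x)) - L2_re K - L2_re (\<lambda>x. of_real (- c) * f x) =
        L2_re (\<lambda>x. of_real (- c) * F x + cnj (cnj (F x))) - L2_re (\<lambda>x. of_real (- c) * F x) - L2_re (\<lambda>x. cnj (F x))"
    by (rule L2_fourier_duality[OF K L2_fourier_cmult[OF f]])
  moreover have "(\<lambda>x. of_real (- c) * F x + cnj (cnj (F x))) = (\<lambda>x. of_real (1 - c) * F x)"
    by (auto simp: algebra_simps)
  moreover have "L2_re (\<lambda>x. of_real (1 - c) * F x) = (1 - c)\<^sup>2 * L2_re F"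
    by (subst L2_re_cmult[OF L(2)]) (simp del: of_real_diff)
  moreover have "L2_re (\<lambda>x. of_real (- c) * F x) = c\<^sup>2 * L2_re F" "L2_re (\<lambda>x. of_real (- c) * f x) = c\<^sup>2 * L2_re f"
    by (subst L2_re_cmult; use L c in simp)+
  moreover have "L2_re K = c * L2_re F" using iso[OF K] by simp
  ultimately have "L2_re (\<lambda>x. K x + cnj (of_real (- c) * f x)) = 0"
    using iso[OF f] by (simp add: algebra_simps power2_eq_square)
  moreover have "(\<lambda>x. K x + cnj (of_real (- c) * f x)) = (\<lambda>x. K x - of_real c * cnj (f x))" by auto
  moreover have KL: "(\<lambda>x. K x - of_real c * cnj (f x)) \<in> L2" by (intro L2_diff L2_cmult L2_cnj L LK)
  ultimately have "L2_sq (\<lambda>x. K x - of_real c * cnj (f x)) = 0"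
    using L2_sq_finite[OF KL] by (auto simp: L2_re_def enn2real_eq_0_iff)
  then have "AE x in lborel. K x = of_real c * cnj (f x)"
    by (subst AE_eq_iff_L2_sq) (auto intro!: L2_measurable L2_cmult L2_cnj L LK)
  then have "L2_fourier (\<lambda>x. cnj (F x)) (\<lambda>x. of_real c * cnj (f x))"
    by (intro L2_fourier_cong_AE[OF K]) (auto intro!: L2_measurable L2_cmult L2_cnj L LK)
  then show ?thesis unfolding c_def .
qed

text \<open>Two inversions, one for each conjugation.\<close>
lemma L2_fourier_inverse:
  fixes f :: "'a::euclidean_space \<Rightarrow> complex"
  assumes "L2_fourier (\<lambda>x. cnj (F x)) K"
  shows "L2_fourier (\<lambda>x. of_real (1 / (2 * pi) ^ DIM('a)) * cnj (K x)) (F :: 'a \<Rightarrow> complex)"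
proof -
  have "(\<lambda>x. of_real (1 / (2 * pi) ^ DIM('a)) * (of_real ((2 * pi) ^ DIM('a)) * cnj (cnj (F x)))) = F"
    by auto
  then show ?thesis
    using L2_fourier_cmult[OF L2_fourier_inversion[OF assms], of "of_real (1 / (2 * pi) ^ DIM('a))"] by simp
qed

section \<open>The partial Fourier transform\<close>

lemma L2_sq_slice_measurable [measurable]:
  fixes f :: "'a::euclidean_space \<times> 'b::euclidean_space \<Rightarrow> complex"
  assumes [measurable]: "f \<in> borel_measurable borel"
  shows "(\<lambda>y. L2_sq (\<lambda>x. f (x, y))) \<in> borel_measurable borel" "(\<lambda>x. L2_sq (\<lambda>y. f (x, y))) \<in> borel_measurable borel"
  unfolding L2_sq_def by measurable

lemma
  fixes f :: "'a::euclidean_space \<times> 'b::euclidean_space \<Rightarrow> complex"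
  assumes [measurable]: "f \<in> borel_measurable borel"
  shows L2_sq_slices_snd: "L2_sq f = (\<integral>\<^sup>+y. L2_sq (\<lambda>x. f (x, y)) \<partial>lborel)"
    and L2_sq_slices_fst: "L2_sq f = (\<integral>\<^sup>+x. L2_sq (\<lambda>y. f (x, y)) \<partial>lborel)"
proof -
  have m: "(\<lambda>z. ennreal ((norm (f z))\<^sup>2)) \<in> borel_measurable (lborel \<Otimes>\<^sub>M lborel)"
    by (simp add: lborel_prod)
  show "L2_sq f = (\<integral>\<^sup>+y. L2_sq (\<lambda>x. f (x, y)) \<partial>lborel)"
    unfolding L2_sq_def using lborel_pair.nn_integral_snd[OF m] by (simp add: lborel_prod)
  show "L2_sq f = (\<integral>\<^sup>+x. L2_sq (\<lambda>y. f (x, y)) \<partial>lborel)"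
    unfolding L2_sq_def using lborel.nn_integral_fst[OF m] by (simp add: lborel_prod)
qed

lemma
  fixes f :: "'a::euclidean_space \<times> 'b::euclidean_space \<Rightarrow> complex"
  assumes f: "f \<in> L2"
  shows AE_L2_slice_snd: "AE y in lborel. (\<lambda>x. f (x, y)) \<in> L2"
    and AE_L2_slice_fst: "AE x in lborel. (\<lambda>y. f (x, y)) \<in> L2"
proof -
  have [measurable]: "f \<in> borel_measurable borel" using f by auto
  have "(\<integral>\<^sup>+y. L2_sq (\<lambda>x. f (x, y)) \<partial>lborel) \<noteq> \<infinity>" "(\<integral>\<^sup>+x. L2_sq (\<lambda>y. f (x, y)) \<partial>lborel) \<noteq> \<infinity>"
    using L2_sq_finite[OF f] by (simp_all flip: L2_sq_slices_fst L2_sq_slices_snd)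
  then have "AE y in lborel. L2_sq (\<lambda>x. f (x, y)) \<noteq> \<infinity>" "AE x in lborel. L2_sq (\<lambda>y. f (x, y)) \<noteq> \<infinity>"
    by (intro nn_integral_PInf_AE; measurable)+
  then show "AE y in lborel. (\<lambda>x. f (x, y)) \<in> L2" "AE x in lborel. (\<lambda>y. f (x, y)) \<in> L2"
    by (auto simp: L2_iff less_top)
qed

text \<open>Almost everywhere equality is the vanishing of an \<open>L2_sq\<close>; Tonelli turns
  this into the vanishing of its slices almost everywhere.\<close>

lemma
  fixes f g :: "'a::euclidean_space \<times> 'b::euclidean_space \<Rightarrow> complex"
  assumes [measurable]: "f \<in> borel_measurable borel" "g \<in> borel_measurable borel"
  shows AE_eq_slices_snd: "(AE z in lborel. f z = g z) \<longleftrightarrow> (AE y in lborel. AE x in lborel. f (x, y) = g (x, y))"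
    and AE_eq_slices_fst: "(AE z in lborel. f z = g z) \<longleftrightarrow> (AE x in lborel. AE y in lborel. f (x, y) = g (x, y))"
proof -
  have m0: "(\<lambda>z. f z - g z) \<in> borel_measurable borel" by measurable
  note m = L2_sq_slice_measurable[OF m0]
  have "(AE z in lborel. f z = g z) \<longleftrightarrow> L2_sq (\<lambda>z. f z - g z) = 0"
    by (rule AE_eq_iff_L2_sq) measurable
  also have "\<dots> \<longleftrightarrow> (AE y in lborel. L2_sq (\<lambda>x. f (x, y) - g (x, y)) = 0)"
    unfolding L2_sq_slices_snd[OF m0] by (subst nn_integral_0_iff_AE) (use m in auto)
  finally show "(AE z in lborel. f z = g z) \<longleftrightarrow> (AE y in lborel. AE x in lborel. f (x, y) = g (x, y))"
    by (simp add: AE_eq_iff_L2_sq)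
  have "(AE z in lborel. f z = g z) \<longleftrightarrow> L2_sq (\<lambda>z. f z - g z) = 0"
    by (rule AE_eq_iff_L2_sq) measurable
  also have "\<dots> \<longleftrightarrow> (AE x in lborel. L2_sq (\<lambda>y. f (x, y) - g (x, y)) = 0)"
    unfolding L2_sq_slices_fst[OF m0] by (subst nn_integral_0_iff_AE) (use m in auto)
  finally show "(AE z in lborel. f z = g z) \<longleftrightarrow> (AE x in lborel. AE y in lborel. f (x, y) = g (x, y))"
    by (simp add: AE_eq_iff_L2_sq)
qed

text \<open>Asking for \<open>G\<close> in L2 of the product secures joint measurability, which
  separate choices of a transform on every slice would not give.\<close>

definition partial_fourier ::
  "('a::euclidean_space \<times> 'b::euclidean_space \<Rightarrow> complex) \<Rightarrow> ('a \<times> 'b \<Rightarrow> complex) \<Rightarrow> bool" where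
  "partial_fourier g G \<longleftrightarrow> g \<in> L2 \<and> G \<in> L2 \<and> (AE y in lborel. L2_fourier (\<lambda>x. g (x, y)) (\<lambda>\<xi>. G (\<xi>, y)))"

lemma partial_fourier_L2: "partial_fourier g G \<Longrightarrow> g \<in> L2" "partial_fourier g G \<Longrightarrow> G \<in> L2"
  by (auto simp: partial_fourier_def)

lemma partial_fourier_slices:
  "partial_fourier g G \<Longrightarrow> AE y in lborel. L2_fourier (\<lambda>x. g (x, y)) (\<lambda>\<xi>. G (\<xi>, y))"
  by (auto simp: partial_fourier_def)

lemma L2_sq_partial_isometry:
  fixes g G :: "'a::euclidean_space \<times> 'b::euclidean_space \<Rightarrow> complex"
  assumes [measurable]: "g \<in> borel_measurable borel" "G \<in> borel_measurable borel"
    and ae: "AE y in lborel. L2_fourier (\<lambda>x. g (x, y)) (\<lambda>\<xi>. G (\<xi>, y))"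
  shows "L2_sq G = ennreal ((2 * pi) ^ DIM('a)) * L2_sq g"
proof -
  have "L2_sq G = (\<integral>\<^sup>+y. ennreal ((2 * pi) ^ DIM('a)) * L2_sq (\<lambda>x. g (x, y)) \<partial>lborel)"
    by (subst L2_sq_slices_snd, simp, rule nn_integral_cong_AE)
       (use ae in eventually_elim, rule L2_fourier_isometry)
  also have "\<dots> = ennreal ((2 * pi) ^ DIM('a)) * L2_sq g"
    by (subst nn_integral_cmult, measurable) (simp flip: L2_sq_slices_snd)
  finally show ?thesis .
qed

lemma partial_fourier_isometry:
  fixes g G :: "'a::euclidean_space \<times> 'b::euclidean_space \<Rightarrow> complex"
  shows "partial_fourier g G \<Longrightarrow> L2_sq G = ennreal ((2 * pi) ^ DIM('a)) * L2_sq g"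
  by (intro L2_sq_partial_isometry L2_measurable partial_fourier_L2 partial_fourier_slices)

lemma partial_fourier_add:
  "partial_fourier f F \<Longrightarrow> partial_fourier g G \<Longrightarrow> partial_fourier (\<lambda>z. f z + g z) (\<lambda>z. F z + G z)"
  unfolding partial_fourier_def by (auto intro!: L2_add L2_fourier_add elim: eventually_elim2)

lemma partial_fourier_cmult:
  "partial_fourier f F \<Longrightarrow> partial_fourier (\<lambda>z. c * f z) (\<lambda>z. c * F z)"
  unfolding partial_fourier_def by (auto intro!: L2_cmult L2_fourier_cmult elim: eventually_mono)

lemma partial_fourier_diff:
  "partial_fourier f F \<Longrightarrow> partial_fourier g G \<Longrightarrow> partial_fourier (\<lambda>z. f z - g z) (\<lambda>z. F z - G z)"
  unfolding partial_fourier_def by (auto intro!: L2_diff L2_fourier_diff elim: eventually_elim2)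

lemma partial_fourier_diff_isometry:
  fixes f g :: "'a::euclidean_space \<times> 'b::euclidean_space \<Rightarrow> complex"
  assumes "partial_fourier f F" "partial_fourier g G"
  shows "L2_sq (\<lambda>z. F z - G z) = ennreal ((2 * pi) ^ DIM('a)) * L2_sq (\<lambda>z. f z - g z)"
  by (rule partial_fourier_isometry[OF partial_fourier_diff[OF assms]])

lemma partial_fourier_tendsto:
  fixes f :: "'a::euclidean_space \<times> 'b::euclidean_space \<Rightarrow> complex"
  assumes f: "partial_fourier f F" and h: "\<And>j. partial_fourier (h j) (H j)"
  shows "L2_tendsto H F A \<longleftrightarrow> L2_tendsto h f A"
proof -
  let ?c = "(2 * pi) ^ DIM('a)"
  have c: "?c > 0" by simp
  have eq: "L2_sq (\<lambda>x. H j x - F x) = ennreal ?c * L2_sq (\<lambda>x. h j x - f x)" for j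
    by (rule partial_fourier_diff_isometry[OF h f])
  have eq': "L2_sq (\<lambda>x. h j x - f x) = ennreal (1 / ?c) * L2_sq (\<lambda>x. H j x - F x)" for j
    unfolding eq mult.assoc[symmetric] using c by (subst ennreal_mult[symmetric]) auto
  show ?thesis unfolding L2_tendsto_iff
  proof
    assume "((\<lambda>j. L2_sq (\<lambda>x. H j x - F x)) \<longlongrightarrow> 0) A"
    then have "((\<lambda>j. ennreal (1 / ?c) * L2_sq (\<lambda>x. H j x - F x)) \<longlongrightarrow> ennreal (1 / ?c) * 0) A"
      by (intro ennreal_tendsto_cmult) auto
    then show "((\<lambda>j. L2_sq (\<lambda>x. h j x - f x)) \<longlongrightarrow> 0) A" by (simp add: eq')
  next
    assume "((\<lambda>j. L2_sq (\<lambda>x. h j x - f x)) \<longlongrightarrow> 0) A"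
    then have "((\<lambda>j. ennreal ?c * L2_sq (\<lambda>x. h j x - f x)) \<longlongrightarrow> ennreal ?c * 0) A"
      by (intro ennreal_tendsto_cmult) auto
    then show "((\<lambda>j. L2_sq (\<lambda>x. H j x - F x)) \<longlongrightarrow> 0) A" by (simp add: eq)
  qed
qed

lemma partial_fourier_cong_AE:
  fixes f :: "'a::euclidean_space \<times> 'b::euclidean_space \<Rightarrow> complex"
  assumes f: "partial_fourier f F" and [measurable]: "f' \<in> borel_measurable borel" "F' \<in> borel_measurable borel"
    and ae: "AE z in lborel. f z = f' z" "AE z in lborel. F z = F' z"
  shows "partial_fourier f' F'"
proof -
  note [measurable] = L2_measurable[OF partial_fourier_L2(1)[OF f]] L2_measurable[OF partial_fourier_L2(2)[OF f]]
  have "f' \<in> L2" "F' \<in> L2"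
    using partial_fourier_L2[OF f] L2_sq_cong_AE[OF ae(1)] L2_sq_cong_AE[OF ae(2)] by (auto simp: L2_iff)
  moreover have "AE y in lborel. AE x in lborel. f (x, y) = f' (x, y)" "AE y in lborel. AE x in lborel. F (x, y) = F' (x, y)"
    using ae by (simp_all only: AE_eq_slices_snd[symmetric] assms(2,3) L2_measurable partial_fourier_L2[OF f])
  with partial_fourier_slices[OF f] have "AE y in lborel. L2_fourier (\<lambda>x. f' (x, y)) (\<lambda>\<xi>. F' (\<xi>, y))"
    by eventually_elim (rule L2_fourier_cong_AE, auto)
  ultimately show ?thesis by (simp add: partial_fourier_def)
qed

definition partial_fourier_integral ::
  "('a::euclidean_space \<times> 'b::euclidean_space \<Rightarrow> complex) \<Rightarrow> 'a \<times> 'b \<Rightarrow> complex" where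
  "partial_fourier_integral g z = fourier_integral (\<lambda>x. g (x, snd z)) (fst z)"

lemma partial_fourier_integral_measurable [measurable]:
  fixes g :: "'a::euclidean_space \<times> 'b::euclidean_space \<Rightarrow> complex"
  assumes [measurable]: "g \<in> borel_measurable borel"
  shows "partial_fourier_integral g \<in> borel_measurable borel"
proof -
  have [measurable]: "(fst :: 'a \<times> 'b \<Rightarrow> 'a) \<in> borel_measurable borel" "(snd :: 'a \<times> 'b \<Rightarrow> 'b) \<in> borel_measurable borel"
    by (auto intro!: borel_measurable_continuous_onI continuous_intros)
  show ?thesis unfolding partial_fourier_integral_def[abs_def] fourier_integral_def by measurable
qed

lemma partial_fourier_integral:
  fixes g :: "'a::euclidean_space \<times> 'b::euclidean_space \<Rightarrow> complex"
  assumes g: "integrable lborel g" "g \<in> L2"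
  shows "partial_fourier g (partial_fourier_integral g)"
proof -
  have [measurable]: "g \<in> borel_measurable borel" using g by auto
  have "integrable (lborel \<Otimes>\<^sub>M lborel) (case_prod (\<lambda>x y. g (x, y)))" using g by (simp add: lborel_prod)
  then have "AE y in lborel. integrable lborel (\<lambda>x. g (x, y))" by (rule lborel_pair.AE_integrable_snd)
  then have ae: "AE y in lborel. L2_fourier (\<lambda>x. g (x, y)) (\<lambda>\<xi>. partial_fourier_integral g (\<xi>, y))"
    using AE_L2_slice_snd[OF g(2)]
    by eventually_elim (simp add: partial_fourier_integral_def L2_fourier_integral)
  have "L2_sq (partial_fourier_integral g) = ennreal ((2 * pi) ^ DIM('a)) * L2_sq g"
    by (rule L2_sq_partial_isometry[OF _ _ ae]) measurable
  with g have "partial_fourier_integral g \<in> L2" by (auto simp: L2_iff ennreal_mult_less_top)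
  with g ae show ?thesis by (simp add: partial_fourier_def)
qed

text \<open>L2 convergence on the product gives convergence on almost every slice only along a
  subsequence. On such a slice closedness of the L2 transform applies.\<close>

lemma partial_fourier_closed:
  fixes f :: "'a::euclidean_space \<times> 'b::euclidean_space \<Rightarrow> complex" and h :: "nat \<Rightarrow> 'a \<times> 'b \<Rightarrow> complex"
  assumes f: "f \<in> L2" "F \<in> L2" and h: "\<And>j. partial_fourier (h j) (H j)"
    and lim: "L2_tendsto h f sequentially" "L2_tendsto H F sequentially"
  shows "partial_fourier f F"
proof -
  have [measurable]: "f \<in> borel_measurable borel" "F \<in> borel_measurable borel"
    "h j \<in> borel_measurable borel" "H j \<in> borel_measurable borel" for j
    using f partial_fourier_L2[OF h] by auto
  \<comment> \<open>Both errors are added so that one subsequence serves the functions and their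
    transforms at once.\<close>
  define u where "u j y = L2_sq (\<lambda>x. h j (x, y) - f (x, y)) + L2_sq (\<lambda>x. H j (x, y) - F (x, y))" for j y
  have um [measurable]: "u j \<in> borel_measurable borel" for j
    unfolding u_def using L2_sq_slice_measurable(1)[of "\<lambda>z. h j z - f z"] L2_sq_slice_measurable(1)[of "\<lambda>z. H j z - F z"]
    by measurable
  have "(\<integral>\<^sup>+y. u j y \<partial>lborel) = L2_sq (\<lambda>z. h j z - f z) + L2_sq (\<lambda>z. H j z - F z)" for j
    unfolding u_def
    by (subst nn_integral_add)
       (use L2_sq_slice_measurable(1)[of "\<lambda>z. h j z - f z"] L2_sq_slice_measurable(1)[of "\<lambda>z. H j z - F z"] in
         \<open>auto simp: L2_sq_slices_snd[of "\<lambda>z. h j z - f z"] L2_sq_slices_snd[of "\<lambda>z. H j z - F z"]\<close>)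
  moreover have "(\<lambda>j. L2_sq (\<lambda>z. h j z - f z) + L2_sq (\<lambda>z. H j z - F z)) \<longlonglongrightarrow> 0 + 0"
    using lim unfolding L2_tendsto_iff by (rule tendsto_add)
  ultimately have "(\<lambda>j. \<integral>\<^sup>+y. u j y \<partial>lborel) \<longlonglongrightarrow> 0" by simp
  then obtain r :: "nat \<Rightarrow> nat" where r: "AE y in lborel. (\<lambda>j. u (r j) y) \<longlonglongrightarrow> 0"
    using nn_integral_tendsto_0_AE_subseq[of u lborel] by auto
  have "AE y in lborel. \<forall>j. L2_fourier (\<lambda>x. h j (x, y)) (\<lambda>\<xi>. H j (\<xi>, y))"
    using partial_fourier_slices[OF h] by (simp add: AE_all_countable)
  with r AE_L2_slice_snd[OF f(1)] AE_L2_slice_snd[OF f(2)]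
  have "AE y in lborel. L2_fourier (\<lambda>x. f (x, y)) (\<lambda>\<xi>. F (\<xi>, y))"
  proof eventually_elim
    case (elim y)
    show ?case
    proof (rule L2_fourier_closed[where h = "\<lambda>j x. h (r j) (x, y)" and H = "\<lambda>j x. H (r j) (x, y)"])
      show "L2_tendsto (\<lambda>j x. h (r j) (x, y)) (\<lambda>x. f (x, y)) sequentially"
        unfolding L2_tendsto_iff by (rule tendsto_0_ennreal_le[OF elim(1)]) (simp add: u_def)
      show "L2_tendsto (\<lambda>j x. H (r j) (x, y)) (\<lambda>x. F (x, y)) sequentially"
        unfolding L2_tendsto_iff by (rule tendsto_0_ennreal_le[OF elim(1)]) (simp add: u_def)
    qed (use elim in auto)
  qed
  with f show ?thesis by (simp add: partial_fourier_def)
qed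

lemma partial_fourier_exists_seq:
  fixes f :: "'a::euclidean_space \<times> 'b::euclidean_space \<Rightarrow> complex" and h :: "nat \<Rightarrow> 'a \<times> 'b \<Rightarrow> complex"
  assumes f: "f \<in> L2" and h: "\<And>j. integrable lborel (h j)" "\<And>j. h j \<in> L2"
    and lim: "L2_tendsto h f sequentially"
  obtains r where "partial_fourier f (\<lambda>z. if convergent (\<lambda>k. partial_fourier_integral (h (r k)) z)
    then lim (\<lambda>k. partial_fourier_integral (h (r k)) z) else 0)"
proof (rule L2_complete_transfer[OF h(2) partial_fourier_L2(2)[OF partial_fourier_integral[OF h]] f _ lim])
  show "L2_sq (\<lambda>z. partial_fourier_integral (h m) z - partial_fourier_integral (h n) z) =
      ennreal ((2 * pi) ^ DIM('a)) * L2_sq (\<lambda>z. h m z - h n z)" for m n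
    by (intro partial_fourier_diff_isometry partial_fourier_integral h)
qed (use that partial_fourier_closed[OF f _ partial_fourier_integral[OF h] lim] in auto)

lemma partial_fourier_inverse:
  fixes G :: "'a::euclidean_space \<times> 'b::euclidean_space \<Rightarrow> complex"
  assumes "partial_fourier (\<lambda>z. cnj (G z)) K"
  shows "partial_fourier (\<lambda>z. of_real (1 / (2 * pi) ^ DIM('a)) * cnj (K z)) G"
proof -
  have "G \<in> L2" using L2_cnj[OF partial_fourier_L2(1)[OF assms]] by simp
  moreover have "(\<lambda>z. of_real (1 / (2 * pi) ^ DIM('a)) * cnj (K z)) \<in> L2"
    by (intro L2_cmult L2_cnj partial_fourier_L2(2)[OF assms])
  moreover have "AE y in lborel. L2_fourier (\<lambda>x. of_real (1 / (2 * pi) ^ DIM('a)) * cnj (K (x, y))) (\<lambda>\<xi>. G (\<xi>, y))"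
    using partial_fourier_slices[OF assms] by eventually_elim (rule L2_fourier_inverse)
  ultimately show ?thesis by (simp add: partial_fourier_def)
qed

text \<open>Fubini, with the kernel split into its two variables. Integrability of \<open>g\<close>
  makes this valid at every \<xi>, which matters where transforms are evaluated at prescribed
  points.\<close>

lemma fourier_integral_prod:
  fixes g :: "'a::euclidean_space \<times> 'b::euclidean_space \<Rightarrow> complex"
  assumes g: "integrable lborel g"
  shows "fourier_integral g (\<xi>, \<eta>) = fourier_integral (\<lambda>y. partial_fourier_integral g (\<xi>, y)) \<eta>"
    and "integrable lborel (\<lambda>y. partial_fourier_integral g (\<xi>, y))"
proof -
  have "integrable lborel (\<lambda>z. exp (- (\<i> * of_real (z \<bullet> (\<xi>, \<eta>)))) * g z)"
    by (rule integrable_fourier_kernel[OF g])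
  then have "integrable (lborel \<Otimes>\<^sub>M lborel) (\<lambda>(x, y). exp (- (\<i> * of_real ((x, y) \<bullet> (\<xi>, \<eta>)))) * g (x, y))"
    by (simp add: lborel_prod case_prod_unfold inner_prod_def)
  from lborel_pair.integral_snd[OF this]
  have "fourier_integral g (\<xi>, \<eta>) = (LINT y|lborel. LINT x|lborel. exp (- (\<i> * of_real ((x, y) \<bullet> (\<xi>, \<eta>)))) * g (x, y))"
    by (simp add: fourier_integral_def lborel_prod case_prod_unfold inner_prod_def)
  also have "\<dots> = (LINT y|lborel. LINT x|lborel. exp (- (\<i> * of_real (y \<bullet> \<eta>))) * (exp (- (\<i> * of_real (x \<bullet> \<xi>))) * g (x, y)))"
    by (simp add: distrib_left exp_add exp_diff exp_minus field_simps)
  also have "\<dots> = fourier_integral (\<lambda>y. partial_fourier_integral g (\<xi>, y)) \<eta>"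
    by (simp add: fourier_integral_def partial_fourier_integral_def)
  finally show "fourier_integral g (\<xi>, \<eta>) = fourier_integral (\<lambda>y. partial_fourier_integral g (\<xi>, y)) \<eta>" .
  have "integrable lborel (\<lambda>z. exp (- (\<i> * of_real (z \<bullet> (\<xi>, 0)))) * g z)"
    by (rule integrable_fourier_kernel[OF g])
  then have "integrable (lborel \<Otimes>\<^sub>M lborel) (\<lambda>(x, y). exp (- (\<i> * of_real (x \<bullet> \<xi>))) * g (x, y))"
    by (simp add: lborel_prod case_prod_unfold inner_prod_def)
  from lborel_pair.integrable_snd[OF this]
  show "integrable lborel (\<lambda>y. partial_fourier_integral g (\<xi>, y))"
    by (simp add: fourier_integral_def partial_fourier_integral_def)
qed

text \<open>For ball truncations, Plancherel in the second variable applies on almost every slice. A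
  common subsequence makes the slices of both transforms converge, and the identity of norms passes
  to the limit. Keeping \<xi> fixed is what later admits a weight in \<xi>.\<close>

lemma L2_fourier_slice_isometry:
  fixes g :: "'a::euclidean_space \<times> 'b::euclidean_space \<Rightarrow> complex"
  assumes \<Gamma>: "L2_fourier g \<Gamma>" and G: "partial_fourier g G"
  shows "AE \<xi> in lborel. L2_sq (\<lambda>\<eta>. \<Gamma> (\<xi>, \<eta>)) = ennreal ((2 * pi) ^ DIM('b)) * L2_sq (\<lambda>y. G (\<xi>, y))"
proof -
  note g = L2_fourier_L2(1)[OF \<Gamma>]
  define h where "h n = ball_trunc (real n) g" for n
  have h: "integrable lborel (h n)" "h n \<in> L2" for n
    unfolding h_def by (rule ball_trunc_integrable[OF g], rule ball_trunc_L2[OF g])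
  have lim: "L2_tendsto h g sequentially" unfolding h_def by (rule ball_trunc_LIMSEQ[OF g])
  define H where "H n = partial_fourier_integral (h n)" for n
  define \<Gamma>n where "\<Gamma>n n = fourier_integral (h n)" for n
  have H: "partial_fourier (h n) (H n)" for n unfolding H_def by (rule partial_fourier_integral[OF h])
  have limH: "L2_tendsto H G sequentially" using partial_fourier_tendsto[where h = h and H = H, OF G H] lim by simp
  have lim\<Gamma>: "L2_tendsto \<Gamma>n \<Gamma> sequentially" unfolding \<Gamma>n_def by (rule L2_fourier_tendsto[OF \<Gamma> h lim])
  have L: "\<Gamma> \<in> L2" "G \<in> L2" "H n \<in> L2" "\<Gamma>n n \<in> L2" for n
    using L2_fourier_L2[OF \<Gamma>] partial_fourier_L2[OF G] partial_fourier_L2[OF H] fourier_integral_L2[OF h]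
    by (auto simp: \<Gamma>n_def)
  note [measurable] = L2_measurable[OF L(1)] L2_measurable[OF L(2)] L2_measurable[OF L(3)] L2_measurable[OF L(4)]
  have eq: "AE \<xi> in lborel. L2_sq (\<lambda>\<eta>. \<Gamma>n n (\<xi>, \<eta>)) = ennreal ((2 * pi) ^ DIM('b)) * L2_sq (\<lambda>y. H n (\<xi>, y))" for n
    using AE_L2_slice_fst[OF L(3)[of n]]
  proof eventually_elim
    case (elim \<xi>)
    then show ?case
      using Plancherel_integrable[OF fourier_integral_prod(2)[OF h(1)[of n]], of \<xi>]
      by (simp add: \<Gamma>n_def H_def fourier_integral_prod(1)[OF h(1)[of n]])
  qed
  define u where "u n \<xi> = L2_sq (\<lambda>\<eta>. \<Gamma>n n (\<xi>, \<eta>) - \<Gamma> (\<xi>, \<eta>)) + L2_sq (\<lambda>y. H n (\<xi>, y) - G (\<xi>, y))" for n \<xi>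
  have um [measurable]: "u n \<in> borel_measurable borel" for n
    unfolding u_def using L2_sq_slice_measurable(2)[of "\<lambda>z. \<Gamma>n n z - \<Gamma> z"] L2_sq_slice_measurable(2)[of "\<lambda>z. H n z - G z"]
    by measurable
  have "(\<integral>\<^sup>+\<xi>. u n \<xi> \<partial>lborel) = L2_sq (\<lambda>z. \<Gamma>n n z - \<Gamma> z) + L2_sq (\<lambda>z. H n z - G z)" for n
    unfolding u_def
    by (subst nn_integral_add)
       (use L2_sq_slice_measurable(2)[of "\<lambda>z. \<Gamma>n n z - \<Gamma> z"] L2_sq_slice_measurable(2)[of "\<lambda>z. H n z - G z"] in
         \<open>auto simp: L2_sq_slices_fst[of "\<lambda>z. \<Gamma>n n z - \<Gamma> z"] L2_sq_slices_fst[of "\<lambda>z. H n z - G z"]\<close>)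
  moreover have "(\<lambda>n. L2_sq (\<lambda>z. \<Gamma>n n z - \<Gamma> z) + L2_sq (\<lambda>z. H n z - G z)) \<longlonglongrightarrow> 0 + 0"
    using lim\<Gamma> limH unfolding L2_tendsto_iff by (rule tendsto_add)
  ultimately have "(\<lambda>n. \<integral>\<^sup>+\<xi>. u n \<xi> \<partial>lborel) \<longlonglongrightarrow> 0" by simp
  then obtain r :: "nat \<Rightarrow> nat" where r: "AE \<xi> in lborel. (\<lambda>j. u (r j) \<xi>) \<longlonglongrightarrow> 0"
    using nn_integral_tendsto_0_AE_subseq[of u lborel] by auto
  have "AE \<xi> in lborel. \<forall>n. L2_sq (\<lambda>\<eta>. \<Gamma>n n (\<xi>, \<eta>)) = ennreal ((2 * pi) ^ DIM('b)) * L2_sq (\<lambda>y. H n (\<xi>, y))"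
    using eq by (simp add: AE_all_countable)
  moreover have "AE \<xi> in lborel. \<forall>n. (\<lambda>\<eta>. \<Gamma>n n (\<xi>, \<eta>)) \<in> L2" "AE \<xi> in lborel. \<forall>n. (\<lambda>\<eta>. H n (\<xi>, \<eta>)) \<in> L2"
    using AE_L2_slice_fst[OF L(3)] AE_L2_slice_fst[OF L(4)] by (simp_all add: AE_all_countable)
  ultimately show ?thesis using r AE_L2_slice_fst[OF L(1)] AE_L2_slice_fst[OF L(2)]
  proof eventually_elim
    case (elim \<xi>)
    have "L2_tendsto (\<lambda>j \<eta>. \<Gamma>n (r j) (\<xi>, \<eta>)) (\<lambda>\<eta>. \<Gamma> (\<xi>, \<eta>)) sequentially"
      unfolding L2_tendsto_iff by (rule tendsto_0_ennreal_le[OF elim(4)]) (simp add: u_def)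
    then have 1: "(\<lambda>j. L2_sq (\<lambda>\<eta>. \<Gamma>n (r j) (\<xi>, \<eta>))) \<longlonglongrightarrow> L2_sq (\<lambda>\<eta>. \<Gamma> (\<xi>, \<eta>))"
      using elim by (intro L2_tendsto_L2_sq) auto
    have "L2_tendsto (\<lambda>j y. H (r j) (\<xi>, y)) (\<lambda>y. G (\<xi>, y)) sequentially"
      unfolding L2_tendsto_iff by (rule tendsto_0_ennreal_le[OF elim(4)]) (simp add: u_def)
    then have "(\<lambda>j. L2_sq (\<lambda>y. H (r j) (\<xi>, y))) \<longlonglongrightarrow> L2_sq (\<lambda>y. G (\<xi>, y))"
      using elim by (intro L2_tendsto_L2_sq) auto
    then have "(\<lambda>j. ennreal ((2 * pi) ^ DIM('b)) * L2_sq (\<lambda>y. H (r j) (\<xi>, y))) \<longlonglongrightarrow> ennreal ((2 * pi) ^ DIM('b)) * L2_sq (\<lambda>y. G (\<xi>, y))"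
      by (intro ennreal_tendsto_cmult) auto
    with 1 elim(1) show ?case by (auto intro: LIMSEQ_unique)
  qed
qed

section \<open>Orthogonal invariance\<close>

text \<open>Averaging translates of \<open>A\<close> over a ball, which \<open>U\<close> preserves, compares the image of
  Lebesgue measure under \<open>U\<close> with Lebesgue measure itself.\<close>
lemma lborel_distr_orthogonal:
  fixes U :: "'a::euclidean_space \<Rightarrow> 'a"
  assumes U: "orthogonal_transformation U"
  shows "distr lborel borel U = lborel"
proof (rule measure_eqI)
  fix A assume "A \<in> sets (distr lborel borel U)"
  then have A [measurable]: "A \<in> sets borel" by simp
  have lin: "linear U" by (rule orthogonal_transformation_linear[OF U])
  have [measurable]: "U \<in> borel_measurable borel"
    by (intro borel_measurable_continuous_onI linear_continuous_on lin[unfolded linear_conv_bounded_linear])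
  define V where "V = inv U"
  have UV: "U (V y) = y" for y
    unfolding V_def by (rule surj_f_inv_f[OF orthogonal_transformation_surj[OF U]])
  define B where "B = ball (0::'a) 1"
  have [measurable]: "B \<in> sets borel" by (simp add: B_def)
  define b where "b = emeasure lborel B"
  have b: "b \<noteq> 0" "b \<noteq> top"
    using less_imp_neq[OF unit_ball_vol_pos[of "real DIM('a)"]] by (auto simp: b_def B_def emeasure_ball)
  have bB: "(\<integral>\<^sup>+x. indicator B x \<partial>lborel) = b" by (simp add: b_def)
  \<comment> \<open>The shift of \<open>U x\<close> by \<open>y\<close> is a shift of
    \<open>x\<close> by \<open>V y\<close>, which Lebesgue measure ignores.\<close>
  have shiftU: "(\<integral>\<^sup>+x. indicator A (U x + y) \<partial>lborel) = (\<integral>\<^sup>+x. indicator A (U x) \<partial>lborel)" for y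
  proof -
    have "(\<lambda>x. indicator A (U x) :: ennreal) \<in> borel_measurable borel" by measurable
    from nn_integral_lborel_shift[OF this, of "V y"] show ?thesis
      by (simp add: linear_add[OF lin] UV add.commute)
  qed
  \<comment> \<open>\<open>U\<close> preserves norms, so \<open>y - U x\<close> lies in the ball
    exactly when \<open>V y - x\<close> does; a reflection and a shift then remove
    \<open>y\<close>.\<close>
  have ballU: "(\<integral>\<^sup>+x. indicator B (y - U x) \<partial>lborel) = b" for y
  proof -
    have "indicator B (y - U x) = (indicator B (V y - x) :: ennreal)" for x
    proof -
      have "y - U x = U (V y - x)" by (simp add: linear_diff[OF lin] UV)
      then have "norm (y - U x) = norm (V y - x)" by (simp add: orthogonal_transformation_norm[OF U])
      then show ?thesis by (simp add: B_def indicator_def)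
    qed
    then show ?thesis using nn_integral_lborel_reflect[of "indicator B" "V y"] by (simp add: bB)
  qed
  have "b * emeasure (distr lborel borel U) A = b * (\<integral>\<^sup>+x. indicator A (U x) \<partial>lborel)"
  proof -
    have "emeasure (distr lborel borel U) A = (\<integral>\<^sup>+x. indicator A x \<partial>distr lborel borel U)" by simp
    also have "\<dots> = (\<integral>\<^sup>+x. indicator A (U x) \<partial>lborel)" by (rule nn_integral_distr) measurable
    finally show ?thesis by simp
  qed
  also have "\<dots> = (\<integral>\<^sup>+y. indicator B y * (\<integral>\<^sup>+x. indicator A (U x) \<partial>lborel) \<partial>lborel)"
    by (subst nn_integral_multc) (simp_all only: bB, measurable)
  also have "\<dots> = (\<integral>\<^sup>+y. \<integral>\<^sup>+x. indicator B y * indicator A (U x + y) \<partial>lborel \<partial>lborel)"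
    by (subst nn_integral_cmult) (simp_all only: shiftU, measurable)
  also have "\<dots> = (\<integral>\<^sup>+x. \<integral>\<^sup>+y. indicator B y * indicator A (U x + y) \<partial>lborel \<partial>lborel)"
    by (rule lborel_pair.Fubini') measurable
  also have "\<dots> = (\<integral>\<^sup>+x. \<integral>\<^sup>+y. indicator B (y - U x) * indicator A y \<partial>lborel \<partial>lborel)"
  proof (rule nn_integral_cong)
    fix x
    have "(\<lambda>y. indicator B (y - U x) * indicator A y :: ennreal) \<in> borel_measurable borel" by measurable
    from nn_integral_lborel_shift[OF this, of "U x"]
    show "(\<integral>\<^sup>+y. indicator B y * indicator A (U x + y) \<partial>lborel) = (\<integral>\<^sup>+y. indicator B (y - U x) * indicator A y \<partial>lborel)"
      by simp
  qed
  also have "\<dots> = (\<integral>\<^sup>+y. \<integral>\<^sup>+x. indicator B (y - U x) * indicator A y \<partial>lborel \<partial>lborel)"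
    by (rule lborel_pair.Fubini') measurable
  also have "\<dots> = (\<integral>\<^sup>+y. b * indicator A y \<partial>lborel)"
    by (subst nn_integral_multc) (simp_all only: ballU, measurable)
  also have "\<dots> = b * emeasure lborel A"
    by (rule nn_integral_cmult_indicator) simp
  finally show "emeasure (distr lborel borel U) A = emeasure lborel A"
    using b by (simp add: ennreal_mult_cancel_left)
qed simp

lemma fourier_integral_orthogonal:
  fixes h :: "'a::euclidean_space \<Rightarrow> complex"
  assumes U: "orthogonal_transformation U" and [measurable]: "h \<in> borel_measurable borel" and h: "\<And>y. h (U y) = h y"
  shows "fourier_integral h (U \<eta>) = fourier_integral h \<eta>"
proof -
  have lin: "linear U" by (rule orthogonal_transformation_linear[OF U])
  have [measurable]: "U \<in> borel_measurable borel"
    by (intro borel_measurable_continuous_onI linear_continuous_on lin[unfolded linear_conv_bounded_linear])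
  have "fourier_integral h (U \<eta>) = (LINT y|distr lborel borel U. exp (- (\<i> * of_real (y \<bullet> U \<eta>))) * h y)"
    by (simp add: fourier_integral_def lborel_distr_orthogonal[OF U])
  also have "\<dots> = (LINT y|lborel. exp (- (\<i> * of_real (U y \<bullet> U \<eta>))) * h (U y))"
    by (rule integral_distr) measurable
  also have "\<dots> = fourier_integral h \<eta>"
    using U by (simp add: fourier_integral_def h orthogonal_transformation_def)
  finally show ?thesis .
qed

section \<open>Transforms of functions radial in the second variable\<close>

definition rad_snd :: "('a::euclidean_space \<times> 'a \<Rightarrow> complex) \<Rightarrow> bool" where
  "rad_snd f \<longleftrightarrow> (\<forall>U x y. orthogonal_transformation U \<longrightarrow> f (x, U y) = f (x, y))"

lemma rad_sndD: "rad_snd f \<Longrightarrow> orthogonal_transformation U \<Longrightarrow> f (x, U y) = f (x, y)"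
  by (simp add: rad_snd_def)

lemma L2_rad_iff: "f \<in> L2_rad \<longleftrightarrow> f \<in> L2 \<and> rad_snd f"
  unfolding L2_rad_def rad_snd_def by (auto simp: eq_commute)

text \<open>Intended for \<phi> taking a sequence to its limit if it converges and to 0 otherwise.
  The value at a point depends only on the sequence at that point, so the symmetry survives without
  any convergence hypothesis.\<close>

lemma rad_snd_pointwise:
  "(\<And>j. rad_snd (h j)) \<Longrightarrow> rad_snd (\<lambda>z. \<phi> (\<lambda>j. h j z))"
  by (simp add: rad_snd_def)

lemma rad_snd_ball_trunc: "rad_snd f \<Longrightarrow> rad_snd (ball_trunc R f)"
  unfolding rad_snd_def by (auto simp: norm_Pair orthogonal_transformation_norm indicator_def)

lemma rad_snd_partial_fourier_integral: "rad_snd f \<Longrightarrow> rad_snd (partial_fourier_integral f)"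
  by (simp add: rad_snd_def partial_fourier_integral_def)

lemma rad_snd_fourier_integral:
  assumes f: "integrable lborel f" "rad_snd f"
  shows "rad_snd (fourier_integral f)"
  unfolding rad_snd_def
proof (intro allI impI)
  fix U :: "'a \<Rightarrow> 'a" and \<xi> \<eta> :: 'a assume U: "orthogonal_transformation U"
  show "fourier_integral f (\<xi>, U \<eta>) = fourier_integral f (\<xi>, \<eta>)"
    unfolding fourier_integral_prod(1)[OF f(1)]
    by (rule fourier_integral_orthogonal[OF U])
       (use fourier_integral_prod(2)[OF f(1)] rad_sndD[OF rad_snd_partial_fourier_integral[OF f(2)] U] in auto)
qed

lemma L2_rad_add: "f \<in> L2_rad \<Longrightarrow> g \<in> L2_rad \<Longrightarrow> (\<lambda>z. f z + g z) \<in> L2_rad"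
  by (auto simp: L2_rad_iff L2_add rad_snd_def)

lemma L2_rad_cmult: "f \<in> L2_rad \<Longrightarrow> (\<lambda>z. c * f z) \<in> L2_rad"
  by (auto simp: L2_rad_iff L2_cmult rad_snd_def)

lemma L2_rad_cnj: "f \<in> L2_rad \<Longrightarrow> (\<lambda>z. cnj (f z)) \<in> L2_rad"
  by (auto simp: L2_rad_iff L2_cnj rad_snd_def)

lemma L2_rad_ball_trunc: "f \<in> L2_rad \<Longrightarrow> ball_trunc R f \<in> L2_rad"
  by (simp add: L2_rad_iff ball_trunc_L2 rad_snd_ball_trunc)

text \<open>An arbitrary representative of the transform would be invariant only almost everywhere.
  Ball truncations are radial and integrable, their Fourier integrals are invariant at every point,
  and so is the pointwise limit with default 0.\<close>

lemma L2_rad_fourier: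
  assumes f: "f \<in> L2_rad"
  obtains \<Phi> where "\<Phi> \<in> L2_rad" "L2_fourier f \<Phi>"
proof -
  have L: "f \<in> L2" "rad_snd f" using f by (auto simp: L2_rad_iff)
  define h where "h n = ball_trunc (real n) f" for n
  have h: "integrable lborel (h n)" "h n \<in> L2" "rad_snd (h n)" for n
    unfolding h_def by (rule ball_trunc_integrable[OF L(1)], rule ball_trunc_L2[OF L(1)], rule rad_snd_ball_trunc[OF L(2)])
  have lim: "L2_tendsto h f sequentially" unfolding h_def by (rule ball_trunc_LIMSEQ[OF L(1)])
  obtain r where r: "L2_fourier f (\<lambda>\<xi>. if convergent (\<lambda>k. fourier_integral (h (r k)) \<xi>)
    then lim (\<lambda>k. fourier_integral (h (r k)) \<xi>) else 0)"
    by (rule L2_fourier_exists_seq[OF L(1) h(1,2) lim])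
  moreover have "rad_snd (\<lambda>\<xi>. if convergent (\<lambda>k. fourier_integral (h (r k)) \<xi>)
    then lim (\<lambda>k. fourier_integral (h (r k)) \<xi>) else 0)"
    using rad_snd_pointwise[of "\<lambda>k. fourier_integral (h (r k))" "\<lambda>s. if convergent s then lim s else 0"]
      rad_snd_fourier_integral[OF h(1,3)] by blast
  ultimately show ?thesis using that L2_fourier_L2(2)[OF r] by (auto simp: L2_rad_iff)
qed

lemma L2_rad_partial_fourier:
  assumes f: "f \<in> L2_rad"
  obtains \<Phi> where "\<Phi> \<in> L2_rad" "partial_fourier f \<Phi>"
proof -
  have L: "f \<in> L2" "rad_snd f" using f by (auto simp: L2_rad_iff)
  define h where "h n = ball_trunc (real n) f" for n
  have h: "integrable lborel (h n)" "h n \<in> L2" "rad_snd (h n)" for n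
    unfolding h_def by (rule ball_trunc_integrable[OF L(1)], rule ball_trunc_L2[OF L(1)], rule rad_snd_ball_trunc[OF L(2)])
  have lim: "L2_tendsto h f sequentially" unfolding h_def by (rule ball_trunc_LIMSEQ[OF L(1)])
  obtain r where r: "partial_fourier f (\<lambda>\<xi>. if convergent (\<lambda>k. partial_fourier_integral (h (r k)) \<xi>)
    then lim (\<lambda>k. partial_fourier_integral (h (r k)) \<xi>) else 0)"
    by (rule partial_fourier_exists_seq[OF L(1) h(1,2) lim])
  moreover have "rad_snd (\<lambda>\<xi>. if convergent (\<lambda>k. partial_fourier_integral (h (r k)) \<xi>)
    then lim (\<lambda>k. partial_fourier_integral (h (r k)) \<xi>) else 0)"
    using rad_snd_pointwise[of "\<lambda>k. partial_fourier_integral (h (r k))" "\<lambda>s. if convergent s then lim s else 0"]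
      rad_snd_partial_fourier_integral[OF h(3)] by blast
  ultimately show ?thesis using that partial_fourier_L2(2)[OF r] by (auto simp: L2_rad_iff)
qed

lemma L2_rad_fourier_inverse:
  fixes \<Phi> :: "'a::euclidean_space \<times> 'a \<Rightarrow> complex"
  assumes "\<Phi> \<in> L2_rad"
  obtains f where "f \<in> L2_rad" "L2_fourier f \<Phi>"
proof -
  obtain K where "K \<in> L2_rad" "L2_fourier (\<lambda>z. cnj (\<Phi> z)) K" using L2_rad_fourier[OF L2_rad_cnj[OF assms]] .
  with that[OF L2_rad_cmult[OF L2_rad_cnj[of K]] L2_fourier_inverse[of \<Phi> K]] show ?thesis by blast
qed

lemma L2_rad_partial_fourier_inverse:
  fixes \<Phi> :: "'a::euclidean_space \<times> 'a \<Rightarrow> complex"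
  assumes "\<Phi> \<in> L2_rad"
  obtains f where "f \<in> L2_rad" "partial_fourier f \<Phi>"
proof -
  obtain K where "K \<in> L2_rad" "partial_fourier (\<lambda>z. cnj (\<Phi> z)) K" using L2_rad_partial_fourier[OF L2_rad_cnj[OF assms]] .
  with that[OF L2_rad_cmult[OF L2_rad_cnj[of K]] partial_fourier_inverse[of \<Phi> K]] show ?thesis by blast
qed

section \<open>Dilation in the second variable\<close>

definition dil :: "('a::euclidean_space \<times> 'a \<Rightarrow> complex) \<Rightarrow> 'a \<times> 'a \<Rightarrow> complex" where
  "dil \<Phi> = (\<lambda>(\<xi>, v). of_real (norm \<xi> powr (real DIM('a) / 2)) * \<Phi> (\<xi>, norm \<xi> *\<^sub>R v))"

lemma dil_apply: "dil \<Phi> (\<xi>, v) = of_real (norm \<xi> powr (real DIM('a) / 2)) * \<Phi> (\<xi>, norm \<xi> *\<^sub>R v)"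
  for \<xi> :: "'a::euclidean_space"
  by (simp add: dil_def)

lemma dil_measurable [measurable]:
  fixes \<Phi> :: "'a::euclidean_space \<times> 'a \<Rightarrow> complex"
  assumes [measurable]: "\<Phi> \<in> borel_measurable borel"
  shows "dil \<Phi> \<in> borel_measurable borel"
proof -
  have [measurable]: "(fst :: 'a \<times> 'a \<Rightarrow> 'a) \<in> borel_measurable borel" "(snd :: 'a \<times> 'a \<Rightarrow> 'a) \<in> borel_measurable borel"
    by (auto intro!: borel_measurable_continuous_onI continuous_intros)
  show ?thesis unfolding dil_def case_prod_unfold by measurable
qed

text \<open>The substitution \<eta> = |\<xi>| v costs |\<xi>|^d, which is the square of the
  prefactor. At \<xi> = 0 the dilation collapses the slice, whence the exclusion of this null
  set.\<close>

lemma L2_sq_slice_dil: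
  fixes \<Phi> :: "'a::euclidean_space \<times> 'a \<Rightarrow> complex"
  assumes [measurable]: "\<Phi> \<in> borel_measurable borel" and \<xi>: "\<xi> \<noteq> 0"
  shows "L2_sq (\<lambda>v. dil \<Phi> (\<xi>, v)) = L2_sq (\<lambda>\<eta>. \<Phi> (\<xi>, \<eta>))"
proof -
  have "(norm \<xi> powr (real DIM('a) / 2))\<^sup>2 = norm \<xi> powr (real DIM('a) / 2 * 2)"
    using \<xi> by (simp add: powr_power)
  also have "\<dots> = norm \<xi> ^ DIM('a)" using \<xi> by (simp add: powr_realpow)
  finally have p: "(norm \<xi> powr (real DIM('a) / 2))\<^sup>2 = norm \<xi> ^ DIM('a)" .
  have "L2_sq (\<lambda>v. dil \<Phi> (\<xi>, v)) = ennreal (norm \<xi> ^ DIM('a)) * L2_sq (\<lambda>v. \<Phi> (\<xi>, norm \<xi> *\<^sub>R v))"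
    unfolding dil_apply by (subst L2_sq_cmult) (simp_all add: p)
  also have "\<dots> = L2_sq (\<lambda>\<eta>. \<Phi> (\<xi>, \<eta>))"
    unfolding L2_sq_def using \<xi> by (subst (2) nn_integral_lborel_affine[where c = "norm \<xi>" and t = 0]) auto
  finally show ?thesis .
qed

lemma AE_neq_0: "AE x in lborel. x \<noteq> (0::'a::euclidean_space)"
  by (rule AE_lborel_singleton)

lemma L2_sq_dil:
  fixes \<Phi> :: "'a::euclidean_space \<times> 'a \<Rightarrow> complex"
  assumes [measurable]: "\<Phi> \<in> borel_measurable borel"
  shows "L2_sq (dil \<Phi>) = L2_sq \<Phi>"
  unfolding L2_sq_slices_fst[OF dil_measurable[OF assms]] L2_sq_slices_fst[OF assms]
  by (rule nn_integral_cong_AE, use AE_neq_0 in eventually_elim) (rule L2_sq_slice_dil, simp_all)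

lemma dil_L2: "\<Phi> \<in> L2 \<Longrightarrow> dil \<Phi> \<in> L2"
  by (auto simp: L2_iff L2_sq_dil)

lemma dil_L2_rad: "\<Phi> \<in> L2_rad \<Longrightarrow> dil \<Phi> \<in> L2_rad"
  by (auto simp: L2_rad_iff dil_L2 rad_snd_def dil_apply orthogonal_transformation_linear
      simp flip: linear_scale[OF orthogonal_transformation_linear])

lemma dil_diff: "dil (\<lambda>z. \<Phi> z - \<Psi> z) = (\<lambda>z. dil \<Phi> z - dil \<Psi> z)"
  and dil_add: "dil (\<lambda>z. \<Phi> z + \<Psi> z) = (\<lambda>z. dil \<Phi> z + dil \<Psi> z)"
  and dil_cmult: "dil (\<lambda>z. c * \<Phi> z) = (\<lambda>z. c * dil \<Phi> z)"
  by (auto simp: dil_def algebra_simps)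

lemma dil_cong_AE:
  fixes \<Phi> :: "'a::euclidean_space \<times> 'a \<Rightarrow> complex"
  assumes [measurable]: "\<Phi> \<in> borel_measurable borel" "\<Psi> \<in> borel_measurable borel"
    and "AE z in lborel. \<Phi> z = \<Psi> z"
  shows "AE z in lborel. dil \<Phi> z = dil \<Psi> z"
proof -
  have "L2_sq (\<lambda>z. \<Phi> z - \<Psi> z) = 0" using assms(3) by (simp flip: AE_eq_iff_L2_sq)
  then have "L2_sq (\<lambda>z. dil \<Phi> z - dil \<Psi> z) = 0" by (simp add: L2_sq_dil flip: dil_diff)
  then show ?thesis by (simp add: AE_eq_iff_L2_sq)
qed

text \<open>The inverse dilation is written down explicitly and inverts \<open>dil\<close> for every
  \<xi> other than 0, hence almost everywhere.\<close>

lemma dil_surj: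
  fixes G :: "'a::euclidean_space \<times> 'a \<Rightarrow> complex"
  assumes G: "G \<in> L2_rad"
  obtains \<Phi> where "\<Phi> \<in> L2_rad" "AE z in lborel. dil \<Phi> z = G z"
proof -
  define \<Phi> where "\<Phi> = (\<lambda>(\<xi>, \<eta>). of_real (norm \<xi> powr (- (real DIM('a) / 2))) * G (\<xi>, \<eta> /\<^sub>R norm \<xi>))"
  have [measurable]: "G \<in> borel_measurable borel" using G by (auto simp: L2_rad_iff)
  have [measurable]: "(fst :: 'a \<times> 'a \<Rightarrow> 'a) \<in> borel_measurable borel" "(snd :: 'a \<times> 'a \<Rightarrow> 'a) \<in> borel_measurable borel"
    by (auto intro!: borel_measurable_continuous_onI continuous_intros)
  have m [measurable]: "\<Phi> \<in> borel_measurable borel"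
    unfolding \<Phi>_def case_prod_unfold by measurable
  have eq: "dil \<Phi> (\<xi>, v) = G (\<xi>, v)" if "\<xi> \<noteq> 0" for \<xi> v
  proof -
    have "norm \<xi> powr (real DIM('a) / 2) * norm \<xi> powr (- (real DIM('a) / 2)) = 1"
      using that by (simp add: powr_minus)
    then have "complex_of_real (norm \<xi> powr (real DIM('a) / 2)) * complex_of_real (norm \<xi> powr (- (real DIM('a) / 2))) = 1"
      unfolding of_real_mult[symmetric] by simp
    then show ?thesis using that by (simp add: dil_apply \<Phi>_def mult.assoc[symmetric])
  qed
  have ae: "AE z in lborel. dil \<Phi> z = G z"
    by (subst AE_eq_slices_fst, measurable, use AE_neq_0 in eventually_elim) (simp add: eq)
  \<comment> \<open>Square integrability of \<Phi> is read off the isometry of \<open>dil\<close>,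
    which presupposes only measurability.\<close>
  have "L2_sq \<Phi> = L2_sq G"
    using L2_sq_cong_AE[OF ae] by (simp add: L2_sq_dil)
  then have "\<Phi> \<in> L2" using G by (simp add: L2_iff L2_rad_iff)
  moreover have "rad_snd \<Phi>"
    using G by (auto simp: L2_rad_iff rad_snd_def \<Phi>_def simp flip: linear_scale[OF orthogonal_transformation_linear])
  ultimately show ?thesis using that ae by (simp add: L2_rad_iff)
qed

section \<open>The Fourier description of the map\<close>

text \<open>The graph of the extended operator on the Fourier side. It is a relation because both
  transforms are determined only up to null sets; one representative \<Phi> with this property
  entails it for all.\<close>

definition cone_rel :: "('a::euclidean_space \<times> 'a \<Rightarrow> complex) \<Rightarrow> ('a \<times> 'a \<Rightarrow> complex) \<Rightarrow> bool" where
  "cone_rel f g \<longleftrightarrow> (\<exists>\<Phi>. L2_fourier f \<Phi> \<and> partial_fourier g (dil \<Phi>))"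

lemma cone_relI: "L2_fourier f \<Phi> \<Longrightarrow> partial_fourier g (dil \<Phi>) \<Longrightarrow> cone_rel f g"
  by (auto simp: cone_rel_def)

lemma cone_relD:
  fixes f :: "'a::euclidean_space \<times> 'a \<Rightarrow> complex"
  assumes "cone_rel f g" and \<Phi>: "L2_fourier f \<Phi>"
  shows "partial_fourier g (dil \<Phi>)"
proof -
  obtain \<Psi> where \<Psi>: "L2_fourier f \<Psi>" "partial_fourier g (dil \<Psi>)" using assms(1) by (auto simp: cone_rel_def)
  have [measurable]: "\<Phi> \<in> borel_measurable borel" "\<Psi> \<in> borel_measurable borel" "g \<in> borel_measurable borel"
    using L2_fourier_L2[OF \<Phi>] L2_fourier_L2[OF \<Psi>(1)] partial_fourier_L2[OF \<Psi>(2)] by auto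
  have "AE z in lborel. \<Psi> z = \<Phi> z" by (rule L2_fourier_unique[OF \<Psi>(1) \<Phi>]) simp
  then have "AE z in lborel. dil \<Psi> z = dil \<Phi> z" by (intro dil_cong_AE) auto
  then show ?thesis by (intro partial_fourier_cong_AE[OF \<Psi>(2)]) auto
qed

lemma cone_rel_add: "cone_rel f g \<Longrightarrow> cone_rel f' g' \<Longrightarrow> cone_rel (\<lambda>z. f z + f' z) (\<lambda>z. g z + g' z)"
  unfolding cone_rel_def
proof (elim exE conjE)
  fix \<Phi> \<Psi> assume "L2_fourier f \<Phi>" "L2_fourier f' \<Psi>" "partial_fourier g (dil \<Phi>)" "partial_fourier g' (dil \<Psi>)"
  then show "\<exists>\<Phi>. L2_fourier (\<lambda>z. f z + f' z) \<Phi> \<and> partial_fourier (\<lambda>z. g z + g' z) (dil \<Phi>)"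
    by (intro exI[of _ "\<lambda>z. \<Phi> z + \<Psi> z"]) (auto simp: dil_add intro: L2_fourier_add partial_fourier_add)
qed

lemma cone_rel_cmult: "cone_rel f g \<Longrightarrow> cone_rel (\<lambda>z. c * f z) (\<lambda>z. c * g z)"
  unfolding cone_rel_def
proof (elim exE conjE)
  fix \<Phi> assume "L2_fourier f \<Phi>" "partial_fourier g (dil \<Phi>)"
  then show "\<exists>\<Phi>. L2_fourier (\<lambda>z. c * f z) \<Phi> \<and> partial_fourier (\<lambda>z. c * g z) (dil \<Phi>)"
    by (intro exI[of _ "\<lambda>z. c * \<Phi> z"]) (auto simp: dil_cmult intro: L2_fourier_cmult partial_fourier_cmult)
qed

text \<open>The domain of \<open>f\<close> has dimension 2d, so its transform contributes the square
  of \<open>(2 * pi) ^ DIM('a)\<close>. The partial transform of \<open>g\<close> absorbs one factor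
  and the dilation is unitary.\<close>

lemma cone_rel_isometry:
  fixes f :: "'a::euclidean_space \<times> 'a \<Rightarrow> complex"
  assumes "cone_rel f g"
  shows "L2_sq g = ennreal ((2 * pi) ^ DIM('a)) * L2_sq f"
proof -
  let ?c = "(2 * pi) ^ DIM('a)"
  obtain \<Phi> where \<Phi>: "L2_fourier f \<Phi>" "partial_fourier g (dil \<Phi>)" using assms by (auto simp: cone_rel_def)
  have "ennreal ?c * L2_sq g = L2_sq (dil \<Phi>)" by (rule partial_fourier_isometry[OF \<Phi>(2), symmetric])
  also have "\<dots> = L2_sq \<Phi>" by (rule L2_sq_dil[OF L2_measurable[OF L2_fourier_L2(2)[OF \<Phi>(1)]]])
  also have "\<dots> = ennreal (?c * ?c) * L2_sq f" by (simp add: L2_fourier_isometry[OF \<Phi>(1)] power_add)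
  also have "\<dots> = ennreal ?c * (ennreal ?c * L2_sq f)" by (subst ennreal_mult) (auto simp: mult.assoc)
  finally show ?thesis by (simp add: ennreal_mult_cancel_left)
qed

lemma cone_rel_L2:
  assumes "cone_rel f g"
  shows "f \<in> L2" "g \<in> L2"
  using assms by (auto simp: cone_rel_def L2_fourier_L2 partial_fourier_L2)

text \<open>The isometry applied to a difference, written with the scalar -1. One direction makes
  the map well defined on L2 classes, the other makes it injective.\<close>

lemma cone_rel_AE_eq_iff:
  fixes f :: "'a::euclidean_space \<times> 'a \<Rightarrow> complex"
  assumes fg: "cone_rel f g" and fg': "cone_rel f' g'"
  shows "(AE z in lborel. f z = f' z) \<longleftrightarrow> (AE z in lborel. g z = g' z)"
proof -
  have [measurable]: "f \<in> borel_measurable borel" "f' \<in> borel_measurable borel"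
    "g \<in> borel_measurable borel" "g' \<in> borel_measurable borel"
    using cone_rel_L2[OF fg] cone_rel_L2[OF fg'] by (auto simp: L2_measurable)
  have "L2_sq (\<lambda>z. g z + (-1) * g' z) = ennreal ((2 * pi) ^ DIM('a)) * L2_sq (\<lambda>z. f z + (-1) * f' z)"
    by (intro cone_rel_isometry cone_rel_add fg cone_rel_cmult fg')
  then show ?thesis by (simp add: AE_eq_iff_L2_sq)
qed

lemma cone_rel_exists:
  assumes "f \<in> L2_rad"
  obtains g where "g \<in> L2_rad" "cone_rel f g"
proof -
  obtain \<Phi> where \<Phi>: "\<Phi> \<in> L2_rad" "L2_fourier f \<Phi>" using L2_rad_fourier[OF assms] .
  obtain g where "g \<in> L2_rad" "partial_fourier g (dil \<Phi>)"
    using L2_rad_partial_fourier_inverse[OF dil_L2_rad[OF \<Phi>(1)]] .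
  with that cone_relI[OF \<Phi>(2)] show ?thesis by blast
qed

text \<open>The factors are undone in reverse order, each within radial functions. The dilation is
  inverted only almost everywhere, so the partial transform of \<open>g\<close> is exchanged for an
  equivalent representative.\<close>

lemma cone_rel_surj:
  fixes g :: "'a::euclidean_space \<times> 'a \<Rightarrow> complex"
  assumes "g \<in> L2_rad"
  obtains f where "f \<in> L2_rad" "cone_rel f g"
proof -
  obtain G where G: "G \<in> L2_rad" "partial_fourier g G" using L2_rad_partial_fourier[OF assms] .
  obtain \<Phi> where \<Phi>: "\<Phi> \<in> L2_rad" "AE z in lborel. dil \<Phi> z = G z" using dil_surj[OF G(1)] .
  obtain f where f: "f \<in> L2_rad" "L2_fourier f \<Phi>" using L2_rad_fourier_inverse[OF \<Phi>(1)] .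
  have "partial_fourier g (dil \<Phi>)"
    by (rule partial_fourier_cong_AE[OF G(2)])
       (use assms \<Phi> dil_L2[of \<Phi>] in \<open>auto simp: L2_rad_iff L2_measurable eq_commute\<close>)
  with that f cone_relI show ?thesis by blast
qed

lemma cone_rel_tendsto:
  fixes f :: "'a::euclidean_space \<times> 'a \<Rightarrow> complex"
  assumes fg: "cone_rel f g" and h: "\<And>j. cone_rel (h j) (k j)"
  shows "L2_tendsto h f A \<Longrightarrow> L2_tendsto k g A"
proof -
  assume lim: "L2_tendsto h f A"
  have eq: "L2_sq (\<lambda>z. k j z + (-1) * g z) = ennreal ((2 * pi) ^ DIM('a)) * L2_sq (\<lambda>z. h j z + (-1) * f z)" for j
    by (intro cone_rel_isometry cone_rel_add h cone_rel_cmult fg)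
  have "((\<lambda>j. ennreal ((2 * pi) ^ DIM('a)) * L2_sq (\<lambda>z. h j z - f z)) \<longlongrightarrow> ennreal ((2 * pi) ^ DIM('a)) * 0) A"
    using lim unfolding L2_tendsto_iff by (intro ennreal_tendsto_cmult) auto
  then show ?thesis using eq by (simp add: L2_tendsto_iff)
qed

lemma cone_rel_cong_AE:
  fixes f :: "'a::euclidean_space \<times> 'a \<Rightarrow> complex"
  assumes fg: "cone_rel f g" and [measurable]: "g' \<in> borel_measurable borel" and ae: "AE z in lborel. g z = g' z"
  shows "cone_rel f g'"
proof -
  obtain \<Phi> where \<Phi>: "L2_fourier f \<Phi>" "partial_fourier g (dil \<Phi>)" using fg by (auto simp: cone_rel_def)
  have "partial_fourier g' (dil \<Phi>)"
    by (rule partial_fourier_cong_AE[OF \<Phi>(2)]) (use ae partial_fourier_L2[OF \<Phi>(2)] in \<open>auto simp: L2_measurable\<close>)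
  with \<Phi> cone_relI show ?thesis by blast
qed

section \<open>Weighted norms\<close>

text \<open>\<open>fourier f\<close> is an arbitrary choice, but two transforms of \<open>f\<close>
  agree on almost every slice. The weight is constant on slices, so only slice norms enter and any
  transform may be used.\<close>

lemma H_norm_sq_eq:
  fixes f :: "'a::euclidean_space \<times> 'a \<Rightarrow> complex"
  assumes f: "L2_fourier f \<Phi>"
  shows "H_norm_sq \<gamma> f = (\<integral>\<^sup>+\<xi>. L2_sq (\<lambda>\<eta>. \<Phi> (\<xi>, \<eta>)) * ennreal ((1 + (norm \<xi>)\<^sup>2) powr \<gamma>) \<partial>lborel)"
proof -
  have F: "L2_fourier f (fourier f)" by (rule L2_fourier_fourier[OF L2_fourier_L2(1)[OF f]])
  have [measurable]: "fourier f \<in> borel_measurable borel" "\<Phi> \<in> borel_measurable borel"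
    using L2_fourier_L2[OF F] L2_fourier_L2[OF f] by auto
  have "AE z in lborel. fourier f z = \<Phi> z" by (rule L2_fourier_unique[OF F f]) simp
  then have "AE \<xi> in lborel. AE \<eta> in lborel. fourier f (\<xi>, \<eta>) = \<Phi> (\<xi>, \<eta>)" by (simp add: AE_eq_slices_fst)
  then have ae: "AE \<xi> in lborel. L2_sq (\<lambda>\<eta>. fourier f (\<xi>, \<eta>)) = L2_sq (\<lambda>\<eta>. \<Phi> (\<xi>, \<eta>))"
    by eventually_elim (rule L2_sq_cong_AE)
  have "H_norm_sq \<gamma> f = (\<integral>\<^sup>+\<xi>. L2_sq (\<lambda>\<eta>. fourier f (\<xi>, \<eta>)) * ennreal ((1 + (norm \<xi>)\<^sup>2) powr \<gamma>) \<partial>lborel)"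
    unfolding H_norm_sq_def L2_sq_def by (simp add: ennreal_mult nn_integral_multc)
  also have "\<dots> = (\<integral>\<^sup>+\<xi>. L2_sq (\<lambda>\<eta>. \<Phi> (\<xi>, \<eta>)) * ennreal ((1 + (norm \<xi>)\<^sup>2) powr \<gamma>) \<partial>lborel)"
    by (rule nn_integral_cong_AE) (use ae in eventually_elim, simp)
  finally show ?thesis .
qed

lemma H_norm_sq_cone_rel:
  fixes f :: "'a::euclidean_space \<times> 'a \<Rightarrow> complex"
  assumes "cone_rel f g"
  shows "H_norm_sq \<gamma> g = ennreal ((2 * pi) ^ DIM('a)) * H_norm_sq \<gamma> f"
proof -
  obtain \<Phi> where \<Phi>: "L2_fourier f \<Phi>" "partial_fourier g (dil \<Phi>)" using assms by (auto simp: cone_rel_def)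
  obtain \<Gamma> where \<Gamma>: "L2_fourier g \<Gamma>" using L2_fourier_exists[OF partial_fourier_L2(1)[OF \<Phi>(2)]] .
  have m [measurable]: "\<Phi> \<in> borel_measurable borel" using L2_fourier_L2[OF \<Phi>(1)] by auto
  have "AE \<xi> in lborel. L2_sq (\<lambda>\<eta>. \<Gamma> (\<xi>, \<eta>)) = ennreal ((2 * pi) ^ DIM('a)) * L2_sq (\<lambda>\<eta>. \<Phi> (\<xi>, \<eta>))"
    using L2_fourier_slice_isometry[OF \<Gamma> \<Phi>(2)] AE_neq_0
    by eventually_elim (simp add: L2_sq_slice_dil)
  then have "H_norm_sq \<gamma> g = (\<integral>\<^sup>+\<xi>. ennreal ((2 * pi) ^ DIM('a)) * (L2_sq (\<lambda>\<eta>. \<Phi> (\<xi>, \<eta>)) * ennreal ((1 + (norm \<xi>)\<^sup>2) powr \<gamma>)) \<partial>lborel)"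
    unfolding H_norm_sq_eq[OF \<Gamma>]
    by (intro nn_integral_cong_AE, elim eventually_mono) (simp add: mult.assoc)
  also have "\<dots> = ennreal ((2 * pi) ^ DIM('a)) * H_norm_sq \<gamma> f"
    unfolding H_norm_sq_eq[OF \<Phi>(1)] by (rule nn_integral_cmult) measurable
  finally show ?thesis .
qed

section \<open>The cone transform\<close>

text \<open>If \<open>f\<close> is also in L2, the limit over balls agrees almost everywhere with
  the integral. This is the form suited to slices of the cone transform, whose integrability is what
  is established.\<close>

lemma has_fourier_integrable_iff:
  fixes f :: "'a::euclidean_space \<Rightarrow> complex"
  assumes f: "integrable lborel f"
  shows "has_fourier f F \<longleftrightarrow> F \<in> borel_measurable borel \<and> (AE x in lborel. F x = fourier_integral f x)"
proof
  assume *: "has_fourier f F"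
  show "F \<in> borel_measurable borel \<and> (AE x in lborel. F x = fourier_integral f x)"
  proof (cases "f \<in> L2")
    case True
    then have F: "L2_fourier f F" using * by (simp add: has_fourier_iff_L2_fourier)
    then have "AE x in lborel. F x = fourier_integral f x"
      by (rule L2_fourier_unique[OF _ L2_fourier_integral[OF f True]]) simp
    with L2_fourier_L2[OF F] show ?thesis by (simp add: L2_measurable)
  qed (use * in \<open>auto simp: has_fourier_def ae_eq_def\<close>)
qed (use f in \<open>auto simp: has_fourier_def ae_eq_def\<close>)

text \<open>For each \<open>v\<close>, the shear (u, y) -> (u + |v| y, y) preserves Lebesgue
  measure: for fixed y it is a translation in u. Hence the slice is integrable for every
  \<open>v\<close>, and the translation leaves behind a phase that is the Fourier kernel in y at
  frequency -|v| \<xi>.\<close>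

lemma
  fixes f :: "'a::euclidean_space \<times> 'a \<Rightarrow> complex"
  assumes f: "integrable lborel f"
  shows cone_transform_slice_integrable: "integrable lborel (\<lambda>u. cone_transform f (u, v))"
    and fourier_cone_transform_slice:
      "fourier_integral (\<lambda>u. cone_transform f (u, v)) \<xi> = fourier_integral f (\<xi>, - (norm v *\<^sub>R \<xi>))"
proof -
  have [measurable]: "f \<in> borel_measurable borel" using f by auto
  let ?c = "norm v"
  have m: "(\<lambda>(u, y). f (u + ?c *\<^sub>R y, y)) \<in> borel_measurable (lborel \<Otimes>\<^sub>M lborel)" by measurable
  have f': "integrable (lborel \<Otimes>\<^sub>M lborel) f" using f by (simp add: lborel_prod)
  have shear: "integrable (lborel \<Otimes>\<^sub>M lborel) (\<lambda>(u, y). f (u + ?c *\<^sub>R y, y))"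
    unfolding integrable_iff_bounded
  proof (intro conjI m)
    have "(\<integral>\<^sup>+z. ennreal (norm (case z of (u, y) \<Rightarrow> f (u + ?c *\<^sub>R y, y))) \<partial>(lborel \<Otimes>\<^sub>M lborel)) =
      (\<integral>\<^sup>+y. \<integral>\<^sup>+u. ennreal (norm (f (u + ?c *\<^sub>R y, y))) \<partial>lborel \<partial>lborel)"
      by (subst lborel_pair.nn_integral_snd[symmetric]) (use m in auto)
    also have "\<dots> = (\<integral>\<^sup>+y. \<integral>\<^sup>+u. ennreal (norm (f (u, y))) \<partial>lborel \<partial>lborel)"
    proof (rule nn_integral_cong)
      fix y
      have "(\<lambda>u. ennreal (norm (f (u, y)))) \<in> borel_measurable borel" by measurable
      from nn_integral_lborel_shift[OF this, of "?c *\<^sub>R y"]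
      show "(\<integral>\<^sup>+u. ennreal (norm (f (u + ?c *\<^sub>R y, y))) \<partial>lborel) = (\<integral>\<^sup>+u. ennreal (norm (f (u, y))) \<partial>lborel)"
        by (simp add: add.commute)
    qed
    also have "\<dots> = (\<integral>\<^sup>+z. ennreal (norm (f z)) \<partial>(lborel \<Otimes>\<^sub>M lborel))"
      by (subst lborel_pair.nn_integral_snd[symmetric]) (use f' in auto)
    also have "\<dots> < \<infinity>" using f' by (simp add: integrable_iff_bounded)
    finally show "(\<integral>\<^sup>+z. ennreal (norm (case z of (u, y) \<Rightarrow> f (u + ?c *\<^sub>R y, y))) \<partial>(lborel \<Otimes>\<^sub>M lborel)) < \<infinity>" .
  qed
  show "integrable lborel (\<lambda>u. cone_transform f (u, v))"
    using lborel_pair.integrable_fst[OF shear] by (simp add: cone_transform_def)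
  have K: "integrable (lborel \<Otimes>\<^sub>M lborel) (\<lambda>(u, y). exp (- (\<i> * of_real (u \<bullet> \<xi>))) * f (u + ?c *\<^sub>R y, y))"
    by (rule Bochner_Integration.integrable_bound[OF shear]) (auto simp: norm_mult)
  have "fourier_integral (\<lambda>u. cone_transform f (u, v)) \<xi> =
      (LINT u|lborel. LINT y|lborel. exp (- (\<i> * of_real (u \<bullet> \<xi>))) * f (u + ?c *\<^sub>R y, y))"
    by (simp add: fourier_integral_def cone_transform_def)
  also have "\<dots> = (LINT y|lborel. LINT u|lborel. exp (- (\<i> * of_real (u \<bullet> \<xi>))) * f (u + ?c *\<^sub>R y, y))"
    by (rule lborel_pair.Fubini_integral[OF K, symmetric])
  \<comment> \<open>Moving the shift from \<open>f\<close> to the exponential separates the phase in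
    \<open>y\<close> from the transform in \<open>u\<close>.\<close>
  also have "\<dots> = (LINT y|lborel. exp (- (\<i> * of_real (y \<bullet> (- (?c *\<^sub>R \<xi>))))) * partial_fourier_integral f (\<xi>, y))"
  proof (rule Bochner_Integration.integral_cong[OF refl])
    fix y
    have "(\<lambda>u. exp (- (\<i> * of_real ((u - ?c *\<^sub>R y) \<bullet> \<xi>))) * f (u, y)) \<in> borel_measurable borel" by measurable
    from integral_lborel_shift[OF this, of "?c *\<^sub>R y"]
    have "(LINT u|lborel. exp (- (\<i> * of_real (u \<bullet> \<xi>))) * f (u + ?c *\<^sub>R y, y)) =
      (LINT u|lborel. exp (- (\<i> * of_real ((u - ?c *\<^sub>R y) \<bullet> \<xi>))) * f (u, y))"
      by (simp add: add.commute)
    also have "\<dots> = (LINT u|lborel. exp (- (\<i> * of_real (y \<bullet> (- (?c *\<^sub>R \<xi>))))) * (exp (- (\<i> * of_real (u \<bullet> \<xi>))) * f (u, y)))"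
    proof -
      have "exp (- (\<i> * of_real ((u - ?c *\<^sub>R y) \<bullet> \<xi>))) =
          exp (- (\<i> * of_real (y \<bullet> (- (?c *\<^sub>R \<xi>))))) * exp (- (\<i> * complex_of_real (u \<bullet> \<xi>)))" for u
        unfolding exp_add[symmetric] by (rule arg_cong[of _ _ exp]) (simp add: inner_diff_left algebra_simps)
      then show ?thesis by (simp only: mult.assoc)
    qed
    also have "\<dots> = exp (- (\<i> * of_real (y \<bullet> (- (?c *\<^sub>R \<xi>))))) * partial_fourier_integral f (\<xi>, y)"
      by (simp only: integral_mult_right_zero partial_fourier_integral_def fourier_integral_def fst_conv snd_conv)
    finally show "(LINT u|lborel. exp (- (\<i> * of_real (u \<bullet> \<xi>))) * f (u + ?c *\<^sub>R y, y)) =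
      exp (- (\<i> * of_real (y \<bullet> (- (?c *\<^sub>R \<xi>))))) * partial_fourier_integral f (\<xi>, y)" .
  qed
  also have "\<dots> = fourier_integral f (\<xi>, - (norm v *\<^sub>R \<xi>))"
    unfolding fourier_integral_prod(1)[OF f] by (simp add: fourier_integral_def)
  finally show "fourier_integral (\<lambda>u. cone_transform f (u, v)) \<xi> = fourier_integral f (\<xi>, - (norm v *\<^sub>R \<xi>))" .
qed

text \<open>The points -|v| \<xi> and |\<xi>| v have the same length, so an orthogonal map carries
  one to the other. The transform is invariant at every point, hence the identity holds for all
  \<xi> and \<open>v\<close>.\<close>

lemma dil_fourier_integral:
  fixes f :: "(real^'m) \<times> (real^'m) \<Rightarrow> complex"
  assumes f: "integrable lborel f" "rad_snd f"
  shows "dil (fourier_integral f) (\<xi>, v) =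
    of_real (norm \<xi> powr (real CARD('m) / 2)) * fourier_integral (\<lambda>u. cone_transform f (u, v)) \<xi>"
proof -
  have "norm (- (norm v *\<^sub>R \<xi>)) = norm (norm \<xi> *\<^sub>R v)" by simp
  then obtain U where U: "orthogonal_transformation U" "U (- (norm v *\<^sub>R \<xi>)) = norm \<xi> *\<^sub>R v"
    by (rule orthogonal_transformation_exists)
  have "fourier_integral f (\<xi>, norm \<xi> *\<^sub>R v) = fourier_integral f (\<xi>, - (norm v *\<^sub>R \<xi>))"
    using rad_sndD[OF rad_snd_fourier_integral[OF f] U(1), of \<xi> "- (norm v *\<^sub>R \<xi>)"] unfolding U(2) .
  then show ?thesis by (simp add: dil_apply fourier_cone_transform_slice[OF f(1)])
qed

text \<open>On a slice where \<open>g\<close> is in L2, both existentially quantified transforms are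
  determined up to null sets, so they may be taken to be the canonical ones. The order -d/2 of the
  potential gives the multiplier exponent +d/2, which is that of \<open>dil\<close>.\<close>

lemma is_riesz1_cone_iff:
  fixes f :: "(real^'m) \<times> (real^'m) \<Rightarrow> complex"
  assumes f: "integrable lborel f" "f \<in> L2_rad" and g: "g \<in> L2"
  shows "is_riesz1 (- (real CARD('m) / 2)) (cone_transform f) g \<longleftrightarrow> partial_fourier g (dil (fourier_integral f))"
proof -
  have L: "f \<in> L2" "rad_snd f" using f by (auto simp: L2_rad_iff)
  have [measurable]: "f \<in> borel_measurable borel" "g \<in> borel_measurable borel" using L g by auto
  have D: "dil (fourier_integral f) \<in> L2" by (intro dil_L2 fourier_integral_L2 f L)
  let ?A = "\<lambda>v. fourier_integral (\<lambda>u. cone_transform f (u, v))"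
  let ?D = "\<lambda>v \<xi>. dil (fourier_integral f) (\<xi>, v)"
  have cm [measurable]: "(\<lambda>u. cone_transform f (u, v)) \<in> borel_measurable borel" for v
    using cone_transform_slice_integrable[OF f(1), of v] by auto
  have Dm [measurable]: "?D v \<in> borel_measurable borel" for v by measurable
  have iff: "(\<exists>A H. has_fourier (\<lambda>u. cone_transform f (u, v)) A \<and> has_fourier (\<lambda>u. g (u, v)) H \<and>
        (AE \<xi> in lborel. H \<xi> = of_real (norm \<xi> powr (real CARD('m) / 2)) * A \<xi>)) \<longleftrightarrow> L2_fourier (\<lambda>u. g (u, v)) (?D v)"
    if gv: "(\<lambda>u. g (u, v)) \<in> L2" for v
  proof
    assume "\<exists>A H. has_fourier (\<lambda>u. cone_transform f (u, v)) A \<and> has_fourier (\<lambda>u. g (u, v)) H \<and>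
        (AE \<xi> in lborel. H \<xi> = of_real (norm \<xi> powr (real CARD('m) / 2)) * A \<xi>)"
    then obtain A H where A: "AE \<xi> in lborel. A \<xi> = ?A v \<xi>" and H: "L2_fourier (\<lambda>u. g (u, v)) H"
      and HA: "AE \<xi> in lborel. H \<xi> = of_real (norm \<xi> powr (real CARD('m) / 2)) * A \<xi>"
      using has_fourier_integrable_iff[OF cone_transform_slice_integrable[OF f(1)]] has_fourier_iff_L2_fourier[OF gv] by blast
    have "AE \<xi> in lborel. H \<xi> = ?D v \<xi>"
      using A HA by eventually_elim (simp add: dil_fourier_integral[OF f(1) L(2)])
    then show "L2_fourier (\<lambda>u. g (u, v)) (?D v)"
      by (intro L2_fourier_cong_AE[OF H]) auto
  next
    assume "L2_fourier (\<lambda>u. g (u, v)) (?D v)"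
    then have "has_fourier (\<lambda>u. g (u, v)) (?D v)" using has_fourier_iff_L2_fourier[OF gv] by blast
    moreover have "has_fourier (\<lambda>u. cone_transform f (u, v)) (?A v)"
      by (subst has_fourier_integrable_iff[OF cone_transform_slice_integrable[OF f(1)]]) auto
    moreover have "AE \<xi> in lborel. ?D v \<xi> = of_real (norm \<xi> powr (real CARD('m) / 2)) * ?A v \<xi>"
      by (simp add: dil_fourier_integral[OF f(1) L(2)])
    ultimately show "\<exists>A H. has_fourier (\<lambda>u. cone_transform f (u, v)) A \<and> has_fourier (\<lambda>u. g (u, v)) H \<and>
        (AE \<xi> in lborel. H \<xi> = of_real (norm \<xi> powr (real CARD('m) / 2)) * A \<xi>)" by blast
  qed
  have "is_riesz1 (- (real CARD('m) / 2)) (cone_transform f) g \<longleftrightarrow> (AE v in lborel. L2_fourier (\<lambda>u. g (u, v)) (?D v))"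
    unfolding is_riesz1_def minus_minus
    by (rule eventually_cong[OF AE_L2_slice_snd[OF g]]) (rule iff)
  then show ?thesis using g D by (simp add: partial_fourier_def)
qed

lemma cone_rel_integrable_iff:
  fixes f :: "(real^'m) \<times> (real^'m) \<Rightarrow> complex"
  assumes f: "integrable lborel f" "f \<in> L2_rad" and g: "g \<in> L2"
  shows "is_riesz1 (- (real CARD('m) / 2)) (cone_transform f) g \<longleftrightarrow> cone_rel f g"
proof -
  have \<Phi>: "L2_fourier f (fourier_integral f)"
    by (rule L2_fourier_integral) (use f in \<open>auto simp: L2_rad_iff\<close>)
  show ?thesis
    unfolding is_riesz1_cone_iff[OF f g] using cone_relI[OF \<Phi>] cone_relD[OF _ \<Phi>] by blast
qed

text \<open>The extension by L2 limits does not depend on the approximants, because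
  \<open>cone_rel\<close> is isometric up to a factor. Conversely ball truncations supply
  approximants that are both radial and integrable.\<close>

lemma is_riesz_cone_iff:
  fixes f g :: "(real^'m) \<times> (real^'m) \<Rightarrow> complex"
  shows "is_riesz_cone (- (real CARD('m) / 2)) f g \<longleftrightarrow> f \<in> L2_rad \<and> g \<in> L2_rad \<and> cone_rel f g"
proof (intro iffI conjI; (elim conjE)?)
  assume *: "is_riesz_cone (- (real CARD('m) / 2)) f g"
  then show f: "f \<in> L2_rad" and g: "g \<in> L2_rad" by (auto simp: is_riesz_cone_def)
  from * obtain F G where F: "\<And>j::nat. F j \<in> L2_rad" "\<And>j. integrable lborel (F j)" and G: "\<And>j. G j \<in> L2"
    and FG: "\<And>j. is_riesz1 (- (real CARD('m) / 2)) (cone_transform (F j)) (G j)"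
    and lim: "L2_tendsto F f sequentially" "L2_tendsto G g sequentially"
    unfolding is_riesz_cone_def by blast
  have rel: "cone_rel (F j) (G j)" for j using FG cone_rel_integrable_iff[OF F(2,1) G] by blast
  \<comment> \<open>\<open>g'\<close> is the image furnished by existence; the isometry makes
    \<open>G\<close> converge to it, and uniqueness of L2 limits identifies it with
    \<open>g\<close>.\<close>
  obtain g' where g': "g' \<in> L2_rad" "cone_rel f g'" using cone_rel_exists[OF f] .
  have "L2_tendsto G g' sequentially" by (rule cone_rel_tendsto[OF g'(2) rel lim(1)])
  then have "AE z in lborel. g' z = g z"
    by (rule L2_tendsto_unique[rotated 3, OF _ lim(2)]) (use G g g' in \<open>auto simp: L2_rad_iff L2_measurable\<close>)
  then show "cone_rel f g"
    by (intro cone_rel_cong_AE[OF g'(2)]) (use g in \<open>auto simp: L2_rad_iff L2_measurable\<close>)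
next
  assume f: "f \<in> L2_rad" and g: "g \<in> L2_rad" and fg: "cone_rel f g"
  define F where "F j = ball_trunc (real j) f" for j
  have fL: "f \<in> L2" using f by (simp add: L2_rad_iff)
  have F: "F j \<in> L2_rad" "integrable lborel (F j)" for j
    unfolding F_def by (rule L2_rad_ball_trunc[OF f], rule ball_trunc_integrable[OF fL])
  have "\<exists>g. g \<in> L2_rad \<and> cone_rel (F j) g" for j using cone_rel_exists[OF F(1)] by blast
  then obtain G where G: "\<And>j. G j \<in> L2_rad" "\<And>j. cone_rel (F j) (G j)" by metis
  have lim: "L2_tendsto F f sequentially" unfolding F_def by (rule ball_trunc_LIMSEQ[OF fL])
  have GL: "G j \<in> L2" for j using G(1) by (simp add: L2_rad_iff)
  show "is_riesz_cone (- (real CARD('m) / 2)) f g"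
    unfolding is_riesz_cone_def
    using f g F GL G(2) cone_rel_integrable_iff[OF F(2,1) GL] lim cone_rel_tendsto[OF fg G(2) lim] by blast
qed

text \<open>Since \<open>T\<close> relates representatives, being a map onto is split into totality,
  surjectivity and an equivalence of \<open>ae_eq\<close> that gives well-definedness and
  injectivity together. Agreement with the literal operator on integrable functions ties the
  extension to the integral; linearity turns the norm identity into a statement about
  distances.\<close>

theorem theorem6:
  fixes n :: nat and \<gamma> :: real
    and T :: "((real^'m) \<times> (real^'m) \<Rightarrow> complex) \<Rightarrow> ((real^'m) \<times> (real^'m) \<Rightarrow> complex) \<Rightarrow> bool"
  assumes "n \<ge> 2" and "CARD('m) = n - 1"
    and T: "T = is_riesz_cone (- ((real n - 1) / 2))"
  shows
    "(\<forall>f \<in> H_rad \<gamma>. \<exists>g \<in> H_rad \<gamma>. T f g) \<and>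
     (\<forall>g \<in> H_rad \<gamma>. \<exists>f \<in> H_rad \<gamma>. T f g) \<and>
     (\<forall>f \<in> H_rad \<gamma>. \<forall>f' \<in> H_rad \<gamma>. \<forall>g g'. T f g \<and> T f' g' \<longrightarrow> (ae_eq f f' \<longleftrightarrow> ae_eq g g')) \<and>
     (\<forall>f \<in> H_rad \<gamma>. \<forall>g. integrable lborel f \<and> T f g \<longrightarrow>
        is_riesz1 (- ((real n - 1) / 2)) (cone_transform f) g) \<and>
     (\<forall>f \<in> H_rad \<gamma>. \<forall>f' \<in> H_rad \<gamma>. \<forall>g g' a b. T f g \<and> T f' g' \<longrightarrow>
        T (\<lambda>z. a * f z + b * f' z) (\<lambda>z. a * g z + b * g' z)) \<and>
     (\<forall>f \<in> H_rad \<gamma>. \<forall>g. T f g \<longrightarrow>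
        g \<in> H_rad \<gamma> \<and> H_norm \<gamma> g = (2 * pi) powr ((real n - 1) / 2) * H_norm \<gamma> f)"
proof -
  \<comment> \<open>The bound on \<open>n\<close> makes the truncated subtraction agree with the
    real one.\<close>
  have n: "real n - 1 = real CARD('m)" using assms(1,2) by simp
  have Tiff: "T f g \<longleftrightarrow> f \<in> L2_rad \<and> g \<in> L2_rad \<and> cone_rel f g" for f g
    unfolding T n by (rule is_riesz_cone_iff)
  have norm_sq: "H_norm_sq \<gamma> g = ennreal ((2 * pi) ^ CARD('m)) * H_norm_sq \<gamma> f" if "cone_rel f g"
    for f g :: "(real^'m) \<times> (real^'m) \<Rightarrow> complex"
    using H_norm_sq_cone_rel[OF that] by simp
  have fin: "H_norm_sq \<gamma> g < \<infinity> \<longleftrightarrow> H_norm_sq \<gamma> f < \<infinity>" if "cone_rel f g"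
    for f g :: "(real^'m) \<times> (real^'m) \<Rightarrow> complex"
    unfolding norm_sq[OF that] by (auto simp: ennreal_mult_less_top)
  have H: "f \<in> H_rad \<gamma> \<longleftrightarrow> f \<in> L2_rad \<and> H_norm_sq \<gamma> f < \<infinity>" for f :: "(real^'m) \<times> (real^'m) \<Rightarrow> complex"
    by (simp add: H_rad_def)
  have c1: "\<exists>g \<in> H_rad \<gamma>. T f g" if "f \<in> H_rad \<gamma>" for f
  proof -
    have f: "f \<in> L2_rad" "H_norm_sq \<gamma> f < \<infinity>" using that by (simp_all only: H)
    obtain g where g: "g \<in> L2_rad" "cone_rel f g" using cone_rel_exists[OF f(1)] .
    show ?thesis by (rule bexI[of _ g]) (use f g fin[OF g(2)] in \<open>simp_all only: H Tiff\<close>)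
  qed
  have c2: "\<exists>f \<in> H_rad \<gamma>. T f g" if "g \<in> H_rad \<gamma>" for g
  proof -
    have g: "g \<in> L2_rad" "H_norm_sq \<gamma> g < \<infinity>" using that by (simp_all only: H)
    obtain f where f: "f \<in> L2_rad" "cone_rel f g" using cone_rel_surj[OF g(1)] .
    show ?thesis by (rule bexI[of _ f]) (use f g fin[OF f(2)] in \<open>simp_all only: H Tiff\<close>)
  qed
  have c3: "ae_eq f f' \<longleftrightarrow> ae_eq g g'" if "T f g" "T f' g'" for f f' g g'
    using that cone_rel_AE_eq_iff[of f g f' g'] unfolding Tiff ae_eq_def by blast
  have c4: "is_riesz1 (- ((real n - 1) / 2)) (cone_transform f) g" if "integrable lborel f" "T f g" for f g
    using that cone_rel_integrable_iff[of f g] unfolding Tiff n by (auto simp: L2_rad_iff)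
  have c5: "T (\<lambda>z. a * f z + b * f' z) (\<lambda>z. a * g z + b * g' z)" if "T f g" "T f' g'" for f f' g g' a b
    using that unfolding Tiff by (auto intro!: L2_rad_add L2_rad_cmult cone_rel_add cone_rel_cmult)
  have c6: "g \<in> H_rad \<gamma> \<and> H_norm \<gamma> g = (2 * pi) powr ((real n - 1) / 2) * H_norm \<gamma> f"
    if "f \<in> H_rad \<gamma>" "T f g" for f g
  proof
    show "g \<in> H_rad \<gamma>" using that fin unfolding H Tiff by blast
    have "H_norm \<gamma> g = sqrt ((2 * pi) ^ CARD('m)) * H_norm \<gamma> f"
    proof -
      have fg: "cone_rel f g" using that by (simp only: Tiff)
      have "enn2real (H_norm_sq \<gamma> g) = (2 * pi) ^ CARD('m) * enn2real (H_norm_sq \<gamma> f)"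
        unfolding norm_sq[OF fg] enn2real_mult by simp
      then show ?thesis by (simp only: H_norm_def real_sqrt_mult)
    qed
    \<comment> \<open>The identity is checked by squaring: the real exponent doubles to the
      dimension.\<close>
    also have "sqrt ((2 * pi) ^ CARD('m)) = (2 * pi) powr ((real n - 1) / 2)"
    proof (rule real_sqrt_unique)
      have "((2 * pi) powr ((real n - 1) / 2))\<^sup>2 = (2 * pi) powr ((real n - 1) / 2 + (real n - 1) / 2)"
        unfolding power2_eq_square powr_add ..
      also have "\<dots> = (2 * pi) ^ CARD('m)"
        unfolding field_sum_of_halves n by (rule powr_realpow) simp
      finally show "((2 * pi) powr ((real n - 1) / 2))\<^sup>2 = (2 * pi) ^ CARD('m)" .
    qed simp
    finally show "H_norm \<gamma> g = (2 * pi) powr ((real n - 1) / 2) * H_norm \<gamma> f" .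
  qed
  show ?thesis
    by (intro conjI ballI allI impI; (elim conjE)?)
       (erule c1, erule c2, rule c3, assumption+, rule c4, assumption+, rule c5, assumption+,
        rule c6[THEN conjunct1], assumption+, rule c6[THEN conjunct2], assumption+)
qed

end
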